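(* Let $K$ be a field of characteristic zero, $S=K[x_0,x_1,x_2]$, and let $C:f=0$ be a reduced plane curve of degree $d\ge2$ in $\mathbb{P}^2$, with Milnor algebra $M(f)=S/J_f$. For a generic linear form $l\in S_1$, multiplication by $l$ induces injective morphisms $M(f)_i\to M(f)_{i+1}$ for $i<(3d-6)/2$. Moreover, with $i_0=[(3d-6)/2]$, the morphisms $M(f)_i\to M(f)_{i+1}$ induced by multiplication by $l$ are surjective for all $i\ge i_0$ if and only if $ct(C)\ge 3(d-2)-i_0$.
   Context: $f\in S$ is homogeneous of degree $d$, $J_f$ is the Jacobian ideal generated by the partial derivatives of $f$. The coincidence threshold is $ct(C)=\max\{q:\dim_K M(f)_k=\dim_K M(f_s)_k\text{ for all }k\le q\}$, where $f_s\in S$ is any homogeneous polynomial of degree $d$ such that $f_s=0$ is a smooth curve in $\mathbb{P}^2$ (with $ct(C)=+\infty$ if $C$ is smooth). "Generic linear form" means a linear form in some nonempty Zariski open subset of $S_1$. $[x]$ denotes the integer part of $x$. *)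

theory Defs
  imports
    "HOL-Library.Poly_Mapping"
    "HOL-Library.Numeral_Type"
    "HOL-Library.Extended_Nat"
    "HOL-Computational_Algebra.Squarefree"
    "HOL-Algebra.QuotRing"
    "HOL-Algebra.Embedded_Algebras"
    "HOL-Algebra.Algebraic_Closure_Type"
begin

text \<open>
  \<open>S = K[x\<^sub>0, x\<^sub>1, x\<^sub>2]\<close> is the monoid algebra of the exponent vectors \<open>3 \<Rightarrow>\<^sub>0 nat\<close>; the
  multiplication of \<^typ>\<open>'b \<Rightarrow>\<^sub>0 'a\<close> is convolution. The variables are indexed by the
  three-element type \<^typ>\<open>3\<close>.
\<close>

type_synonym 'a poly3 = "(3 \<Rightarrow>\<^sub>0 nat) \<Rightarrow>\<^sub>0 'a"

definition monom_degree :: "(3 \<Rightarrow>\<^sub>0 nat) \<Rightarrow> nat" where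
  "monom_degree m = (\<Sum>j\<in>UNIV. Poly_Mapping.lookup m j)"

text \<open>The graded piece \<open>S\<^sub>k\<close>, which includes the zero polynomial.\<close>

definition forms :: "nat \<Rightarrow> 'a::zero poly3 set" where
  "forms k = {p. \<forall>m\<in>Poly_Mapping.keys p. monom_degree m = k}"

definition partial_deriv :: "3 \<Rightarrow> 'a::comm_ring_1 poly3 \<Rightarrow> 'a poly3" where
  "partial_deriv j p =
     (\<Sum>m\<in>Poly_Mapping.keys p. Poly_Mapping.single (m - Poly_Mapping.single j 1)
                                     (of_nat (Poly_Mapping.lookup m j) * Poly_Mapping.lookup p m))"

text \<open>Evaluation at a point \<open>a\<close> after applying a homomorphism \<open>\<phi>\<close> to the coefficients.\<close>

definition eval_at :: "('a::zero \<Rightarrow> 'b::comm_ring_1) \<Rightarrow> (3 \<Rightarrow> 'b) \<Rightarrow> 'a poly3 \<Rightarrow> 'b" where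
  "eval_at \<phi> a p =
     (\<Sum>m\<in>Poly_Mapping.keys p. \<phi> (Poly_Mapping.lookup p m) * (\<Prod>j\<in>UNIV. a j ^ Poly_Mapping.lookup m j))"

text \<open>
  \<open>K\<close> need not be algebraically closed, so smoothness of the scheme \<open>f = 0\<close> in \<open>P\<^sup>2\<close> is
  tested by the Jacobian criterion at the points over the algebraic closure.
\<close>

definition smooth_curve :: "'a::field poly3 \<Rightarrow> bool" where
  "smooth_curve f \<longleftrightarrow>
     (\<forall>a :: 3 \<Rightarrow> 'a alg_closure. (\<exists>j. a j \<noteq> 0) \<longrightarrow> eval_at to_ac a f = 0 \<longrightarrow>
        (\<exists>j. eval_at to_ac a (partial_deriv j f) \<noteq> 0))"

abbreviation poly3_ring :: "'a::comm_ring_1 poly3 ring" where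
  "poly3_ring \<equiv> ring_of_type_algebra"

definition jacobian_ideal :: "'a::comm_ring_1 poly3 \<Rightarrow> 'a poly3 set" where
  "jacobian_ideal f = genideal poly3_ring (range (\<lambda>j. partial_deriv j f))"

definition milnor_algebra :: "'a::comm_ring_1 poly3 \<Rightarrow> 'a poly3 set ring" where
  "milnor_algebra f = poly3_ring Quot (jacobian_ideal f)"

definition milnor_class :: "'a::comm_ring_1 poly3 \<Rightarrow> 'a poly3 \<Rightarrow> 'a poly3 set" where
  "milnor_class f g = jacobian_ideal f +>\<^bsub>poly3_ring\<^esub> g"

text \<open>\<open>M(f)\<^sub>k\<close>, the image of \<open>S\<^sub>k\<close> in \<open>M(f)\<close>.\<close>

definition milnor_part :: "'a::comm_ring_1 poly3 \<Rightarrow> nat \<Rightarrow> 'a poly3 set set" where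
  "milnor_part f k = milnor_class f ` forms k"

text \<open>
  The copy of \<open>K\<close> inside \<open>M(f)\<close>, over which dimensions are taken. It is a subfield whenever
  \<open>J\<^sub>f\<close> is a proper ideal, in particular for forms of degree at least \<open>2\<close>.
\<close>

definition milnor_scalars :: "'a::comm_ring_1 poly3 \<Rightarrow> 'a poly3 set set" where
  "milnor_scalars f = range (\<lambda>c. milnor_class f (Poly_Mapping.single 0 c))"

definition milnor_dim :: "'a::field poly3 \<Rightarrow> nat \<Rightarrow> nat" where
  "milnor_dim f k = ring.dim (milnor_algebra f) (milnor_scalars f) (milnor_part f k)"

definition milnor_mult ::
    "'a::comm_ring_1 poly3 \<Rightarrow> 'a poly3 \<Rightarrow> 'a poly3 set \<Rightarrow> 'a poly3 set" where
  "milnor_mult f l u = milnor_class f l \<otimes>\<^bsub>milnor_algebra f\<^esub> u"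

text \<open>
  The coincidence threshold of \<open>f = 0\<close>, computed with the smooth comparison form \<open>fs\<close> of
  the same degree. If \<open>f = 0\<close> is reduced and singular, the set of admissible \<open>q\<close> is finite
  and nonempty and the supremum is its maximum.
\<close>

definition coincidence_threshold :: "'a::field poly3 \<Rightarrow> 'a poly3 \<Rightarrow> enat" where
  "coincidence_threshold f fs =
     (if smooth_curve f then \<infinity>
      else Sup {enat q | q. \<forall>k\<le>q. milnor_dim f k = milnor_dim fs k})"

text \<open>
  Zariski open subsets of \<open>S\<^sub>1\<close>, identified with affine 3-space by the coefficients of a
  linear form: the complements of the common zero loci of sets of polynomials in the three
  coefficients.
\<close>

definition linear_coeffs :: "'a::zero poly3 \<Rightarrow> 3 \<Rightarrow> 'a" where
  "linear_coeffs l j = Poly_Mapping.lookup l (Poly_Mapping.single j 1)"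

definition zariski_open_forms1 :: "'a::comm_ring_1 poly3 set \<Rightarrow> bool" where
  "zariski_open_forms1 U \<longleftrightarrow>
     (\<exists>P :: 'a poly3 set. U = {l \<in> forms 1. \<exists>p\<in>P. eval_at id (linear_coeffs l) p \<noteq> 0})"

end

theory Submission
  imports Defs "Berlekamp_Zassenhaus.Unique_Factorization_Poly"
begin

text \<open>
  Put \<open>e = d - 1\<close> and let \<open>f\<^sub>0, f\<^sub>1, f\<^sub>2\<close> be the partial derivatives of \<open>f\<close>, which are forms of
  degree \<open>e\<close> without common factor because \<open>f\<close> is squarefree.  A syzygy of their restrictions to a
  line \<open>l = 0\<close> lifts to a relation in the plane modulo \<open>l\<close>, so the kernel and the cokernel of
  multiplication by \<open>l\<close> on the Milnor algebra are governed by the syzygies on the line.  Letting the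
  line rotate and differentiating a syzygy with respect to the line, as in the Grauert-Muelich
  theorem, one finds that on the general line every syzygy of degree \<open>k\<close> with \<open>2 * k + 2 \<le> e\<close> is the
  restriction of a syzygy of \<open>f\<^sub>0, f\<^sub>1, f\<^sub>2\<close> in the plane.  This gives injectivity in the stated range, and
  counting dimensions on the line it shows that surjectivity holds iff there is no such syzygy.  For
  a smooth curve the partial derivatives have no syzygy of degree below \<open>e\<close> at all (Nullstellensatz
  and Koszul), so agreement of the dimensions of the Milnor algebras up to degree
  \<open>3 * (d - 2) - i0\<close> is the absence of the same syzygies.
\<close>

text \<open>The bound \<open>2 * k + 2 \<le> e\<close> is the price of one differentiation. Two
  syzygies of \<open>g\<close> have a cross product proportional to \<open>g\<close>; since
  \<open>g\<close> has no common factor, that product is a multiple of \<open>g\<close>, and it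
  vanishes once its degree is below \<open>e\<close>. A syzygy of degree \<open>k\<close> and its
  derivative, of degree at most \<open>k + 1\<close>, are therefore proportional when
  \<open>2 * k + 1 < e\<close>. This cross product takes the place of a splitting theorem for the
  syzygies on a line. The obstacle is the passage from the generic line, with coefficients in
  \<open>K[u, v]\<close>, to actual lines. The equivalence has to hold for every linear form of one
  open set, so failure of surjectivity must be as generic as surjectivity. A pattern
  (\<open>supported\<close>) prescribes which coefficients of a triple may occur. With a suitable
  pattern, the absence of syzygies on the generic line is certified by one nonzero
  \<open>\<delta>\<close> in \<open>K[u, v]\<close>, hence persists wherever \<open>\<delta>\<close>
  does not vanish, and the number of admissible coefficients decides surjectivity. The algebraic
  closure enters only for smooth curves.\<close>

abbreviation "lookup \<equiv> Poly_Mapping.lookup"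
abbreviation "keys \<equiv> Poly_Mapping.keys"
abbreviation deg :: "'a::zero poly \<Rightarrow> nat" where "deg \<equiv> Polynomial.degree"
abbreviation coeff :: "'a::zero poly \<Rightarrow> nat \<Rightarrow> 'a" where "coeff \<equiv> poly.coeff"
abbreviation monom :: "'a::zero \<Rightarrow> nat \<Rightarrow> 'a poly" where "monom \<equiv> Polynomial.monom"
abbreviation single :: "'b \<Rightarrow> 'a::zero \<Rightarrow> 'b \<Rightarrow>\<^sub>0 'a" where "single \<equiv> Poly_Mapping.single"
abbreviation "partials f \<equiv> \<lambda>j. partial_deriv j f"

section \<open>Monomials, evaluation and homomorphisms of ternary polynomials\<close>

lemma UNIV_three: "(UNIV :: 3 set) = {0, 1, 2}"
proof -
  have "card {0, 1, 2 :: 3} = 3" by simp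
  then show ?thesis by (intro card_subset_eq[symmetric]) auto
qed

lemma all_three: "(\<forall>j::3. P j) \<longleftrightarrow> P 0 \<and> P 1 \<and> P 2"
  by (metis (full_types) UNIV_I UNIV_three insertE singletonD)

lemma sum_three: "(\<Sum>j\<in>(UNIV :: 3 set). g j) = g 0 + g 1 + g 2"
  unfolding UNIV_three by (simp add: add.assoc)

lemma prod_three: "(\<Prod>j\<in>(UNIV :: 3 set). g j) = g 0 * g 1 * g 2"
  unfolding UNIV_three by (simp add: mult.assoc)

definition mon :: "nat \<Rightarrow> nat \<Rightarrow> nat \<Rightarrow> 3 \<Rightarrow>\<^sub>0 nat" where
  "mon a b c = single 0 a + single 1 b + single 2 c"

lemma lookup_mon [simp]:
  "lookup (mon a b c) 0 = a" "lookup (mon a b c) 1 = b" "lookup (mon a b c) 2 = c"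
  by (simp_all add: mon_def lookup_add lookup_single when_def)

lemma mon_exhaust: obtains a b c where "m = mon a b c"
proof
  show "m = mon (lookup m 0) (lookup m 1) (lookup m 2)"
  proof (rule poly_mapping_eqI)
    fix k :: 3
    have "k = 0 \<or> k = 1 \<or> k = 2" using UNIV_three by auto
    then show "lookup m k = lookup (mon (lookup m 0) (lookup m 1) (lookup m 2)) k" by (elim disjE) simp_all
  qed
qed

lemma mon_inject [simp]: "mon a b c = mon a' b' c' \<longleftrightarrow> a = a' \<and> b = b' \<and> c = c'"
  by (metis lookup_mon)

lemma monom_degree_mon [simp]: "monom_degree (mon a b c) = a + b + c"
  by (simp only: monom_degree_def sum_three lookup_mon)

lemma monom_degree_add: "monom_degree (m + m') = monom_degree m + monom_degree m'"
  by (simp add: monom_degree_def lookup_add sum.distrib)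

abbreviation cst :: "'a::zero \<Rightarrow> 'a poly3" where
  "cst c \<equiv> single 0 c"

definition Var :: "3 \<Rightarrow> 'a::zero_neq_one poly3" where
  "Var j = single (single j 1) 1"

lemma poly3_expand: "p = (\<Sum>m\<in>keys p. single m (lookup p m))"
  by (rule poly_mapping_eqI)
    (auto simp: lookup_sum lookup_single when_def in_keys_iff sum.If_cases sum.delta)

lemma poly3_induct [case_names zero single add]:
  assumes "P 0" "\<And>m c. P (single m c)" "\<And>p q. P p \<Longrightarrow> P q \<Longrightarrow> P (p + q)"
  shows "P (p :: 'a::comm_monoid_add poly3)"
proof -
  have "P (\<Sum>m\<in>M. single m (lookup p m))" if "finite M" for M
    using that by (induction M) (auto intro: assms)
  from this[of "keys p"] show ?thesis by (simp flip: poly3_expand)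
qed

lemma Var_power: "Var j ^ n = single (single j n) (1 :: 'a::comm_semiring_1)"
  by (induction n) (simp_all add: Var_def mult_single flip: single_add)

lemma single_mon:
  "single (mon a b c) (x :: 'a::comm_semiring_1) = cst x * Var 0 ^ a * Var 1 ^ b * Var 2 ^ c"
  by (simp add: mon_def Var_power mult_single)

lemma eval_at_superset:
  assumes "finite M" "keys p \<subseteq> M" "\<phi> 0 = 0"
  shows "eval_at \<phi> a p = (\<Sum>m\<in>M. \<phi> (lookup p m) * (\<Prod>j\<in>UNIV. a j ^ lookup m j))"
  unfolding eval_at_def using assms by (intro sum.mono_neutral_left) (auto simp: in_keys_iff)

lemma eval_at_add:
  assumes "comm_ring_hom \<phi>"
  shows "eval_at \<phi> a (p + q) = eval_at \<phi> a p + eval_at \<phi> a q"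
proof -
  interpret comm_ring_hom \<phi> by fact
  let ?M = "keys p \<union> keys q"
  have "finite ?M" "keys (p + q) \<subseteq> ?M" "keys p \<subseteq> ?M" "keys q \<subseteq> ?M"
    using keys_add[of p q] by auto
  then show ?thesis
    by (simp add: eval_at_superset[of ?M] lookup_add hom_add sum.distrib distrib_right)
qed

lemma eval_at_single:
  assumes "comm_ring_hom \<phi>"
  shows "eval_at \<phi> a (single m c) = \<phi> c * (\<Prod>j\<in>UNIV. a j ^ lookup m j)"
proof -
  interpret comm_ring_hom \<phi> by fact
  show ?thesis by (simp add: eval_at_superset[of "{m}"])
qed

lemma eval_at_mult:
  assumes "comm_ring_hom \<phi>"
  shows "eval_at \<phi> a (p * q) = eval_at \<phi> a p * eval_at \<phi> a q"
proof -
  interpret comm_ring_hom \<phi> by fact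
  note simps = eval_at_add[OF assms] eval_at_single[OF assms]
  have z: "eval_at \<phi> a 0 = 0" by (simp add: eval_at_def)
  have 1: "eval_at \<phi> a (single m c * q) = eval_at \<phi> a (single m c) * eval_at \<phi> a q" for m c
  proof (induction q rule: poly3_induct)
    case (single m' c')
    show ?case
      by (simp add: simps mult_single lookup_add power_add prod.distrib hom_mult mult_ac)
  qed (simp_all add: simps(1) z distrib_left)
  show ?thesis
  proof (induction p rule: poly3_induct)
    case (single m c)
    show ?case by (rule 1)
  qed (simp_all add: simps(1) z distrib_right)
qed

lemma eval_at_hom:
  assumes "comm_ring_hom \<phi>"
  shows "comm_ring_hom (eval_at \<phi> a)"
proof -
  interpret comm_ring_hom \<phi> by fact
  show ?thesis
  proof
    show "eval_at \<phi> a 1 = 1"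
      using eval_at_single[OF assms, of a 0 1] by simp
    show "eval_at \<phi> a 0 = 0" by (simp add: eval_at_def)
  qed (simp_all only: eval_at_add[OF assms] eval_at_mult[OF assms])
qed

lemma eval_at_cst: "comm_ring_hom \<phi> \<Longrightarrow> eval_at \<phi> a (cst c) = \<phi> c"
  by (simp add: eval_at_single)

lemma eval_at_Var: "comm_ring_hom \<phi> \<Longrightarrow> eval_at \<phi> a (Var j) = a j"
proof -
  assume h: "comm_ring_hom \<phi>"
  interpret comm_ring_hom \<phi> by fact
  have "(\<Prod>i\<in>UNIV. a i ^ lookup (single j (1::nat)) i) = (\<Prod>i\<in>UNIV. if i = j then a i else 1)"
    by (intro prod.cong) (auto simp: lookup_single when_def)
  then show ?thesis by (simp add: Var_def eval_at_single[OF h])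
qed

lemma hom_poly3_eqI:
  assumes "comm_ring_hom H" "comm_ring_hom H'"
    and "\<And>c. H (cst c) = H' (cst c)" "\<And>j. H (Var j) = H' (Var j)"
  shows "H (p :: 'a::comm_ring_1 poly3) = H' p"
proof -
  interpret H: comm_ring_hom H by fact
  interpret H': comm_ring_hom H' by fact
  show ?thesis
  proof (induction p rule: poly3_induct)
    case (single m c)
    show ?case
      by (rule mon_exhaust[of m]) (simp only: single_mon H.hom_mult H.hom_power H'.hom_mult H'.hom_power assms(3,4))
  qed (simp_all add: H.hom_add H'.hom_add)
qed

lemma comm_ring_hom_comp:
  "comm_ring_hom f \<Longrightarrow> comm_ring_hom g \<Longrightarrow> comm_ring_hom (\<lambda>x. f (g x))"
proof -
  assume "comm_ring_hom f" "comm_ring_hom g"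
  then interpret f: comm_ring_hom f + g: comm_ring_hom g by simp_all
  show ?thesis by unfold_locales (simp_all add: f.hom_add g.hom_add f.hom_mult g.hom_mult)
qed

lemma comm_ring_hom_id: "comm_ring_hom id"
  by unfold_locales auto

lemma comm_ring_hom_pCons: "comm_ring_hom (\<lambda>c. [:c:])"
  by unfold_locales auto

lemma comm_ring_hom_poly: "comm_ring_hom (\<lambda>p. poly p (a::'a::comm_ring_1))"
  by (rule Ring_Hom_Poly.poly_hom.comm_ring_hom_axioms)

lemma comm_ring_hom_map_poly: "comm_ring_hom f \<Longrightarrow> comm_ring_hom (map_poly f)"
proof -
  assume "comm_ring_hom f"
  then interpret map_poly_comm_ring_hom f by (rule map_poly_comm_ring_hom.intro)
  show ?thesis by (rule comm_ring_hom_axioms)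
qed

text \<open>The generators besides the constants are the innermost variable
  \<open>[:[:pCons 0 1:]:]\<close>, the middle one \<open>[:pCons 0 1:]\<close> and the outermost
  one \<open>pCons 0 1\<close>; this notation is kept throughout.\<close>

lemma poly_poly_poly_eqI:
  assumes H: "comm_ring_hom H" and H': "comm_ring_hom H'"
    and "\<And>c. H [:[:[:c:]:]:] = H' [:[:[:c:]:]:]" 
    and 0: "H [:[:pCons 0 1:]:] = H' [:[:pCons 0 1:]:]" "H [:pCons 0 1:] = H' [:pCons 0 1:]" "H (pCons 0 1) = H' (pCons 0 1)"
  shows "H (p :: 'a::comm_ring_1 poly poly poly) = H' p"
proof -
  interpret H: comm_ring_hom H by fact
  interpret H': comm_ring_hom H' by fact
  have 1: "H [:[:p:]:] = H' [:[:p:]:]" for p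
  proof (induction p)
    case (pCons a p)
    have "[:[:pCons a p:]:] = [:[:[:a:]:]:] + [:[:pCons 0 1:]:] * [:[:p:]:]" by simp
    then show ?case using pCons assms by (simp only: H.hom_add H'.hom_add H.hom_mult H'.hom_mult)
  qed simp
  have 2: "H [:p:] = H' [:p:]" for p
  proof (induction p)
    case (pCons a p)
    have "[:pCons a p:] = [:[:a:]:] + [:pCons 0 1:] * [:p:]" by simp
    then show ?case using pCons assms 1 by (simp only: H.hom_add H'.hom_add H.hom_mult H'.hom_mult)
  qed simp
  show ?thesis
  proof (induction p)
    case (pCons a p)
    have "pCons a p = [:a:] + pCons 0 1 * p" by simp
    then show ?case using pCons assms 2 by (simp only: H.hom_add H'.hom_add H.hom_mult H'.hom_mult)
  qed simp
qed

text \<open>Closure under sums and products replaces \<open>pCons\<close> steps, since the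
  properties proved this way (being a dehomogenized form, degree bounds for a derivation, clearing
  of denominators) pass to products.\<close>

lemma poly_poly_induct [case_names const inner outer add mult]:
  assumes "\<And>c. P [:[:c:]:]" "P [:pCons 0 1:]" "P (pCons 0 1)"
    and add: "\<And>p q. P p \<Longrightarrow> P q \<Longrightarrow> P (p + q)" and mult: "\<And>p q. P p \<Longrightarrow> P q \<Longrightarrow> P (p * q)"
  shows "P (p :: 'a::comm_ring_1 poly poly)"
proof -
  have const: "P [:r:]" for r
  proof (induction r)
    case (pCons a r)
    have "[:pCons a r:] = [:[:a:]:] + [:pCons 0 1:] * [:r:]" by simp
    with pCons assms(1,2) show ?case by (simp only: add mult)
  qed (use assms(1)[of 0] in simp)
  show ?thesis
  proof (induction p)
    case (pCons a r)
    have "pCons a r = [:a:] + pCons 0 1 * r" by simp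
    with pCons const assms(3) show ?case by (simp only: add mult)
  qed (use assms(1)[of 0] in simp)
qed

section \<open>Proportional triples\<close>

lemma ufd_prime_factor:
  assumes "(x :: 'a::ufd) \<noteq> 0" "\<not> x dvd 1"
  obtains p where "prime_elem p" "p dvd x"
proof -
  from mset_factors_exist[OF assms] obtain F where F: "mset_factors F x" by blast
  obtain p where "p \<in># F"
    by (rule multiset_nonemptyE[OF mset_factorsD(2)[OF F]])
  with F have "irreducible p" "p dvd x"
    by (rule mset_factorsD(1), rule mset_factors_imp_dvd)
  then show thesis by (intro that[of p]) simp_all
qed

text \<open>The prime factors of \<open>a\<close> are moved into \<open>y\<close> one at a time: a
  prime dividing \<open>a\<close> misses some \<open>b j\<close>, so it divides \<open>y\<close>.
  Which \<open>b j\<close> is missed may change from prime to prime.\<close>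

lemma ufd_coprime_cancel:
  assumes "(a :: 'a::ufd) \<noteq> 0"
    and "\<And>p. prime_elem p \<Longrightarrow> p dvd a \<Longrightarrow> \<exists>j. \<not> p dvd b j"
    and "\<And>j. a dvd b j * y"
  shows "a dvd y"
proof (cases "a dvd 1")
  case False
  from mset_factors_exist[OF assms(1) this] obtain F where F: "mset_factors F a" by blast
  have "prod_mset F dvd y" if "prod_mset F \<noteq> 0" "\<And>f. f \<in># F \<Longrightarrow> prime_elem f"
    "\<And>p. prime_elem p \<Longrightarrow> p dvd prod_mset F \<Longrightarrow> \<exists>j. \<not> p dvd b j"
    "\<And>j. prod_mset F dvd b j * y" for F
    using that
  proof (induction F arbitrary: y)
    case (add f F)
    have f: "prime_elem f" using add.prems by simp
    then obtain j where "\<not> f dvd b j" using add.prems(3)[of f] by auto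
    moreover have "f dvd b j * y" using add.prems(4)[of j] dvd_mult_left by fastforce
    ultimately have "f dvd y" using f by (simp add: prime_elem_dvd_mult_iff)
    then obtain y' where y': "y = f * y'" by blast
    have dvd: "prod_mset F dvd b j * y'" for j
      using add.prems(1) add.prems(4)[of j] by (simp add: y' mult.left_commute)
    have "prod_mset F dvd y'"
    proof (rule add.IH)
      show "prod_mset F \<noteq> 0" using add.prems(1) by auto
      show "prime_elem f'" if "f' \<in># F" for f' using that add.prems(2) by auto
      show "\<exists>j. \<not> p dvd b j" if "prime_elem p" "p dvd prod_mset F" for p
        using that add.prems(3)[of p] by (simp add: dvd_mult)
      show "prod_mset F dvd b j * y'" for j by (rule dvd)
    qed
    then show ?case by (simp add: y')
  qed simp
  with F assms show ?thesis by (metis mset_factorsD(1,3) prime_elem_iff_irreducible)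
qed (use dvd_trans in blast)

text \<open>Coprime as a whole, not pairwise. For polynomials in several variables this is weaker
  than generating the unit ideal.\<close>

definition coprime_family :: "('i \<Rightarrow> 'a::comm_ring_1) \<Rightarrow> bool" where
  "coprime_family A \<longleftrightarrow> (\<forall>d. (\<forall>j. d dvd A j) \<longrightarrow> d dvd 1)"

definition proportional :: "('i \<Rightarrow> 'a::comm_ring_1) \<Rightarrow> ('i \<Rightarrow> 'a) \<Rightarrow> bool" where
  "proportional A B \<longleftrightarrow> (\<forall>i j. A i * B j = A j * B i)"

text \<open>A nonzero \<open>A i\<close> divides every \<open>A j * B i\<close>, so by coprimality
  it divides \<open>B i\<close>; the quotient then serves all indices.\<close>

lemma coprime_family_proportional:
  fixes A B :: "'i \<Rightarrow> 'a::ufd"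
  assumes "coprime_family A" "proportional A B"
  obtains h where "\<And>j. B j = h * A j"
proof -
  obtain i where i: "A i \<noteq> 0"
    using assms(1) unfolding coprime_family_def by (metis dvd_0_right dvd_0_left_iff zero_neq_one)
  have "A i dvd B i"
  proof (rule ufd_coprime_cancel[of _ A])
    fix p assume "prime_elem p" "p dvd A i"
    then show "\<exists>j. \<not> p dvd A j"
      using assms(1) unfolding coprime_family_def by (meson prime_elem_not_unit)
  next
    fix j show "A i dvd A j * B i"
      using assms(2) unfolding proportional_def by (metis dvd_triv_left)
  qed fact
  then obtain h where "B i = h * A i" by (metis dvd_def mult.commute)
  moreover from this have "B j = h * A j" for j
    using i assms(2) unfolding proportional_def
    by (metis (no_types, lifting) mult.left_commute mult_left_cancel mult.commute)
  ultimately show thesis using that by blast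
qed

section \<open>Forms\<close>

lemma forms_zero [simp]: "0 \<in> forms k"
  by (simp add: forms_def)

lemma forms_add: "p \<in> forms k \<Longrightarrow> q \<in> forms k \<Longrightarrow> p + q \<in> forms k"
  using keys_add[of p q] by (auto simp: forms_def)

lemma forms_uminus: "(p :: 'a::ab_group_add poly3) \<in> forms k \<Longrightarrow> - p \<in> forms k"
  by (simp add: forms_def in_keys_iff)

lemma forms_diff: "p \<in> forms k \<Longrightarrow> q \<in> forms k \<Longrightarrow> (p - q :: 'a::ab_group_add poly3) \<in> forms k"
  using forms_add[OF _ forms_uminus, of p k q] by simp

lemma forms_sum: "(\<And>x. x \<in> I \<Longrightarrow> g x \<in> forms k) \<Longrightarrow> (\<Sum>x\<in>I. g x) \<in> forms k"
  by (induction I rule: infinite_finite_induct) (auto intro: forms_add)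

lemma forms_single: "monom_degree m = k \<Longrightarrow> single m c \<in> forms k"
  by (simp add: forms_def)

lemma forms_mult: "p \<in> forms k \<Longrightarrow> q \<in> forms l \<Longrightarrow> p * q \<in> forms (k + l)"
  using keys_mult[of p q] by (fastforce simp: forms_def monom_degree_add)

lemma forms_cst [simp]: "cst c \<in> forms 0"
  by (rule forms_single) (simp add: monom_degree_def)

lemma forms_Var [simp]: "Var j \<in> forms (Suc 0)"
  unfolding Var_def by (rule forms_single) (simp add: monom_degree_def lookup_single when_def)

lemma forms_power: "p \<in> forms k \<Longrightarrow> p ^ n \<in> forms (n * k)"
proof (induction n)
  case 0
  then show ?case by (simp flip: single_one)
qed (auto intro: forms_mult)

lemma forms_Var_power: "Var j ^ n \<in> forms n"
  using forms_power[OF forms_Var, of j n] by simp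

lemma forms_cst_mult: "p \<in> forms k \<Longrightarrow> cst c * p \<in> forms k"
  using forms_mult[OF forms_cst, of p k c] by simp

lemma lookup_forms: "p \<in> forms k \<Longrightarrow> monom_degree m \<noteq> k \<Longrightarrow> lookup p m = 0"
  by (auto simp: forms_def in_keys_iff)

lemma mon_in_keys_forms: "mon a b c \<in> keys p \<Longrightarrow> p \<in> forms k \<Longrightarrow> a + b + c = k"
  unfolding forms_def by auto

lemma forms_induct [consumes 1, case_names zero single add]:
  assumes "p \<in> forms k" "P 0" "\<And>a b c x. a + b + c = k \<Longrightarrow> P (single (mon a b c) x)"
    "\<And>p q. P p \<Longrightarrow> P q \<Longrightarrow> P (p + q)"
  shows "P (p :: 'a::comm_monoid_add poly3)"
proof -
  have "P (\<Sum>m\<in>M. single m (lookup p m))" if "finite M" "M \<subseteq> keys p" for M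
    using that
  proof (induction M)
    case (insert m M)
    have "P (single m (lookup p m))"
    proof (rule mon_exhaust[of m])
      fix a b c assume "m = mon a b c"
      with insert.prems mon_in_keys_forms[OF _ assms(1)] show ?thesis by (auto intro: assms(3))
    qed
    with insert show ?case by (simp add: assms(4))
  qed (simp add: assms(2))
  from this[of "keys p"] show ?thesis by (simp flip: poly3_expand)
qed

lemma lookup_cst_mult: "lookup (cst c * p) m = c * lookup p (m :: 3 \<Rightarrow>\<^sub>0 nat)"
  by (simp flip: mult_map_scale_conv_mult add: map.rep_eq when_def)

lemma lookup_Var_mult:
  "lookup (Var j * p) m = (if lookup m j > 0 then lookup p (m - single j 1) else (0 :: 'a::comm_ring_1))"
proof (induction p rule: poly3_induct)
  case (single m' c)
  have "single j 1 + m' = m \<longleftrightarrow> lookup m j > 0 \<and> m' = m - single j 1"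
  proof safe
    assume "lookup m j > 0"
    then show "single j 1 + (m - single j 1) = m"
      by (intro poly_mapping_eqI) (auto simp: lookup_add lookup_minus lookup_single when_def)
  qed (simp_all add: lookup_add)
  then show ?case by (auto simp: Var_def mult_single lookup_single when_def)
qed (auto simp: distrib_left lookup_add)

lemma lookup_partial_deriv:
  "lookup (partial_deriv j p) m
    = of_nat (Suc (lookup m j)) * lookup p (m + single j 1)"
proof -
  let ?e = "single j (1 :: nat)"
  \<comment> \<open>Truncated subtraction also sends exponents without the variable \<open>j\<close>
    to \<open>m\<close>, but these carry the factor zero; a single term of the sum remains.\<close>
  have eq: "m' - ?e = m \<longleftrightarrow> m' = m + ?e" if "lookup m' j \<noteq> 0" for m'
  proof safe
    show "m' = m' - ?e + ?e"
      using that by (intro poly_mapping_eqI) (auto simp: lookup_add lookup_minus lookup_single when_def)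
  qed simp
  have "lookup (partial_deriv j p) m = (\<Sum>m'\<in>keys p. if m' = m + ?e then of_nat (lookup m' j) * lookup p m' else 0)"
    unfolding partial_deriv_def lookup_sum lookup_single when_def
  proof (rule sum.cong[OF refl])
    fix m'
    show "(if m' - ?e = m then of_nat (lookup m' j) * lookup p m' else 0) =
        (if m' = m + ?e then of_nat (lookup m' j) * lookup p m' else 0)"
      using eq[of m'] by (cases "lookup m' j = 0") simp_all
  qed
  also have "\<dots> = of_nat (lookup (m + ?e) j) * lookup p (m + ?e)"
    by (simp add: in_keys_iff)
  finally show ?thesis by (simp add: lookup_add)
qed

lemma partial_deriv_add: "partial_deriv j (p + q) = partial_deriv j p + partial_deriv j q"
  by (rule poly_mapping_eqI) (simp add: lookup_partial_deriv lookup_add distrib_left)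

lemma partial_deriv_zero [simp]: "partial_deriv j 0 = 0"
  by (simp add: partial_deriv_def)

lemma partial_deriv_single:
  "partial_deriv j (single m c) = single (m - single j 1) (of_nat (lookup m j) * c)"
  by (cases "c = 0") (simp_all add: partial_deriv_def)

lemma partial_deriv_forms:
  assumes "p \<in> forms k" shows "partial_deriv j p \<in> forms (k - 1)"
  unfolding forms_def
proof safe
  fix m assume "m \<in> keys (partial_deriv j p)"
  then have "m + single j 1 \<in> keys p"
    by (auto simp: in_keys_iff lookup_partial_deriv)
  with assms have "monom_degree m + monom_degree (single j (1::nat)) = k"
    unfolding forms_def by (metis (mono_tags, lifting) mem_Collect_eq monom_degree_add)
  then show "monom_degree m = k - 1" by (simp add: monom_degree_def lookup_single when_def)
qed

lemma euler_formula:
  assumes "p \<in> forms k"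
  shows "(\<Sum>j\<in>UNIV. Var j * partial_deriv j p) = cst (of_nat k) * p"
proof (rule poly_mapping_eqI)
  fix m
  have "lookup (Var j * partial_deriv j p) m = of_nat (lookup m j) * lookup p m" for j
  proof (cases "lookup m j > 0")
    case True
    have "m - single j 1 + single j 1 = m"
      using True by (intro poly_mapping_eqI) (auto simp: lookup_add lookup_minus lookup_single when_def)
    with True show ?thesis
      unfolding lookup_Var_mult lookup_partial_deriv by (simp add: lookup_minus)
  qed (simp add: lookup_Var_mult)
  then have "lookup (\<Sum>j\<in>UNIV. Var j * partial_deriv j p) m = of_nat (monom_degree m) * lookup p m"
    by (simp add: lookup_sum monom_degree_def sum_distrib_right)
  then show "lookup (\<Sum>j\<in>UNIV. Var j * partial_deriv j p) m = lookup (cst (of_nat k) * p) m"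
    using lookup_forms[OF assms, of m] unfolding lookup_cst_mult by (cases "monom_degree m = k") simp_all
qed

section \<open>The affine chart and the line at infinity\<close>

text \<open>The affine plane \<open>x1 = 1\<close> with coordinate ring \<open>K[s][w]\<close>,
  where \<open>s = x0\<close> is the inner and \<open>w = x2\<close> the outer variable.\<close>

definition chart :: "'a::comm_ring_1 poly3 \<Rightarrow> 'a poly poly" where
  "chart = eval_at (\<lambda>c. [:[:c:]:]) (\<lambda>j. if j = 0 then [:pCons 0 1:] else if j = 1 then 1 else (pCons 0 1))"

text \<open>The line \<open>x1 = 0\<close> missing from the chart, parametrized by
  \<open>(1 : 0 : z)\<close>. This is the point at infinity of the lines of slope \<open>z\<close>,
  which is why \<open>at_inf\<close> reappears as a leading coefficient. The point
  \<open>(0 : 0 : 1)\<close> is left out.\<close>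

definition at_inf :: "'a::comm_ring_1 poly3 \<Rightarrow> 'a poly" where
  "at_inf = eval_at (\<lambda>c. [:c:]) (\<lambda>j. if j = 0 then 1 else if j = 1 then 0 else (pCons 0 1))"

lemma comm_ring_hom_cst2: "comm_ring_hom (\<lambda>c. [:[:c:]:])"
  by (rule comm_ring_hom_comp[OF comm_ring_hom_pCons comm_ring_hom_pCons])

lemma comm_ring_hom_cst3: "comm_ring_hom (\<lambda>c. [:[:[:c:]:]:])"
  by (rule comm_ring_hom_comp[OF comm_ring_hom_pCons comm_ring_hom_cst2])

interpretation chart: comm_ring_hom chart
  unfolding chart_def by (rule eval_at_hom[OF comm_ring_hom_cst2])

interpretation at_inf: comm_ring_hom at_inf
  unfolding at_inf_def by (rule eval_at_hom[OF comm_ring_hom_pCons])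

lemma chart_cst [simp]: "chart (cst c) = [:[:c:]:]"
  by (simp add: chart_def eval_at_cst[OF comm_ring_hom_cst2])

lemma chart_Var [simp]: "chart (Var 0) = [:pCons 0 1:]" "chart (Var 1) = 1" "chart (Var 2) = pCons 0 1"
  by (simp_all add: chart_def eval_at_Var[OF comm_ring_hom_cst2])

lemma at_inf_cst [simp]: "at_inf (cst c) = [:c:]"
  by (simp add: at_inf_def eval_at_cst[OF comm_ring_hom_pCons])

lemma at_inf_Var [simp]:
  "at_inf (Var 0) = 1" "at_inf (Var 1) = 0" "at_inf (Var 2) = pCons 0 1"
  by (simp_all add: at_inf_def eval_at_Var[OF comm_ring_hom_pCons])

lemma pCons_0_1_power: "pCons 0 (1 :: 'a::comm_ring_1 poly) ^ n = monom 1 n"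
  by (simp add: monom_altdef)

lemma const_poly_power: "[:c:] ^ n = [:c ^ n :: 'a::comm_ring_1:]"
  by (induction n) simp_all

lemma chart_single: "chart (single (mon a b c) x) = monom (monom x a) c"
  unfolding single_mon chart.hom_mult chart.hom_power chart_cst chart_Var const_poly_power pCons_0_1_power
  by (simp add: smult_monom)

lemma at_inf_single:
  "at_inf (single (mon a b c) x) = (if b = 0 then monom x c else 0)"
  unfolding single_mon at_inf.hom_mult at_inf.hom_power at_inf_cst at_inf_Var pCons_0_1_power
  by (cases b) (simp_all add: smult_monom)

text \<open>Homogeneity restores the exponent of \<open>x1\<close> that the chart forgets.\<close>

lemma coeff_chart_forms:
  assumes "p \<in> forms k" "a + c \<le> k"
  shows "coeff (coeff (chart p) c) a = lookup p (mon a (k - a - c) c)"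
  using assms(1)
proof (induction rule: forms_induct)
  case (single a' b' c' x)
  then show ?case using assms(2) by (auto simp: chart_single lookup_single when_def)
qed (simp_all add: chart.hom_add lookup_add)

lemma chart_inj_forms:
  assumes "p \<in> forms k" "chart p = 0" shows "p = 0"
proof (rule poly_mapping_eqI)
  fix m
  show "lookup p m = lookup 0 m"
  proof (rule mon_exhaust[of m])
    fix a b c assume m: "m = mon a b c"
    show ?thesis
    proof (cases "a + b + c = k")
      case True
      then have "k - a - c = b" by simp
      with coeff_chart_forms[OF assms(1), of a c] True assms(2) show ?thesis by (simp add: m)
    qed (use lookup_forms[OF assms(1), of m] in \<open>simp add: m\<close>)
  qed
qed

lemma chart_eq_forms: "p \<in> forms k \<Longrightarrow> q \<in> forms k \<Longrightarrow> chart p = chart q \<Longrightarrow> p = q"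
  using chart_inj_forms[OF forms_diff, of p k q] by (simp add: chart.hom_minus)

lemma coeff_at_inf_forms:
  assumes "p \<in> forms k" "c \<le> k"
  shows "coeff (at_inf p) c = lookup p (mon (k - c) 0 c)"
  using assms(1)
proof (induction rule: forms_induct)
  case (single a' b' c' x)
  then show ?case using assms(2) by (auto simp: at_inf_single lookup_single when_def)
qed (simp_all add: at_inf.hom_add lookup_add)

lemma degree_at_inf_forms:
  assumes "p \<in> forms k" shows "deg (at_inf p) \<le> k"
  using assms
proof (induction rule: forms_induct)
  case (single a b c x)
  then show ?case by (auto simp: at_inf_single intro: order_trans[OF degree_monom_le])
qed (simp_all add: at_inf.hom_add degree_add_le)

lemma at_inf_forms_ex:
  assumes "deg h \<le> k" obtains p where "p \<in> forms k" "at_inf p = h"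
proof
  let ?p = "\<Sum>i\<le>k. single (mon (k - i) 0 i) (coeff h i)"
  show "?p \<in> forms k" by (rule forms_sum) (auto intro!: forms_single)
  show "at_inf ?p = h"
    unfolding at_inf.hom_sum at_inf_single using assms by (simp add: poly_as_sum_of_monoms')
qed

text \<open>The monomials of one degree without \<open>x1\<close> have distinct images under
  \<open>at_inf\<close>, so all their coefficients vanish.\<close>

lemma at_inf_zero_dvd:
  assumes "p \<in> forms (Suc k)" "at_inf p = 0"
  obtains q where "q \<in> forms k" "p = Var 1 * q"
proof
  let ?e = "single 1 1 :: 3 \<Rightarrow>\<^sub>0 nat"
  let ?q = "\<Sum>m\<in>keys p. single (m - ?e) (lookup p m)"
  have shift: "?e + (m - ?e) = m" if "m \<in> keys p" for m
  proof -
    have "lookup m 1 \<noteq> 0"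
    proof (rule mon_exhaust[of m], rule notI)
      fix a b c assume m: "m = mon a b c" and "lookup m 1 = 0"
      then have b: "b = 0" by simp
      have "a + c = Suc k"
        using mon_in_keys_forms[of a b c, OF _ assms(1)] that m b by simp
      then have "Suc k - c = a" "c \<le> Suc k" by simp_all
      with coeff_at_inf_forms[OF assms(1), of c] assms(2) have "lookup p m = 0"
        by (simp add: m b)
      with that show False by (simp add: in_keys_iff)
    qed
    then show ?thesis
      by (intro poly_mapping_eqI) (auto simp: lookup_add lookup_minus lookup_single when_def)
  qed
  have "Var 1 * ?q = (\<Sum>m\<in>keys p. single m (lookup p m))"
    unfolding sum_distrib_left by (rule sum.cong) (simp_all add: Var_def mult_single shift del: One_nat_def)
  then show "p = Var 1 * ?q" by (simp flip: poly3_expand)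
  show "?q \<in> forms k"
  proof (intro forms_sum forms_single)
    fix m assume "m \<in> keys p"
    then have "monom_degree (?e + (m - ?e)) = Suc k"
      using assms(1) shift unfolding forms_def by auto
    then show "monom_degree (m - ?e) = k"
      unfolding monom_degree_add by (simp add: monom_degree_def lookup_single when_def)
  qed
qed

lemma chart_partial_deriv:
  "chart (partial_deriv 0 p) = map_poly pderiv (chart p)" "chart (partial_deriv 2 p) = pderiv (chart p)"
proof -
  have add: "map_poly pderiv (q + q') = map_poly pderiv q + map_poly pderiv q'" for q q' :: "'a poly poly"
    by (rule poly_eqI) (simp add: coeff_map_poly pderiv_add)
  have sub: "mon a b c - single 0 1 = mon (a - 1) b c"
    "mon a b c - single 2 1 = mon a b (c - 1)" for a b c
    by (rule poly_mapping_eqI, simp add: mon_def lookup_add lookup_minus lookup_single when_def)+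
  have "chart (partial_deriv 0 p) = map_poly pderiv (chart p) \<and> chart (partial_deriv 2 p) = pderiv (chart p)"
  proof (induction p rule: poly3_induct)
    case (single m x)
    show ?case
    proof (rule mon_exhaust[of m])
      fix a b c assume m: "m = mon a b c"
      show ?thesis
        unfolding m partial_deriv_single sub chart_single lookup_mon
        by (simp add: map_poly_monom pderiv_monom)
           (simp add: of_nat_poly smult_monom)
    qed
  qed (simp_all add: partial_deriv_add chart.hom_add pderiv_add add)
  then show "chart (partial_deriv 0 p) = map_poly pderiv (chart p)" "chart (partial_deriv 2 p) = pderiv (chart p)"
    by auto
qed

text \<open>Homogenization without control of the degree: summands are brought to a common degree by
  powers of \<open>Var 1\<close>, which becomes 1 in the chart. The sharp degree comes later, in
  \<open>forms_of_degree\<close>.\<close>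

lemma chart_forms_ex:
  obtains k p where "p \<in> forms k" "chart p = q"
proof -
  define good where "good q \<longleftrightarrow> (\<exists>k. \<exists>p\<in>forms k. chart p = q)" for q :: "'a poly poly"
  have add: "good (q + q')" if "good q" "good q'" for q q'
  proof -
    from that obtain k p k' p' where *: "p \<in> forms k" "chart p = q" "p' \<in> forms k'" "chart p' = q'"
      unfolding good_def by blast
    have "Var 1 ^ k' * p + Var 1 ^ k * p' \<in> forms (k + k')"
      using forms_mult[OF forms_Var_power[of 1 k'] *(1)] forms_mult[OF forms_Var_power[of 1 k] *(3)]
      by (auto intro: forms_add simp: add.commute)
    moreover have "chart (Var 1 ^ k' * p + Var 1 ^ k * p') = q + q'"
      by (simp add: chart.hom_add chart.hom_mult chart.hom_power *)
    ultimately show ?thesis unfolding good_def by blast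
  qed
  have mult: "good (q * q')" if "good q" "good q'" for q q'
    using that unfolding good_def by (metis chart.hom_mult forms_mult)
  have 1: "good [:[:c:]:]" for c unfolding good_def by (metis chart_cst forms_cst)
  have 2: "good [:pCons 0 1:]" "good (pCons 0 1)" unfolding good_def by (metis chart_Var forms_Var)+
  have "good q" by (induction q rule: poly_poly_induct) (rule 1 2 add mult; assumption)+
  then show thesis using that unfolding good_def by blast
qed

section \<open>Coordinates adapted to the lines of the plane\<close>

text \<open>The induction is on the number of primes in a multiple \<open>prod_mset F\<close> of
  \<open>A i\<close>: cancelling a common prime of the family uses up one of them. Asking for a
  multiple instead of a factorization absorbs all units.\<close>

lemma ufd_content:
  fixes A :: "'i \<Rightarrow> 'a::ufd"
  assumes "A i \<noteq> 0"
  obtains c A' where "\<And>j. A j = c * A' j" "coprime_family A'"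
proof -
  have "\<exists>c A'. (\<forall>j. A j = c * A' j) \<and> coprime_family A'"
    if "\<And>f. f \<in># F \<Longrightarrow> prime_elem f" "A i dvd prod_mset F" for F and A :: "'i \<Rightarrow> 'a"
    using that
  proof (induction "size F" arbitrary: F A)
    case 0
    then have "A i dvd 1" by simp
    then have "coprime_family A" unfolding coprime_family_def using dvd_trans by blast
    then show ?case by (intro exI[of _ 1]) auto
  next
    case (Suc n)
    have nz: "prod_mset F \<noteq> 0"
      using Suc.prems(1) by (metis prod_mset_zero_iff not_prime_elem_zero)
    then have Ai: "A i \<noteq> 0" using Suc.prems(2) by auto
    show ?case
    proof (cases "coprime_family A")
      case True
      then show ?thesis by (intro exI[of _ 1]) auto
    next
      case False
      then obtain d where d: "\<And>j. d dvd A j" "\<not> d dvd 1" unfolding coprime_family_def by blast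
      with Ai have "d \<noteq> 0" by (metis dvd_0_left)
      obtain p where p: "prime_elem p" "p dvd d"
        by (rule ufd_prime_factor[OF \<open>d \<noteq> 0\<close> d(2)])
      with d have "\<forall>j. \<exists>a. A j = p * a" by (meson dvd_def dvd_trans)
      then obtain A' where A': "\<And>j. A j = p * A' j" by metis
      have "p dvd prod_mset F" using Suc.prems(2) A' by (metis dvd_mult_left)
      then obtain f where f: "f \<in># F" "p dvd f"
        using prime_elem_dvd_prod_mset p(1) by metis
      then obtain u where u: "f = p * u" by blast
      have "u dvd 1"
        using Suc.prems(1)[OF f(1)] p(1) u
        by (meson irreducibleD prime_elem_imp_irreducible prime_elem_not_unit)
      have "p * A' i dvd p * (u * prod_mset (F - {#f#}))"
        using Suc.prems(2) f(1) u A' by (metis insert_DiffM prod_mset.add_mset mult.assoc)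
      then have "A' i dvd u * prod_mset (F - {#f#})"
        using p(1) by (simp add: prime_elem_def)
      then have "A' i dvd prod_mset (F - {#f#})"
        using \<open>u dvd 1\<close> by (metis dvd_def dvd_mult_cancel_left mult.left_commute mult.right_neutral dvd_trans dvd_mult mult.commute)
      moreover have "n = size (F - {#f#})" using Suc.hyps(2) f(1) by (simp add: size_Diff_singleton)
      moreover have "\<And>f'. f' \<in># F - {#f#} \<Longrightarrow> prime_elem f'" using Suc.prems(1) by (meson in_diffD)
      ultimately obtain c A'' where "\<forall>j. A' j = c * A'' j" "coprime_family A''"
        using Suc.hyps(1)[of "F - {#f#}" A'] by blast
      then show ?thesis by (intro exI[of _ "p * c"] exI[of _ A'']) (simp add: A' mult.assoc)
    qed
  qed
  moreover have "\<exists>F. (\<forall>f. f \<in># F \<longrightarrow> prime_elem f) \<and> A i dvd prod_mset F"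
  proof (cases "A i dvd 1")
    case True
    then show ?thesis by (intro exI[of _ "{#}"]) simp
  next
    case False
    from mset_factors_exist[OF assms this] obtain F where "mset_factors F (A i)" by blast
    then show ?thesis by (intro exI[of _ F]) (metis dvd_refl mset_factorsD(1,3) prime_elem_iff_irreducible)
  qed
  ultimately show thesis using that by metis
qed

text \<open>The arguments \<open>x\<close>, \<open>y\<close>, \<open>z\<close> replace the
  innermost, the middle and the outermost variable, in this order.\<close>

definition subst3 :: "'a::comm_ring_1 poly poly poly \<Rightarrow> 'a poly poly poly \<Rightarrow> 'a poly poly poly
    \<Rightarrow> 'a poly poly poly \<Rightarrow> 'a poly poly poly" where
  "subst3 x y z p =
    poly (map_poly (\<lambda>q. poly (map_poly (\<lambda>r. poly (map_poly (\<lambda>c. [:[:[:c:]:]:]) r) x) q) y) p) z"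

lemma comm_ring_hom_subst_aux:
  "comm_ring_hom (\<lambda>r. poly (map_poly (\<lambda>c. [:[:[:c:]:]:]) r) (x :: 'a::comm_ring_1 poly poly poly))"
  by (rule comm_ring_hom_comp[OF comm_ring_hom_poly comm_ring_hom_map_poly[OF comm_ring_hom_cst3]])

lemma comm_ring_hom_subst_aux2:
  "comm_ring_hom (\<lambda>q. poly (map_poly (\<lambda>r. poly (map_poly (\<lambda>c. [:[:[:c:]:]:]) r) x) q) (y :: 'a::comm_ring_1 poly poly poly))"
  by (rule comm_ring_hom_comp[OF comm_ring_hom_poly comm_ring_hom_map_poly[OF comm_ring_hom_subst_aux]])

lemma comm_ring_hom_subst3: "comm_ring_hom (subst3 x y z)"
  unfolding subst3_def
  by (rule comm_ring_hom_comp[OF comm_ring_hom_poly comm_ring_hom_map_poly[OF comm_ring_hom_subst_aux2]])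

lemma subst3_gen [simp]:
  "subst3 x y z [:[:[:c:]:]:] = [:[:[:c:]:]:]"
  "subst3 x y z [:[:pCons 0 1:]:] = x" "subst3 x y z [:pCons 0 1:] = y" "subst3 x y z (pCons 0 1) = z"
proof -
  interpret h0: comm_ring_hom "\<lambda>c :: 'a. [:[:[:c:]:]:]" by (rule comm_ring_hom_cst3)
  interpret h1: comm_ring_hom "\<lambda>r. poly (map_poly (\<lambda>c. [:[:[:c :: 'a:]:]:]) r) x"
    by (rule comm_ring_hom_subst_aux)
  interpret h2: comm_ring_hom "\<lambda>q. poly (map_poly (\<lambda>r. poly (map_poly (\<lambda>c. [:[:[:c :: 'a:]:]:]) r) x) q) y"
    by (rule comm_ring_hom_subst_aux2)
  show "subst3 x y z [:[:[:c:]:]:] = [:[:[:c:]:]:]"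
    "subst3 x y z [:[:pCons 0 1:]:] = x" "subst3 x y z [:pCons 0 1:] = y" "subst3 x y z (pCons 0 1) = z"
    by (simp_all add: subst3_def h1.map_poly_pCons_hom h2.map_poly_pCons_hom h0.map_poly_pCons_hom
        h1.hom_one h2.hom_one h0.hom_one map_poly_1')
qed

text \<open>The source of \<open>line_coords\<close> is \<open>K[s][w][u]\<close>, the ring of the points \<open>(s, w)\<close> of the chart
  together with a slope \<open>u\<close>. Its target is \<open>K[u][v][s]\<close>, where the line of slope \<open>u\<close> through
  the point is \<open>w = u s + v\<close>. The degree in \<open>s\<close> of the image of a polynomial in \<open>s, w\<close> is its
  total degree, whereas vector fields along which the lines rotate become \<open>d/du\<close> in the source.\<close>

definition line_coords :: "'a::comm_ring_1 poly poly poly \<Rightarrow> 'a poly poly poly" where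
  "line_coords = subst3 (pCons 0 1) [:pCons 0 1, [:pCons 0 1:]:] [:[:pCons 0 1:]:]"

text \<open>The intercept \<open>v = w - s * u\<close> of the line of slope \<open>u\<close> through
  the point \<open>(s, w)\<close>, as an element of \<open>K[s][w][u]\<close>.\<close>

definition offset :: "'a::comm_ring_1 poly poly poly" where
  "offset = [:pCons 0 1:] - [:[:pCons 0 1:]:] * pCons 0 1"

definition point_coords :: "'a::comm_ring_1 poly poly poly \<Rightarrow> 'a poly poly poly" where
  "point_coords = subst3 (pCons 0 1) offset [:[:pCons 0 1:]:]"

interpretation line_coords: comm_ring_hom line_coords
  unfolding line_coords_def by (rule comm_ring_hom_subst3)

interpretation point_coords: comm_ring_hom point_coords
  unfolding point_coords_def by (rule comm_ring_hom_subst3)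

lemma line_coords_gen [simp]:
  "line_coords [:[:[:c:]:]:] = [:[:[:c:]:]:]"
  "line_coords [:[:pCons 0 1:]:] = pCons 0 1" "line_coords [:pCons 0 1:] = [:pCons 0 1, [:pCons 0 1:]:]"
  "line_coords (pCons 0 1) = [:[:pCons 0 1:]:]"
  by (simp_all add: line_coords_def)

lemma point_coords_gen [simp]:
  "point_coords [:[:[:c:]:]:] = [:[:[:c:]:]:]"
  "point_coords [:[:pCons 0 1:]:] = pCons 0 1" "point_coords [:pCons 0 1:] = offset"
  "point_coords (pCons 0 1) = [:[:pCons 0 1:]:]"
  by (simp_all add: point_coords_def)

lemma line_point_coords [simp]: "line_coords (point_coords p) = p"
proof (rule poly_poly_poly_eqI[where H' = "\<lambda>p. p"])
  show "comm_ring_hom (\<lambda>p. line_coords (point_coords p))"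
    by (rule comm_ring_hom_comp) (rule line_coords.comm_ring_hom_axioms point_coords.comm_ring_hom_axioms)+
  show "line_coords (point_coords [:pCons 0 1:]) = [:pCons 0 1 :: 'a poly poly:]"
    unfolding point_coords_gen offset_def line_coords.hom_minus line_coords.hom_mult line_coords_gen by simp
qed (simp_all add: comm_ring_hom_id[unfolded id_def])

lemma point_line_coords [simp]: "point_coords (line_coords p) = p"
proof (rule poly_poly_poly_eqI[where H' = "\<lambda>p. p"])
  show "comm_ring_hom (\<lambda>p. point_coords (line_coords p))"
    by (rule comm_ring_hom_comp) (rule line_coords.comm_ring_hom_axioms point_coords.comm_ring_hom_axioms)+
  have "[:pCons 0 1, [:pCons 0 1:]:] = [:pCons 0 1:] + [:[:pCons 0 1:]:] * pCons 0 (1 :: 'a poly poly poly)"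
    by simp
  then show "point_coords (line_coords [:pCons 0 1:]) = [:pCons 0 (1 :: 'a poly poly):]"
    unfolding line_coords_gen by (simp only: point_coords.hom_add point_coords.hom_mult point_coords_gen) (simp add: offset_def)
qed (simp_all add: comm_ring_hom_id[unfolded id_def])

lemma line_coords_eq_iff [simp]: "line_coords p = line_coords q \<longleftrightarrow> p = q"
  by (metis point_line_coords)

lemma line_coords_eq_0_iff [simp]: "line_coords p = 0 \<longleftrightarrow> p = 0"
  using line_coords_eq_iff[of p 0] by simp

lemma point_coords_eq_0_iff [simp]: "point_coords p = 0 \<longleftrightarrow> p = 0"
  by (metis line_point_coords line_coords.hom_zero point_coords.hom_zero)

text \<open>The restriction of a form to the generic line. Before the change of coordinates it is
  constant in the slope, so rotating the line does not differentiate it.\<close>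

definition on_lines :: "'a::comm_ring_1 poly3 \<Rightarrow> 'a poly poly poly" where
  "on_lines p = line_coords [:chart p:]"

lemma comm_ring_hom_on_lines: "comm_ring_hom on_lines"
  unfolding on_lines_def
  by (rule comm_ring_hom_comp[OF line_coords.comm_ring_hom_axioms comm_ring_hom_comp[OF comm_ring_hom_pCons chart.comm_ring_hom_axioms]])

interpretation on_lines: comm_ring_hom on_lines
  by (rule comm_ring_hom_on_lines)

lemma on_lines_cst [simp]: "on_lines (cst c) = [:[:[:c:]:]:]"
  by (simp add: on_lines_def)

lemma on_lines_Var [simp]:
  "on_lines (Var 0) = pCons 0 1" "on_lines (Var 1) = 1" "on_lines (Var 2) = [:pCons 0 1, [:pCons 0 1:]:]"
  by (simp_all add: on_lines_def flip: one_pCons)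

lemma coeff_mult_le:
  assumes "deg p \<le> m" "deg q \<le> n"
  shows "coeff (p * q) (m + n) = coeff p m * coeff (q :: 'a::comm_semiring_1 poly) n"
proof (cases "deg p = m \<and> deg q = n")
  case False
  then have "deg p < m \<or> deg q < n" using assms by linarith
  moreover from this have "deg (p * q) < m + n"
    using assms degree_mult_le[of p q] by linarith
  ultimately show ?thesis by (auto simp: coeff_eq_0)
qed (use coeff_mult_degree_sum in auto)

lemma coeff_power_le:
  assumes "deg p \<le> m"
  shows "deg (p ^ n) \<le> m * n \<and> coeff (p ^ n) (m * n) = coeff (p :: 'a::comm_semiring_1 poly) m ^ n"
proof (induction n)
  case (Suc n)
  have "deg (p * p ^ n) \<le> m + m * n"
    using assms Suc degree_mult_le[of p "p ^ n"] by linarith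
  with coeff_mult_le[of p m "p ^ n" "m * n"] assms Suc show ?case by simp
qed simp

lemma on_lines_single:
  "on_lines (single (mon a b c) x) = [:[:[:x:]:]:] * (pCons 0 1) ^ a * [:pCons 0 1, [:pCons 0 1:]:] ^ c"
  unfolding single_mon on_lines.hom_mult on_lines.hom_power on_lines_cst on_lines_Var by simp

text \<open>On the line \<open>w = u * s + v\<close> the variables \<open>x0\<close> and
  \<open>x2\<close> have degree one in \<open>s\<close> with leading coefficients \<open>1\<close>
  and \<open>u\<close>, while \<open>x1\<close> is constant; the coefficient of \<open>s ^ k\<close>
  is therefore the value at \<open>(1 : 0 : u)\<close>.\<close>

lemma on_lines_forms:
  assumes "p \<in> forms k"
  shows "deg (on_lines p) \<le> k" "coeff (on_lines p) k = [:at_inf p:]"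
proof -
  have "deg (on_lines p) \<le> k \<and> coeff (on_lines p) k = [:at_inf p:]"
    using assms
  proof (induction rule: forms_induct)
    case (single a b c x)
    then have k: "k = a + c + b" by simp
    let ?L = "[:pCons 0 1, [:pCons 0 1:]:] :: 'a poly poly poly"
    define q where "q = [:[:[:x:]:]:] * (pCons 0 1) ^ a"
    have L: "deg (?L ^ c) \<le> c" "coeff (?L ^ c) c = [:pCons 0 1:] ^ c"
      using coeff_power_le[of ?L 1 c] by simp_all
    have q: "deg q \<le> a" "coeff q a = [:[:x:]:]"
      by (simp_all add: q_def pCons_0_1_power degree_monom_le smult_monom)
    have d: "deg (q * ?L ^ c) \<le> a + c"
      using degree_mult_le[of q "?L ^ c"] L q by linarith
    have "coeff (q * ?L ^ c) (a + c) = [:monom x c:]"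
      unfolding coeff_mult_le[OF q(1) L(1)] q(2) L(2) const_poly_power pCons_0_1_power by (simp add: smult_monom)
    with d show ?case
      unfolding on_lines_single at_inf_single q_def[symmetric] by (cases "b = 0") (auto simp: k coeff_eq_0)
  qed (simp_all add: on_lines.hom_add at_inf.hom_add degree_add_le)
  then show "deg (on_lines p) \<le> k" "coeff (on_lines p) k = [:at_inf p:]" by auto
qed

text \<open>The degree in \<open>s\<close> on the generic line measures the total degree: while a
  homogenization has too large a degree, its leading coefficient \<open>at_inf\<close> vanishes and
  a factor \<open>Var 1\<close> splits off.\<close>

lemma forms_of_degree:
  assumes "deg (line_coords [:q:]) \<le> k"
  obtains p where "p \<in> forms k" "chart p = q"
proof -
  have desc: "\<exists>p\<in>forms k. chart p = q" if "p \<in> forms (n + k)" "chart p = q" for p n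
    using that
  proof (induction n arbitrary: p)
    case (Suc n)
    have "coeff (on_lines p) (Suc n + k) = 0"
      using assms Suc.prems(2) by (intro coeff_eq_0) (simp add: on_lines_def)
    then have "at_inf p = 0" using on_lines_forms(2)[OF Suc.prems(1)] by simp
    with at_inf_zero_dvd[of p "n + k"] Suc.prems(1) obtain p' where p': "p' \<in> forms (n + k)" "p = Var 1 * p'"
      by auto
    with Suc.IH Suc.prems(2) show ?case by (simp add: chart.hom_mult)
  qed auto
  obtain N p where p: "p \<in> forms N" "chart p = q" by (rule chart_forms_ex)
  \<comment> \<open>The padding is trivial for \<open>N \<ge> k\<close>; in every case the degree
    becomes \<open>k\<close> plus something, as \<open>desc\<close> requires.\<close>
  have "Var 1 ^ (k - N) * p \<in> forms ((k - N) + N)" using p(1) by (intro forms_mult forms_Var_power)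
  moreover have "(k - N) + N = (N - k) + k" by simp
  ultimately have "Var 1 ^ (k - N) * p \<in> forms ((N - k) + k)" by metis
  from desc[OF this] p(2) show thesis
    by (auto simp: chart.hom_mult chart.hom_power intro: that)
qed

text \<open>In the coordinates \<open>u, v, s\<close> the derivative by the slope at a fixed point
  is \<open>d/du - s * d/dv\<close>, because \<open>v = w - s * u\<close>. The factor
  \<open>s\<close> accounts for the successor.\<close>

lemma degree_rotate:
  "deg (line_coords (pderiv (point_coords (q :: 'a::idom poly poly poly)))) \<le> Suc (deg q)"
proof -
  define good where "good q \<longleftrightarrow> deg (line_coords (pderiv (point_coords [:q:]))) \<le> 1" for q :: "'a poly poly"
  have split: "[:a + b:] = [:a:] + [:b:]" "[:a * b:] = [:a:] * [:b:]" for a b :: "'b::comm_ring_1" by simp_all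
  have add: "good (p + q)" if "good p" "good q" for p q
    using that unfolding good_def split
    by (simp only: point_coords.hom_add pderiv_add line_coords.hom_add degree_add_le)
  have mult: "good (p * q)" if "good p" "good q" for p q
    using that unfolding good_def split
    by (simp only: point_coords.hom_mult pderiv_mult line_coords.hom_add line_coords.hom_mult line_point_coords)
      (auto intro!: degree_add_le order_trans[OF degree_mult_le])
  have 1: "good [:[:c:]:]" for c unfolding good_def by simp
  have 2: "good [:pCons 0 1:]" unfolding good_def by (simp add: pderiv_pCons)
  have 3: "good (pCons 0 1)"
  proof -
    have "pderiv offset = - [:[:pCons 0 (1 :: 'a poly):]:]"
      unfolding offset_def by (simp add: pderiv_diff pderiv_mult pderiv_pCons)
    then show ?thesis unfolding good_def point_coords_gen
      by (simp only: line_coords.hom_uminus line_coords_gen) simp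
  qed
  have good: "good q" for q by (induction q rule: poly_poly_induct) (rule 1 2 3 add mult; assumption)+
  show ?thesis
  proof (induction q)
    case (pCons a q)
    have eq: "pCons a q = [:a:] + pCons 0 1 * q" by simp
    have "line_coords (pderiv (point_coords (pCons a q)))
        = line_coords (pderiv (point_coords [:a:])) + pCons 0 1 * line_coords (pderiv (point_coords q))"
      unfolding eq point_coords.hom_add point_coords.hom_mult pderiv_add pderiv_mult point_coords_gen
        line_coords.hom_add line_coords.hom_mult line_coords_gen
      by (simp add: pderiv_pCons)
    moreover have "deg (line_coords (pderiv (point_coords [:a:]))) \<le> Suc (deg (pCons a q))"
      using good[of a] unfolding good_def by linarith
    moreover have "deg (pCons 0 1 * line_coords (pderiv (point_coords q))) \<le> Suc (deg (pCons a q))"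
    proof (cases "q = 0")
      case False
      then show ?thesis
        using pCons.IH by (intro order_trans[OF degree_mult_le]) simp
    qed simp
    ultimately show ?case by (simp only: degree_add_le)
  qed simp
qed

section \<open>Nets without fixed component\<close>

text \<open>This allows the slope to be adjoined to the ring of the plane.\<close>

lemma coprime_family_pCons:
  assumes "coprime_family (b :: 'i \<Rightarrow> 'a::idom)"
  shows "coprime_family (\<lambda>j. [:b j:])"
  unfolding coprime_family_def
proof safe
  fix d assume d: "\<forall>j. d dvd [:b j:]"
  obtain i where "b i \<noteq> 0"
    using assms unfolding coprime_family_def by (metis dvd_0_right dvd_0_left_iff zero_neq_one)
  with d have "deg d = 0"
    by (metis degree_pCons_0 dvd_imp_degree_le le_zero_eq pCons_eq_0_iff)
  then obtain c where c: "d = [:c:]" by (rule degree_eq_zeroE)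
  with d have "c dvd b j" for j by (metis coeff_pCons_0 const_poly_dvd_iff)
  with assms have "c dvd 1" unfolding coprime_family_def by blast
  then show "d dvd 1" by (simp add: c is_unit_const_poly_iff)
qed

definition cross :: "(3 \<Rightarrow> 'a::comm_ring_1) \<Rightarrow> (3 \<Rightarrow> 'a) \<Rightarrow> 3 \<Rightarrow> 'a" where
  "cross a b j = (if j = 0 then a 1 * b 2 - a 2 * b 1
     else if j = 1 then a 2 * b 0 - a 0 * b 2 else a 0 * b 1 - a 1 * b 0)"

lemma cross_simps [simp]:
  "cross a b 0 = a 1 * b 2 - a 2 * b 1"
  "cross a b 1 = a 2 * b 0 - a 0 * b 2"
  "cross a b 2 = a 0 * b 1 - a 1 * b 0"
  by (simp_all add: cross_def)

lemma proportional_iff_cross: "proportional a b \<longleftrightarrow> (\<forall>j. cross a b j = 0)"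
  unfolding proportional_def all_three cross_simps by (auto simp: mult.commute)

text \<open>Both \<open>a\<close> and \<open>b\<close> are orthogonal to \<open>g\<close>, so their
  cross product is parallel to \<open>g\<close>; as polynomial identities this is valid in any
  commutative ring.\<close>

lemma proportional_cross:
  assumes "(\<Sum>j\<in>UNIV. a j * g j) = 0" "(\<Sum>j\<in>UNIV. b j * g j) = (0 :: 'a::comm_ring_1)"
  shows "proportional g (cross a b)"
proof -
  have a: "a 0 * g 0 + a 1 * g 1 + a 2 * g 2 = 0" and b: "b 0 * g 0 + b 1 * g 1 + b 2 * g 2 = 0"
    using assms by (simp_all only: sum_three)
  have "g 0 * (a 2 * b 0 - a 0 * b 2) - g 1 * (a 1 * b 2 - a 2 * b 1)
      = a 2 * (b 0 * g 0 + b 1 * g 1 + b 2 * g 2) - b 2 * (a 0 * g 0 + a 1 * g 1 + a 2 * g 2)"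
    "g 0 * (a 0 * b 1 - a 1 * b 0) - g 2 * (a 1 * b 2 - a 2 * b 1)
      = b 1 * (a 0 * g 0 + a 1 * g 1 + a 2 * g 2) - a 1 * (b 0 * g 0 + b 1 * g 1 + b 2 * g 2)"
    "g 1 * (a 0 * b 1 - a 1 * b 0) - g 2 * (a 2 * b 0 - a 0 * b 2)
      = a 0 * (b 0 * g 0 + b 1 * g 1 + b 2 * g 2) - b 0 * (a 0 * g 0 + a 1 * g 1 + a 2 * g 2)"
    by (simp_all add: algebra_simps)
  then have "g 0 * (a 2 * b 0 - a 0 * b 2) = g 1 * (a 1 * b 2 - a 2 * b 1)"
    "g 0 * (a 0 * b 1 - a 1 * b 0) = g 2 * (a 1 * b 2 - a 2 * b 1)"
    "g 1 * (a 0 * b 1 - a 1 * b 0) = g 2 * (a 2 * b 0 - a 0 * b 2)"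
    unfolding a b by simp_all
  then show ?thesis unfolding proportional_def all_three cross_simps by simp
qed

lemma degree_mult_ge:
  "p \<noteq> 0 \<Longrightarrow> deg (q :: 'a::idom poly) \<le> deg (p * q)"
  by (cases "q = 0") (simp_all add: degree_mult_eq)

lemma dvd_pderiv_imp_const:
  fixes p :: "'a::{idom, ring_char_0} poly"
  assumes "p dvd pderiv p" obtains c where "p = [:c:]"
proof -
  have "pderiv p = 0"
  proof (rule ccontr)
    assume nz: "pderiv p \<noteq> 0"
    with assms have "deg p \<le> deg (pderiv p)" by (rule dvd_imp_degree_le)
    with nz show False by (simp add: degree_pderiv pderiv_eq_0_iff)
  qed
  then show thesis using that by (metis degree_eq_zeroE pderiv_eq_0_iff)
qed

lemma forms_0_eq_cst:
  assumes "p \<in> forms 0" shows "p = cst (lookup p 0)"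
proof (rule poly_mapping_eqI)
  fix x show "lookup p x = lookup (cst (lookup p 0)) x"
  proof (cases "x = 0")
    case False
    then have "monom_degree x \<noteq> 0"
      by (metis (mono_tags, lifting) UNIV_I finite lookup_zero monom_degree_def poly_mapping_eqI sum_eq_0_iff)
    with False lookup_forms[OF assms] show ?thesis by (simp add: lookup_single)
  qed simp
qed

lemma forms_0_at_inf:
  assumes "p \<in> forms 0" "at_inf p = 0" shows "p = 0"
proof -
  have p: "p = cst (lookup p 0)" using assms(1) by (rule forms_0_eq_cst)
  then have "[:lookup p 0:] = 0" using assms(2) by (metis at_inf_cst)
  with p show ?thesis by simp
qed

text \<open>The chart does not see the component \<open>x1 = 0\<close>, so the absence of a common
  factor is split into \<open>g_coprime\<close> for the chart and \<open>g_at_inf\<close> for that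
  line.\<close>

locale net =
  fixes g :: "3 \<Rightarrow> 'a::field_char_0 poly3" and e :: nat
  assumes g_forms: "g j \<in> forms e"
    and g_coprime: "coprime_family (\<lambda>j. chart (g j))"
    and g_at_inf: "\<exists>j. at_inf (g j) \<noteq> 0"
begin

definition syzygy :: "nat \<Rightarrow> (3 \<Rightarrow> 'a poly3) \<Rightarrow> bool" where
  "syzygy k b \<longleftrightarrow> (\<forall>j. b j \<in> forms k) \<and> (\<Sum>j\<in>UNIV. b j * g j) = 0"

text \<open>A syzygy on the generic line, with \<open>u\<close> and \<open>v\<close> indeterminate;
  the counterpart on a single line is \<open>restr_syzygy\<close>.\<close>

definition line_syzygy :: "(3 \<Rightarrow> 'a poly poly poly) \<Rightarrow> bool" where
  "line_syzygy A \<longleftrightarrow> (\<Sum>j\<in>UNIV. A j * on_lines (g j)) = 0"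

text \<open>Such a triple is a multiple \<open>h * g\<close>, and a component \<open>g i\<close>
  that survives at infinity has degree exactly \<open>e\<close> along the lines, so a nonzero
  \<open>h\<close> would give degree at least \<open>e\<close>.\<close>

lemma proportional_low_degree:
  assumes "proportional (\<lambda>j. [:chart (g j):]) C" "\<And>j. deg (line_coords (C j)) < e"
  shows "C j = 0"
proof -
  obtain h where h: "\<And>j. C j = h * [:chart (g j):]"
    by (rule coprime_family_proportional[OF coprime_family_pCons[OF g_coprime] assms(1)]) blast
  obtain i where i: "at_inf (g i) \<noteq> 0" using g_at_inf by blast
  have "coeff (on_lines (g i)) e \<noteq> 0"
    using i on_lines_forms(2)[OF g_forms[of i]] by simp
  then have "e \<le> deg (on_lines (g i))" by (rule le_degree)
  moreover have "line_coords (C i) = line_coords h * on_lines (g i)"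
    unfolding h line_coords.hom_mult on_lines_def ..
  ultimately have "h = 0"
    using assms(2)[of i] degree_mult_ge[of "line_coords h" "on_lines (g i)"] by (cases "h = 0") auto
  then show ?thesis by (simp add: h)
qed

text \<open>The cross product of the two syzygies is parallel to \<open>g\<close>, and its degree,
  at most \<open>k + l\<close>, is too small for a nonzero multiple of \<open>g\<close>.\<close>

lemma line_syzygies_proportional:
  assumes "line_syzygy A" "line_syzygy B"
    and "\<And>j. deg (A j) \<le> k" "\<And>j. deg (B j) \<le> l" "k + l < e"
  shows "proportional A B"
proof -
  have p: "point_coords (on_lines (g j)) = [:chart (g j):]" for j
    by (simp add: on_lines_def)
  have "proportional (\<lambda>j. on_lines (g j)) (cross A B)"
    using assms(1,2) unfolding line_syzygy_def by (rule proportional_cross)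
  then have "proportional (\<lambda>j. [:chart (g j):]) (\<lambda>j. point_coords (cross A B j))"
    unfolding proportional_def by (metis p point_coords.hom_mult)
  moreover have "deg (line_coords (point_coords (cross A B j))) < e" for j
  proof -
    have "deg (A i * B i') \<le> k + l" for i i'
      using degree_mult_le[of "A i" "B i'"] assms(3)[of i] assms(4)[of i'] by linarith
    then have "deg (cross A B j) \<le> k + l"
      unfolding cross_def by (auto intro: degree_diff_le)
    with assms(5) show ?thesis by simp
  qed
  ultimately have "point_coords (cross A B j) = 0" for j
    by (rule proportional_low_degree)
  then show ?thesis by (simp add: proportional_iff_cross)
qed

lemma syzygy_of_degree:
  assumes "\<And>j. deg (line_coords [:q j:]) \<le> k" "(\<Sum>j\<in>UNIV. q j * chart (g j)) = 0"
  obtains b where "syzygy k b" "\<And>j. chart (b j) = q j"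
proof -
  have "\<forall>j. \<exists>p. p \<in> forms k \<and> chart p = q j"
    using forms_of_degree[OF assms(1)] by metis
  then obtain b where b: "\<And>j. b j \<in> forms k" "\<And>j. chart (b j) = q j" by metis
  have "(\<Sum>j\<in>UNIV. b j * g j) \<in> forms (k + e)"
    by (intro forms_sum forms_mult b g_forms)
  moreover have "chart (\<Sum>j\<in>UNIV. b j * g j) = 0"
    using assms(2) by (simp add: chart.hom_sum chart.hom_mult b)
  ultimately have "(\<Sum>j\<in>UNIV. b j * g j) = 0" by (rule chart_inj_forms)
  with b(1) have "syzygy k b" unfolding syzygy_def by blast
  then show thesis using b(2) by (rule that)
qed

text \<open>The Grauert--Muelich descent: if the syzygies on the general line have a large enough
  degree gap, then rotating the line sends the lowest one to a multiple of itself. After removing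
  the content the multiplier vanishes for degree reasons, so the syzygy comes from the plane.\<close>

lemma descent:
  assumes "line_syzygy A" "A i \<noteq> 0" "\<And>j. deg (A j) \<le> k" "2 * k + 1 < e"
  obtains b j where "syzygy k b" "b j \<noteq> 0"
proof -
  \<comment> \<open>The content is removed in point coordinates, where the derivative by the slope
    is \<open>pderiv\<close>.\<close>
  obtain c a where ca: "\<And>j. point_coords (A j) = c * a j" and cop: "coprime_family a"
    using assms(2) by (rule ufd_content[of "\<lambda>j. point_coords (A j)" i, simplified]) blast
  have c: "c \<noteq> 0" using ca[of i] assms(2) by auto
  have Aca: "A j = line_coords c * line_coords (a j)" for j
    using ca[of j] by (metis line_coords.hom_mult line_point_coords)
  have deg: "deg (line_coords (a j)) \<le> k" for j
    using assms(3)[of j] c degree_mult_ge[of "line_coords c" "line_coords (a j)"] unfolding Aca by auto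
  have "line_coords c * (\<Sum>j\<in>UNIV. line_coords (a j) * on_lines (g j)) = 0"
    using assms(1) unfolding line_syzygy_def Aca sum_distrib_left by (simp add: mult.assoc)
  with c have syz: "line_syzygy (\<lambda>j. line_coords (a j))" by (simp add: line_syzygy_def)
  have "line_coords (\<Sum>j\<in>UNIV. a j * [:chart (g j):]) = 0"
    using syz unfolding line_syzygy_def on_lines_def by (simp only: line_coords.hom_sum line_coords.hom_mult)
  then have pt: "(\<Sum>j\<in>UNIV. a j * [:chart (g j):]) = 0" by (simp only: line_coords_eq_0_iff)
  \<comment> \<open>The partial derivative of the relation by the slope touches only the
    coefficients, as \<open>g\<close> lives on the plane.\<close>
  have "(\<Sum>j\<in>UNIV. pderiv (a j) * [:chart (g j):]) = pderiv (\<Sum>j\<in>UNIV. a j * [:chart (g j):])"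
    by (simp add: sum_three pderiv_add pderiv_smult)
  also have "\<dots> = 0" by (simp only: pt pderiv_0)
  finally have "line_coords (\<Sum>j\<in>UNIV. pderiv (a j) * [:chart (g j):]) = 0" by (simp only: line_coords.hom_zero)
  then have syz': "line_syzygy (\<lambda>j. line_coords (pderiv (a j)))"
    unfolding line_syzygy_def on_lines_def by (simp only: line_coords.hom_sum line_coords.hom_mult)
  have "deg (line_coords (pderiv (a j))) \<le> Suc k" for j
    using degree_rotate[of "line_coords (a j)"] deg[of j] by simp
  \<comment> \<open>Here the degree gap is spent: \<open>k + Suc k < e\<close>.\<close>
  with syz syz' deg have "proportional (\<lambda>j. line_coords (a j)) (\<lambda>j. line_coords (pderiv (a j)))"
    by (rule line_syzygies_proportional) (use assms(4) in simp)
  then have "proportional a (\<lambda>j. pderiv (a j))"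
    unfolding proportional_def by (simp flip: line_coords.hom_mult)
  with cop obtain h where h: "\<And>j. pderiv (a j) = h * a j"
    by (rule coprime_family_proportional) blast
  \<comment> \<open>A polynomial dividing its own derivative is constant in characteristic zero;
    constant in the slope means defined on the plane.\<close>
  then have "\<exists>q. a j = [:q:]" for j using dvd_pderiv_imp_const[of "a j"] by (metis dvd_triv_right)
  then obtain q where q: "\<And>j. a j = [:q j:]" by metis
  have "[:\<Sum>j\<in>UNIV. q j * chart (g j):] = 0" using pt by (simp add: q sum_three mult.commute)
  then have sum0: "(\<Sum>j\<in>UNIV. q j * chart (g j)) = 0" by simp
  have "deg (line_coords [:q j:]) \<le> k" for j using deg[of j] by (simp add: q)
  from this sum0 obtain b where b: "syzygy k b" "\<And>j. chart (b j) = q j"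
    by (rule syzygy_of_degree) blast
  have "a i \<noteq> 0" using assms(2) Aca[of i] by auto
  then have "b i \<noteq> 0" using b(2)[of i] by (auto simp: q)
  with b(1) show thesis by (rule that)
qed

text \<open>A common factor of degree \<open>m\<close> can be divided out, leaving a syzygy of
  degree \<open>r - m\<close>; minimality forces \<open>m = 0\<close>.\<close>

lemma minimal_syzygy_coprime:
  assumes "syzygy r b" "b i \<noteq> 0" and min: "\<And>k b' j. k < r \<Longrightarrow> syzygy k b' \<Longrightarrow> b' j = 0"
  shows "coprime_family (\<lambda>j. chart (b j))"
  unfolding coprime_family_def
proof safe
  fix d assume "\<forall>j. d dvd chart (b j)"
  then obtain q where q: "\<And>j. chart (b j) = d * q j" unfolding dvd_def by metis
  have forms: "b j \<in> forms r" for j using assms(1) by (simp add: syzygy_def)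
  have "chart (b i) \<noteq> 0" using chart_inj_forms[OF forms] assms(2) by blast
  then have d: "d \<noteq> 0" and qi: "q i \<noteq> 0" by (auto simp: q)
  define m where "m = deg (line_coords [:d:])"
  have lq: "on_lines (b j) = line_coords [:d:] * line_coords [:q j:]" for j
  proof -
    have "[:chart (b j):] = [:d:] * [:q j:]" by (simp add: q)
    then show ?thesis unfolding on_lines_def by (simp only: line_coords.hom_mult)
  qed
  have ld: "line_coords [:d:] \<noteq> 0" using d by simp
  have deg: "q j = 0 \<or> m + deg (line_coords [:q j:]) \<le> r" for j
    using on_lines_forms(1)[OF forms[of j]] ld unfolding lq m_def
    by (cases "q j = 0") (simp_all add: degree_mult_eq)
  then have "deg (line_coords [:q j:]) \<le> r - m" for j by (cases "q j = 0") (use deg[of j] in auto)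
  moreover have "d * (\<Sum>j\<in>UNIV. q j * chart (g j)) = chart (\<Sum>j\<in>UNIV. b j * g j)"
    by (simp add: chart.hom_sum chart.hom_mult q sum_distrib_left mult.assoc)
  then have "(\<Sum>j\<in>UNIV. q j * chart (g j)) = 0" using assms(1) d by (simp add: syzygy_def)
  ultimately obtain b' where b': "syzygy (r - m) b'" "\<And>j. chart (b' j) = q j"
    by (rule syzygy_of_degree) blast
  have "b' i \<noteq> 0" using b'(2)[of i] qi by auto
  with min[OF _ b'(1)] have "\<not> r - m < r" by blast
  moreover have "m \<le> r" using deg[of i] qi by auto
  ultimately have "m = 0" by linarith
  then have "deg (line_coords [:d:]) \<le> 0" by (simp add: m_def)
  then obtain p where p: "p \<in> forms 0" "chart p = d" by (rule forms_of_degree)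
  from forms_0_eq_cst[OF p(1)] p(2) have "d = [:[:lookup p 0:]:]" by (metis chart_cst)
  with d show "d dvd 1" by (simp add: is_unit_const_poly_iff dvd_field_iff)
qed

text \<open>Proportionality to a minimal syzygy becomes divisibility by it, since its components are
  coprime. The factor \<open>c\<close> may still depend on the line.\<close>

lemma line_syzygy_multiple:
  assumes "syzygy r b" "b i \<noteq> 0" "\<And>k b' j. k < r \<Longrightarrow> syzygy k b' \<Longrightarrow> b' j = 0"
    and "line_syzygy A" "\<And>j. deg (A j) \<le> k" "r + k < e"
  obtains c where "\<And>j. A j = c * on_lines (b j)"
proof -
  have bs: "line_syzygy (\<lambda>j. on_lines (b j))"
  proof -
    have "on_lines (\<Sum>j\<in>UNIV. b j * g j) = 0" using assms(1) by (simp add: syzygy_def)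
    then show ?thesis unfolding line_syzygy_def by (simp only: on_lines.hom_sum on_lines.hom_mult)
  qed
  have "deg (on_lines (b j)) \<le> r" for j
    using assms(1) by (intro on_lines_forms(1)) (simp add: syzygy_def)
  with bs assms(4) have "proportional (\<lambda>j. on_lines (b j)) A"
    by (rule line_syzygies_proportional) (use assms(5,6) in auto)
  then have prp: "proportional (\<lambda>j. [:chart (b j):]) (\<lambda>j. point_coords (A j))"
    unfolding proportional_def on_lines_def by (metis point_coords.hom_mult point_line_coords)
  have "coprime_family (\<lambda>j. [:chart (b j):])"
    by (rule coprime_family_pCons, rule minimal_syzygy_coprime[OF assms(1,2)]) (rule assms(3))
  from this prp obtain h where "\<And>j. point_coords (A j) = h * [:chart (b j):]"
    by (rule coprime_family_proportional) blast
  then have "A j = line_coords h * on_lines (b j)" for j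
    unfolding on_lines_def by (metis line_coords.hom_mult line_point_coords)
  then show thesis by (rule that)
qed

end

section \<open>The partial derivatives of a squarefree form\<close>

lemma map_poly_pderiv_mult:
  "map_poly pderiv (p * q) = p * map_poly pderiv q + map_poly pderiv p * (q :: 'a::idom poly poly)"
proof (rule poly_eqI)
  fix n
  have ps: "pderiv (\<Sum>i\<in>I. h i) = (\<Sum>i\<in>I. pderiv (h i))" for I :: "nat set" and h :: "nat \<Rightarrow> 'a poly"
    by (induction I rule: infinite_finite_induct) (simp_all add: pderiv_add)
  have pm: "pderiv (a * b) = a * pderiv b + pderiv a * b" for a b :: "'a poly"
    by (simp add: pderiv_mult mult.commute)
  show "coeff (map_poly pderiv (p * q)) n
      = coeff (p * map_poly pderiv q + map_poly pderiv p * q) n"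
    by (simp add: coeff_map_poly coeff_mult ps pm sum.distrib)
qed

text \<open>If \<open>F = q * h\<close> and \<open>q\<close> does not divide \<open>h\<close>, the
  product rule makes \<open>q\<close> divide both of its own partial derivatives. Then
  \<open>q\<close> is constant in the outer variable and next in the inner one, hence no
  prime.\<close>

lemma prime_dvd_partials_imp_square_dvd:
  fixes q F :: "'a::field_char_0 poly poly"
  assumes q: "prime_elem q" and F: "q dvd F" "q dvd pderiv F" "q dvd map_poly pderiv F"
  shows "q * q dvd F"
proof -
  obtain h where h: "F = q * h" using F(1) by (rule dvdE)
  have "q dvd h"
  proof (rule ccontr)
    assume nh: "\<not> q dvd h"
    have "q dvd h * pderiv q"
      using F(2) unfolding h pderiv_mult by (simp add: dvd_add_right_iff)
    then have 1: "q dvd pderiv q" using q nh by (simp add: prime_elem_dvd_mult_iff)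
    have "q dvd map_poly pderiv q * h"
      using F(3) unfolding h map_poly_pderiv_mult by (simp add: dvd_add_right_iff)
    then have 2: "q dvd map_poly pderiv q" using q nh by (simp add: prime_elem_dvd_mult_iff)
    obtain c where c: "q = [:c:]" using 1 by (rule dvd_pderiv_imp_const)
    have "map_poly pderiv [:c:] = [:pderiv c:]"
      by (rule poly_eqI) (simp add: coeff_map_poly coeff_pCons split: nat.splits)
    with 2 have "[:c:] dvd [:pderiv c:]" by (simp only: c)
    then have "c dvd pderiv c" by (simp add: const_poly_dvd)
    then obtain x where "c = [:x:]" by (rule dvd_pderiv_imp_const)
    with c q show False by (auto simp: prime_elem_def is_unit_const_poly_iff dvd_field_iff)
  qed
  then show ?thesis by (auto simp: h)
qed

lemma Var_not_unit: "\<not> (Var 1 :: 'a::field poly3) dvd 1"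
proof
  assume "(Var 1 :: 'a poly3) dvd 1"
  then have "at_inf (Var 1 :: 'a poly3) dvd at_inf 1" by (rule at_inf.hom_dvd)
  then show False by simp
qed

text \<open>By Euler's formula a common factor of the partial derivatives also divides
  \<open>f\<close>, so each of its primes divides \<open>f\<close> twice. The rest carries that
  square from the chart back to forms.\<close>

lemma partials_coprime:
  fixes f :: "'a::field_char_0 poly3"
  assumes "squarefree f" "f \<in> forms d" "d \<ge> 1"
  shows "coprime_family (\<lambda>j. chart (partial_deriv j f))"
proof (rule ccontr)
  assume "\<not> ?thesis"
  then obtain D where D: "\<And>j. D dvd chart (partial_deriv j f)" "\<not> D dvd 1"
    unfolding coprime_family_def by blast
  have euler: "[:[:of_nat d:]:] * chart f = (\<Sum>j\<in>UNIV. chart (Var j) * chart (partial_deriv j f))"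
  proof -
    have "chart (cst (of_nat d) * f) = chart (\<Sum>j\<in>UNIV. Var j * partial_deriv j f)"
      by (simp only: euler_formula[OF assms(2)])
    then show ?thesis unfolding chart.hom_mult chart.hom_sum chart_cst .
  qed
  have unit: "[:[:of_nat d :: 'a:]:] dvd 1"
    using assms(3) by (simp add: is_unit_const_poly_iff dvd_field_iff)
  have dvdF: "q dvd chart f" if "\<And>j. q dvd chart (partial_deriv j f)" for q
  proof -
    have "q dvd [:[:of_nat d:]:] * chart f"
      unfolding euler by (intro dvd_sum dvd_mult that)
    then obtain x where x: "[:[:of_nat d:]:] * chart f = q * x" by (rule dvdE)
    obtain y where y: "1 = [:[:of_nat d :: 'a:]:] * y" using unit by (rule dvdE)
    have "chart f = [:[:of_nat d:]:] * y * chart f" by (simp only: y[symmetric] mult_1_left)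
    also have "\<dots> = y * ([:[:of_nat d:]:] * chart f)" by (simp only: mult_ac)
    also have "\<dots> = q * (x * y)" unfolding x by (simp only: mult_ac)
    finally show ?thesis by (rule dvdI)
  qed
  have "f \<noteq> 0"
    using assms(1) Var_not_unit unfolding squarefree_def by (metis dvd_0_right)
  then have F: "chart f \<noteq> 0" using chart_inj_forms[OF assms(2)] by blast
  have "D \<noteq> 0" using dvdF[of D] D(1) F by auto
  obtain q where q: "prime_elem q" "q dvd D" by (rule ufd_prime_factor[OF \<open>D \<noteq> 0\<close> D(2)])
  have dvd: "q dvd chart (partial_deriv j f)" for j using q(2) D(1) by (rule dvd_trans)
  have "q * q dvd chart f"
    using q(1) dvdF[OF dvd]
  proof (rule prime_dvd_partials_imp_square_dvd)
    show "q dvd pderiv (chart f)" using dvd[of 2] by (simp add: chart_partial_deriv)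
    show "q dvd map_poly pderiv (chart f)" using dvd[of 0] by (simp add: chart_partial_deriv)
  qed
  then obtain h where h: "chart f = q * q * h" by (rule dvdE)
  then have nz: "q \<noteq> 0" "h \<noteq> 0" using F by auto
  \<comment> \<open>Degrees along the generic line add up, so \<open>2 * N + M \<le> d\<close>; a
    power of \<open>Var 1\<close> fills the gap to \<open>d\<close>.\<close>
  define N M where "N = deg (line_coords [:q:])" and "M = deg (line_coords [:h:])"
  obtain q' where q': "q' \<in> forms N" "chart q' = q" by (rule forms_of_degree[of q N]) (simp_all add: N_def)
  obtain h' where h': "h' \<in> forms M" "chart h' = h" by (rule forms_of_degree[of h M]) (simp_all add: M_def)
  have "[:chart f:] = [:q:] * [:q:] * [:h:]" by (simp add: h)
  then have "on_lines f = line_coords [:q:] * line_coords [:q:] * line_coords [:h:]"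
    unfolding on_lines_def by (simp only: line_coords.hom_mult)
  moreover have "line_coords [:q:] \<noteq> 0" "line_coords [:h:] \<noteq> 0" using nz by simp_all
  ultimately have "deg (on_lines f) = N + N + M"
    by (simp add: degree_mult_eq N_def M_def)
  with on_lines_forms(1)[OF assms(2)] have le: "N + N + M \<le> d" by simp
  have "Var 1 ^ (d - (N + N + M)) * (q' * q' * h') \<in> forms ((d - (N + N + M)) + (N + N + M))"
    by (intro forms_mult forms_Var_power q' h')
  then have "Var 1 ^ (d - (N + N + M)) * (q' * q' * h') \<in> forms d" using le by simp
  moreover have "chart (Var 1 ^ (d - (N + N + M)) * (q' * q' * h')) = chart f"
    by (simp add: chart.hom_mult chart.hom_power q' h' h)
  ultimately have "f = Var 1 ^ (d - (N + N + M)) * (q' * q' * h')"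
    using chart_eq_forms[OF assms(2)] by metis
  also have "\<dots> = q' ^ 2 * (Var 1 ^ (d - (N + N + M)) * h')"
    by (simp only: power2_eq_square mult_ac)
  finally have "q' ^ 2 dvd f" by simp
  with assms(1) have "q' dvd 1" unfolding squarefree_def by blast
  then have "chart q' dvd chart 1" by (rule chart.hom_dvd)
  with q'(2) have "q dvd 1" by simp
  with prime_elem_not_unit[OF q(1)] show False by blast
qed

text \<open>If all partial derivatives vanish on \<open>x1 = 0\<close>, then so does
  \<open>f\<close> by Euler's formula. Writing \<open>f = x1 * g\<close>, the derivative by
  \<open>x1\<close> equals \<open>g\<close> on that line, so \<open>x1\<close> divides
  \<open>f\<close> twice.\<close>

lemma partials_at_inf:
  fixes f :: "'a::field_char_0 poly3"
  assumes "squarefree f" "f \<in> forms d" "d \<ge> 1"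
  shows "\<exists>j. at_inf (partial_deriv j f) \<noteq> 0"
proof (rule ccontr)
  assume "\<not> ?thesis"
  then have all: "at_inf (partial_deriv j f) = 0" for j by blast
  obtain e where e: "d = Suc e" using assms(3) by (cases d) auto
  have "at_inf (cst (of_nat d) * f) = at_inf (\<Sum>j\<in>UNIV. Var j * partial_deriv j f)"
    by (simp only: euler_formula[OF assms(2)])
  then have "[:of_nat d:] * at_inf f = 0"
    unfolding at_inf.hom_mult at_inf.hom_sum at_inf_cst by (simp add: all)
  then have "at_inf f = 0" using assms(3) by simp
  with assms(2) obtain g where g: "g \<in> forms e" "f = Var 1 * g"
    unfolding e by (rule at_inf_zero_dvd)
  have ex: "f \<in> forms (Suc e)" "partial_deriv 1 f \<in> forms e"
    using partial_deriv_forms[OF assms(2), of 1] assms(2) by (simp_all add: e)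
  have "at_inf g = at_inf (partial_deriv 1 f)"
  proof (rule poly_eqI)
    fix c show "coeff (at_inf g) c = coeff (at_inf (partial_deriv 1 f)) c"
    proof (cases "c \<le> e")
      case True
      have "mon (e - c) 0 c + single 1 1 = mon (e - c) 1 c"
        by (simp add: mon_def ac_simps)
      moreover have "mon (e - c) 1 c - single 1 1 = mon (e - c) 0 c"
        by (rule poly_mapping_eqI) (simp add: mon_def lookup_add lookup_minus lookup_single when_def)
      ultimately have "lookup (partial_deriv 1 f) (mon (e - c) 0 c) = lookup g (mon (e - c) 0 c)"
        unfolding lookup_partial_deriv by (simp add: g(2) lookup_Var_mult)
      then show ?thesis using True coeff_at_inf_forms[OF g(1)] coeff_at_inf_forms[OF ex(2)] by simp
    next
      case False
      then show ?thesis
        using degree_at_inf_forms[OF g(1)] degree_at_inf_forms[OF ex(2)] by (simp add: coeff_eq_0)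
    qed
  qed
  then have inf: "at_inf g = 0" by (simp add: all)
  have "Var 1 dvd g"
  proof (cases e)
    case 0
    with forms_0_at_inf[of g] g(1) inf show ?thesis by simp
  next
    case (Suc e')
    with at_inf_zero_dvd[of g e'] g(1) inf show ?thesis by (metis dvd_triv_left)
  qed
  then have "Var 1 ^ 2 dvd f" by (simp add: g(2) power2_eq_square)
  with assms(1) Var_not_unit show False unfolding squarefree_def by blast
qed

lemma net_partials:
  fixes f :: "'a::field_char_0 poly3"
  assumes "squarefree f" "f \<in> forms d" "d \<ge> 1"
  shows "net (partials f) (d - 1)"
  using assms partial_deriv_forms partials_coprime partials_at_inf by unfold_locales blast+

section \<open>Smooth curves\<close>

text \<open>The ideal generated by a triple, in explicit form;
  \<open>jacobian_ideal_eq_combos\<close> makes the link with \<open>genideal\<close>.\<close>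

definition combos :: "(3 \<Rightarrow> 'a::comm_ring_1) \<Rightarrow> 'a set" where
  "combos G = range (\<lambda>C. \<Sum>j\<in>UNIV. C j * G j)"

lemma combosI: "p = (\<Sum>j\<in>UNIV. C j * G j) \<Longrightarrow> p \<in> combos G"
  unfolding combos_def by blast

lemma combos_add:
  assumes "p \<in> combos G" "q \<in> combos G" shows "p + q \<in> combos G"
proof -
  from assms obtain C D where "p = (\<Sum>j\<in>UNIV. C j * G j)" "q = (\<Sum>j\<in>UNIV. D j * G j)"
    unfolding combos_def by blast
  then have "p + q = (\<Sum>j\<in>UNIV. (C j + D j) * G j)" by (simp add: distrib_right sum.distrib)
  then show ?thesis by (rule combosI[where C = "\<lambda>j. C j + D j"])
qed

lemma combos_mult:
  assumes "p \<in> combos G" shows "q * p \<in> combos G"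
proof -
  from assms obtain C where "p = (\<Sum>j\<in>UNIV. C j * G j)" unfolding combos_def by blast
  then have "q * p = (\<Sum>j\<in>UNIV. (q * C j) * G j)" by (simp add: sum_distrib_left mult.assoc)
  then show ?thesis by (rule combosI[where C = "\<lambda>j. q * C j"])
qed

lemma combos_diff: "p \<in> combos G \<Longrightarrow> q \<in> combos G \<Longrightarrow> p - q \<in> combos G"
  using combos_add[OF _ combos_mult[of q G "- 1"], of p] by simp

lemma combos_generator: "G j \<in> combos G"
proof -
  have "G j = (\<Sum>i\<in>UNIV. (if i = j then 1 else 0) * G i)" by (simp add: if_distrib[of "\<lambda>c. c * _"] cong: if_cong)
  then show ?thesis by (rule combosI[where C = "\<lambda>i. if i = j then 1 else 0"])
qed

lemma bezout_univariate:
  fixes G :: "3 \<Rightarrow> 'a::alg_closed_field poly"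
  assumes "\<And>x. \<exists>j. poly (G j) x \<noteq> 0"
  obtains C where "(\<Sum>j\<in>UNIV. C j * G j) = 1"
proof -
  note mult = combos_mult and diff = combos_diff and gen = combos_generator[of G]
  obtain i where "G i \<noteq> 0" using assms[of 0] by (metis poly_0)
  then obtain g where g: "g \<in> combos G" "g \<noteq> 0" and min: "\<And>p. p \<in> combos G \<Longrightarrow> p \<noteq> 0 \<Longrightarrow> deg g \<le> deg p"
    using ex_has_least_nat[of "\<lambda>p. p \<in> combos G \<and> p \<noteq> 0" "G i" deg] gen[of i] by (metis (no_types, lifting))
  have dvd: "g dvd G j" for j
  proof -
    have "G j mod g = G j - (G j div g) * g" by (simp add: minus_div_mult_eq_mod)
    then have "G j mod g \<in> combos G" using diff[OF gen mult[OF g(1)]] by simp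
    with min g(2) have "G j mod g = 0" using degree_mod_less[of g "G j"] by (meson not_le)
    then show ?thesis by (simp add: mod_eq_0_iff_dvd)
  qed
  have "deg g = 0"
  proof (rule ccontr)
    assume "deg g \<noteq> 0"
    then obtain x where "poly g x = 0" using alg_closed_imp_poly_has_root[of g] by auto
    then have "poly (G j) x = 0" for j using dvd[of j] by auto
    with assms[of x] show False by blast
  qed
  then obtain c where c: "g = [:c:]" by (rule degree_eq_zeroE)
  with g(2) have "1 = [:inverse c:] * g" by simp
  then have "1 \<in> combos G" using mult[OF g(1)] by metis
  then show thesis using that unfolding combos_def by force
qed

lemma poly_poly_eq_poly_map_poly:
  "poly (poly P [:w:]) s = poly (map_poly (\<lambda>c. poly c s) P) (w :: 'a::comm_ring_1)"
proof (induction P)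
  case (pCons a P)
  have "map_poly (\<lambda>c. poly c s) (pCons a P) = pCons (poly a s) (map_poly (\<lambda>c. poly c s) P)"
    by (rule poly_hom.map_poly_pCons_hom)
  with pCons show ?case by simp
qed simp

text \<open>Elimination yields a nonzero member of the ideal in \<open>s\<close> alone. One of least
  degree is constant: over a root \<open>a\<close>, Bezout on the fibre \<open>s = a\<close> allows
  the factor \<open>s - a\<close> to be cancelled.\<close>

lemma nullstellensatz_bivariate:
  fixes G :: "3 \<Rightarrow> 'a::{alg_closed_field, field_char_0} poly poly"
  assumes "\<And>s w. \<exists>j. poly (poly (G j) [:w:]) s \<noteq> 0"
  obtains C where "(\<Sum>j\<in>UNIV. C j * G j) = 1"
proof -
  note mult = combos_mult and diff = combos_diff and gen = combos_generator[of G]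
  \<comment> \<open>Otherwise a member of least degree in \<open>w\<close> has positive degree and
    pseudo-divides every \<open>G j\<close>; a root of it over a value of \<open>s\<close> where its
    leading coefficient survives is a common zero.\<close>
  have elim: "\<exists>q. q \<noteq> 0 \<and> [:q:] \<in> combos G"
  proof (rule ccontr)
    assume none: "\<not> ?thesis"
    obtain i where "G i \<noteq> 0" using assms[of 0 0] by (metis poly_0)
    then obtain g where g: "g \<in> combos G" "g \<noteq> 0" and min: "\<And>p. p \<in> combos G \<Longrightarrow> p \<noteq> 0 \<Longrightarrow> deg g \<le> deg p"
      using ex_has_least_nat[of "\<lambda>p. p \<in> combos G \<and> p \<noteq> 0" "G i" deg] gen[of i] by (metis (no_types, lifting))
    let ?lc = "Polynomial.lead_coeff g"
    have dg: "deg g > 0"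
    proof (rule ccontr)
      assume "\<not> ?thesis"
      then have "deg g = 0" by simp
      then obtain q where "g = [:q:]" by (rule degree_eq_zeroE)
      with g none show False by auto
    qed
    have "\<exists>n Q. Polynomial.smult (?lc ^ n) (G j) = g * Q" for j
    proof -
      obtain Q r where Qr: "pseudo_divmod (G j) g = (Q, r)" by fastforce
      from pseudo_divmod[OF g(2) Qr]
      obtain n where n: "Polynomial.smult (?lc ^ n) (G j) = g * Q + r" and r: "r = 0 \<or> deg r < deg g"
        by blast
      have "r = [:?lc ^ n:] * G j - Q * g" using n by (simp add: mult.commute)
      then have "r \<in> combos G" using diff[OF mult[OF gen] mult[OF g(1)]] by metis
      with min r have "r = 0" by (meson not_le)
      with n show ?thesis by auto
    qed
    then obtain n Q where nQ: "\<And>j. Polynomial.smult (?lc ^ n j) (G j) = g * Q j" by metis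
    obtain a where a: "poly ?lc a \<noteq> 0" using g(2) poly_all_0_iff_0[of ?lc] by auto
    let ?h = "map_poly (\<lambda>c. poly c a) g"
    have "coeff ?h (deg g) \<noteq> 0" using a by (simp add: coeff_map_poly)
    then have "deg ?h > 0" using dg le_degree[of ?h "deg g"] by linarith
    then obtain b where "poly ?h b = 0" using alg_closed_imp_poly_has_root by blast
    then have gb: "poly (poly g [:b:]) a = 0" by (simp add: poly_poly_eq_poly_map_poly)
    have "poly (poly (G j) [:b:]) a = 0" for j
    proof -
      have "poly (poly (Polynomial.smult (?lc ^ n j) (G j)) [:b:]) a = 0"
        unfolding nQ by (simp add: gb)
      with a show ?thesis by simp
    qed
    with assms[of b a] show False by blast
  qed
  then obtain q where q: "q \<noteq> 0" "[:q:] \<in> combos G"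
    and min: "\<And>p. p \<noteq> 0 \<Longrightarrow> [:p:] \<in> combos G \<Longrightarrow> deg q \<le> deg p"
    using ex_has_least_nat[of "\<lambda>q. q \<noteq> 0 \<and> [:q:] \<in> combos G" _ deg] by (metis (no_types, lifting))
  have "deg q = 0"
  proof (rule ccontr)
    assume dq: "deg q \<noteq> 0"
    then obtain a where a: "poly q a = 0" using alg_closed_imp_poly_has_root[of q] by auto
    then obtain q' where q': "q = [:- a, 1:] * q'" by (meson poly_eq_0_iff_dvd dvdE)
    let ?ev = "map_poly (\<lambda>c. poly c a) :: 'a poly poly \<Rightarrow> 'a poly"
    interpret ev: comm_ring_hom ?ev by (rule comm_ring_hom_map_poly[OF comm_ring_hom_poly])
    have ex: "\<exists>j. poly (?ev (G j)) x \<noteq> 0" for x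
      using assms[of x a] by (simp only: poly_poly_eq_poly_map_poly)
    obtain C where C: "(\<Sum>j\<in>UNIV. C j * ?ev (G j)) = 1"
      by (rule bezout_univariate[where G = "\<lambda>j. ?ev (G j)"]) (rule ex)
    \<comment> \<open>\<open>P\<close> lifts the Bezout identity of the fibre, so
      \<open>s - a\<close> divides \<open>P - 1\<close>. Hence \<open>q' * (P - 1)\<close> is a
      multiple of \<open>q\<close>, and \<open>q'\<close> lies in the ideal although its degree is
      smaller.\<close>
    define P where "P = (\<Sum>j\<in>UNIV. map_poly (\<lambda>c. [:c:]) (C j) * G j)"
    have PI: "P \<in> combos G" by (rule combosI[OF P_def])
    have lift: "?ev (map_poly (\<lambda>c. [:c:]) r) = r" for r
      by (rule poly_eqI) (simp add: coeff_map_poly)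
    have ev0: "?ev (P - 1) = 0"
      unfolding P_def ev.hom_minus ev.hom_sum ev.hom_mult lift C by simp
    define H where "H = map_poly (\<lambda>c. c div [:- a, 1:]) (P - 1)"
    have H: "P - 1 = Polynomial.smult [:- a, 1:] H"
    proof (rule poly_eqI)
      fix n
      have "poly (coeff (P - 1) n) a = coeff (?ev (P - 1)) n" by (simp only: coeff_map_poly poly_0)
      also have "\<dots> = 0" by (simp only: ev0 coeff_0)
      finally have "[:- a, 1:] dvd coeff (P - 1) n" by (simp only: poly_eq_0_iff_dvd)
      then show "coeff (P - 1) n = coeff (Polynomial.smult [:- a, 1:] H) n"
        by (simp only: H_def coeff_smult coeff_map_poly div_0 dvd_mult_div_cancel)
    qed
    have "[:q':] * (P - 1) = H * [:q:]" unfolding H q' by (simp add: mult.commute)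
    then have "[:q':] = [:q':] * P - H * [:q:]" by (simp add: smult_diff_right diff_eq_eq add.commute)
    then have "[:q':] \<in> combos G" using diff[OF mult[OF PI] mult[OF q(2)]] by metis
    moreover have "q' \<noteq> 0" using q(1) q' by auto
    ultimately have "deg q \<le> deg q'" using min by blast
    with \<open>q' \<noteq> 0\<close> show False unfolding q' by (simp add: degree_mult_eq del: mult_pCons_left)
  qed
  then obtain c where c: "q = [:c:]" by (rule degree_eq_zeroE)
  with q(1) have "1 = [:[:inverse c:]:] * [:q:]" by simp
  then have "1 \<in> combos G" using mult[OF q(2)] by metis
  then show thesis using that unfolding combos_def by force
qed

definition pt :: "'a \<Rightarrow> 'a \<Rightarrow> 'a \<Rightarrow> 3 \<Rightarrow> 'a" where
  "pt x y z j = (if j = 0 then x else if j = 1 then y else z)"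

lemma pt_simps [simp]: "pt x y z 0 = x" "pt x y z 1 = y" "pt x y z 2 = z"
  by (simp_all add: pt_def)

lemma hom_poly3_eqI':
  assumes "comm_ring_hom H" "comm_ring_hom H'"
    and "\<And>c. H (cst c) = H' (cst c)" "H (Var 0) = H' (Var 0)" "H (Var 1) = H' (Var 1)" "H (Var 2) = H' (Var 2)"
  shows "H (p :: 'a::comm_ring_1 poly3) = H' p"
proof -
  have "\<forall>j. H (Var j) = H' (Var j)" unfolding all_three using assms by blast
  with hom_poly3_eqI[OF assms(1-3)] show ?thesis by blast
qed

lemma eval_id_gen: "eval_at id a (cst c) = c" "eval_at id a (Var j) = a j"
  by (simp_all only: eval_at_cst[OF comm_ring_hom_id] eval_at_Var[OF comm_ring_hom_id] id_apply)

lemma eval_chart: "eval_at id (pt s 1 w) p = poly (poly (chart p) [:w:]) (s :: 'a::comm_ring_1)"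
proof (rule hom_poly3_eqI')
  show "comm_ring_hom (\<lambda>p. poly (poly (chart p) [:w:]) s)"
    by (rule comm_ring_hom_comp[OF comm_ring_hom_poly comm_ring_hom_comp[OF comm_ring_hom_poly chart.comm_ring_hom_axioms]])
qed (simp_all add: eval_id_gen eval_at_hom[OF comm_ring_hom_id] del: id_apply)

lemma eval_at_inf: "eval_at id (pt 1 0 z) p = poly (at_inf p) (z :: 'a::comm_ring_1)"
proof (rule hom_poly3_eqI')
  show "comm_ring_hom (\<lambda>p. poly (at_inf p) z)"
    by (rule comm_ring_hom_comp[OF comm_ring_hom_poly at_inf.comm_ring_hom_axioms])
qed (simp_all add: eval_id_gen eval_at_hom[OF comm_ring_hom_id] del: id_apply)

text \<open>The point at infinity that \<open>at_inf\<close> omits decides whether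
  \<open>at_inf p\<close> has full degree.\<close>

lemma eval_last_point:
  assumes "p \<in> forms k"
  shows "eval_at id (pt 0 0 1) p = coeff (at_inf p) (k :: nat)"
  using assms
proof (induction rule: forms_induct)
  case (single a b c x)
  then show ?case
    unfolding eval_at_single[OF comm_ring_hom_id] at_inf_single prod_three by (auto simp: power_0_left)
next
  case (add p q)
  then show ?case by (simp only: eval_at_add[OF comm_ring_hom_id] at_inf.hom_add coeff_add)
qed (simp add: eval_at_def)

lemma cross_diff_right: "cross g (\<lambda>j. x j - h * g j) j = cross g x (j :: 3)"
  by (simp add: cross_def algebra_simps)

text \<open>The triple product identity; \<open>c\<close> acts as a contracting homotopy of the
  Koszul complex.\<close>

lemma cross_cross:
  assumes "(\<Sum>j\<in>UNIV. c j * g j) = 1" "(\<Sum>j\<in>UNIV. a j * g j) = (0 :: 'a::comm_ring_1)"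
  shows "cross g (cross a c) j = a j"
proof -
  have c: "c 0 * g 0 + c 1 * g 1 + c 2 * g 2 = 1" and a: "a 0 * g 0 + a 1 * g 1 + a 2 * g 2 = 0"
    using assms by (simp_all only: sum_three)
  have "\<forall>j. cross g (cross a c) j
      = a j * (c 0 * g 0 + c 1 * g 1 + c 2 * g 2) - c j * (a 0 * g 0 + a 1 * g 1 + a 2 * g 2)"
    unfolding all_three cross_simps by (simp add: algebra_simps)
  then show ?thesis unfolding a c by simp
qed

lemma cross_hom: "comm_ring_hom H \<Longrightarrow> H (cross a b j) = cross (\<lambda>i. H (a i)) (\<lambda>i. H (b i)) j"
proof -
  assume "comm_ring_hom H"
  then interpret comm_ring_hom H .
  show ?thesis by (simp add: cross_def hom_minus hom_mult)
qed

lemma Var_neq_0: "(Var j :: 'a::zero_neq_one poly3) \<noteq> 0"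
  by (metis Var_def lookup_single_eq lookup_zero zero_neq_one)

text \<open>In the chart the Koszul complex is exact because the unit ideal is generated; the poles
  along the line at infinity are then removed one order at a time, by the exactness on that line.\<close>

lemma no_low_syzygy_if_base_point_free:
  fixes g a :: "3 \<Rightarrow> 'a::{alg_closed_field, field_char_0} poly3"
  assumes g: "\<And>j. g j \<in> forms e" and free: "\<And>p. \<exists>j. p j \<noteq> 0 \<Longrightarrow> \<exists>j. eval_at id p (g j) \<noteq> 0"
    and a: "\<And>j. a j \<in> forms m" and "m < e" and syz: "(\<Sum>j\<in>UNIV. a j * g j) = 0"
  shows "a j = 0"
proof -
  have inf: "\<exists>j. poly (at_inf (g j)) z \<noteq> 0" for z
    using free[of "pt 1 0 z"] unfolding eval_at_inf by (metis pt_simps(1) zero_neq_one)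
  then obtain C where C: "(\<Sum>j\<in>UNIV. C j * at_inf (g j)) = 1" by (rule bezout_univariate)
  have cop: "coprime_family (\<lambda>j. at_inf (g j))"
    unfolding coprime_family_def
  proof safe
    fix d assume "\<forall>j. d dvd at_inf (g j)"
    then have "d dvd (\<Sum>j\<in>UNIV. C j * at_inf (g j))" by (intro dvd_sum dvd_mult) blast
    then show "d dvd 1" by (simp only: C)
  qed
  have "\<exists>j. eval_at id (pt 0 0 1) (g j) \<noteq> 0" using free[of "pt 0 0 1"] by (metis pt_simps(3) zero_neq_one)
  then obtain i where i: "coeff (at_inf (g i)) e \<noteq> 0" unfolding eval_last_point[OF g] by blast
  then have di: "e \<le> deg (at_inf (g i))" by (rule le_degree)
  \<comment> \<open>\<open>x\<close> is a Koszul primitive of \<open>a\<close> up to a power of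
    \<open>Var 1\<close>. That power is positive because \<open>m < e\<close>, so the cross product
    vanishes at infinity and \<open>x\<close> is a multiple of \<open>g\<close> there.\<close>
  have multiple: "\<exists>h. (\<forall>j. at_inf (x j) = h * at_inf (g j)) \<and> (h \<noteq> 0 \<longrightarrow> deg h + e \<le> n)"
    if x: "\<And>j. x j \<in> forms n" and eq: "\<And>j. Var 1 ^ (n + e - m) * a j = cross g x j" for n x
  proof -
    have "cross (\<lambda>j. at_inf (g j)) (\<lambda>j. at_inf (x j)) j = 0" for j
    proof -
      have "at_inf (Var 1 ^ (n + e - m) * a j) = 0"
        using \<open>m < e\<close> by (simp add: at_inf.hom_mult at_inf.hom_power zero_power)
      then show ?thesis unfolding eq cross_hom[OF at_inf.comm_ring_hom_axioms] .
    qed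
    then have "proportional (\<lambda>j. at_inf (g j)) (\<lambda>j. at_inf (x j))"
      by (simp add: proportional_iff_cross)
    with cop obtain h where h: "\<And>j. at_inf (x j) = h * at_inf (g j)"
      by (rule coprime_family_proportional) blast
    have "deg h + e \<le> n" if "h \<noteq> 0"
    proof -
      have "deg h + e \<le> deg (at_inf (x i))"
        using that i di unfolding h by (subst degree_mult_eq) auto
      also have "\<dots> \<le> n" by (rule degree_at_inf_forms) (rule x)
      finally show ?thesis .
    qed
    with h show ?thesis by blast
  qed
  \<comment> \<open>Subtracting \<open>H * g\<close> keeps the cross product and makes the primitive
    divisible by \<open>Var 1\<close>, which lowers \<open>n\<close>. At \<open>n = 0\<close> a
    nonzero multiple of \<open>g\<close> does not fit, as \<open>e > 0\<close>, so the primitive is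
    zero.\<close>
  have main: "a j = 0" if "\<And>j. x j \<in> forms n" "\<And>j. Var 1 ^ (n + e - m) * a j = cross g x j" for n x j
    using that
  proof (induction n arbitrary: x)
    case (0 x)
    from multiple[OF 0] \<open>m < e\<close> have h: "at_inf (x j) = 0" for j by auto
    have "x j = 0" for j using 0(1) h by (rule forms_0_at_inf)
    then have "cross g x j = 0" by (simp add: cross_def)
    with 0(2)[of j] show ?case by (simp add: Var_neq_0)
  next
    case (Suc n x)
    from multiple[OF Suc.prems] obtain h where h: "\<And>j. at_inf (x j) = h * at_inf (g j)"
      and deg_h: "h \<noteq> 0 \<Longrightarrow> deg h + e \<le> Suc n" by blast
    have "\<exists>H. (\<forall>j. H * g j \<in> forms (Suc n)) \<and> at_inf H = h"
    proof (cases "h = 0")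
      case True
      then show ?thesis by (intro exI[of _ 0]) simp
    next
      case False
      from deg_h[OF this] have le: "deg h + e \<le> Suc n" .
      then have "deg h \<le> Suc n - e" by simp
      then obtain H where H: "H \<in> forms (Suc n - e)" "at_inf H = h" by (rule at_inf_forms_ex)
      have "H * g j \<in> forms (Suc n)" for j using forms_mult[OF H(1) g[of j]] le by simp
      with H(2) show ?thesis by blast
    qed
    then obtain H where H: "\<And>j. H * g j \<in> forms (Suc n)" "at_inf H = h" by blast
    have "\<exists>y. y \<in> forms n \<and> x j - H * g j = Var 1 * y" for j
    proof -
      have "x j - H * g j \<in> forms (Suc n)" by (intro forms_diff Suc.prems(1) H)
      moreover have "at_inf (x j - H * g j) = 0"
        by (simp add: at_inf.hom_minus at_inf.hom_mult H h)
      ultimately show ?thesis by (metis at_inf_zero_dvd)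
    qed
    then obtain y where y: "\<And>j. y j \<in> forms n" "\<And>j. x j - H * g j = Var 1 * y j" by metis
    show ?case
    proof (rule Suc.IH[OF y(1)])
      fix j
      have "Var 1 * (Var 1 ^ (n + e - m) * a j) = cross g x j"
        using Suc.prems(2)[of j] \<open>m < e\<close> by (simp add: Suc_diff_le mult.assoc)
      also have "\<dots> = cross g (\<lambda>j. Var 1 * y j) j" by (subst cross_diff_right[symmetric, where h = H]) (simp only: y(2))
      also have "\<dots> = Var 1 * cross g y j" by (simp add: cross_def algebra_simps)
      finally show "Var 1 ^ (n + e - m) * a j = cross g y j" using Var_neq_0 by (metis mult_left_cancel)
    qed
  qed
  have "\<exists>j. poly (poly (chart (g j)) [:w:]) s \<noteq> 0" for s w
    using free[of "pt s 1 w"] unfolding eval_chart by (metis pt_simps(2) zero_neq_one)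
  then obtain c where c: "(\<Sum>j\<in>UNIV. c j * chart (g j)) = 1" by (rule nullstellensatz_bivariate)
  have "(\<Sum>j\<in>UNIV. chart (a j) * chart (g j)) = chart (\<Sum>j\<in>UNIV. a j * g j)"
    by (simp only: chart.hom_sum chart.hom_mult)
  then have a0: "(\<Sum>j\<in>UNIV. chart (a j) * chart (g j)) = 0" by (simp add: syz)
  \<comment> \<open>The primitive on the chart, given by the contracting homotopy; homogenizing it
    starts the induction.\<close>
  let ?X = "cross (\<lambda>j. chart (a j)) c"
  have X: "cross (\<lambda>j. chart (g j)) ?X j = chart (a j)" for j by (rule cross_cross[OF c a0])
  define n where "n = Max (range (\<lambda>j. deg (line_coords [:?X j:])))"
  have "deg (line_coords [:?X j:]) \<le> n" for j unfolding n_def by (rule Max_ge) auto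
  then have "\<exists>p. p \<in> forms n \<and> chart p = ?X j" for j using forms_of_degree by metis
  then obtain x where x: "\<And>j. x j \<in> forms n" "\<And>j. chart (x j) = ?X j" by metis
  show ?thesis
  proof (rule main[OF x(1)])
    fix j
    have cross: "cross g x j \<in> forms (n + e)"
      unfolding cross_def using forms_mult[OF g x(1)] by (auto intro!: forms_diff simp: add.commute)
    have "Var 1 ^ (n + e - m) * a j \<in> forms ((n + e - m) + m)" by (intro forms_mult forms_Var_power a)
    then have "Var 1 ^ (n + e - m) * a j \<in> forms (n + e)" using \<open>m < e\<close> by simp
    then show "Var 1 ^ (n + e - m) * a j = cross g x j"
      using cross
    proof (rule chart_eq_forms)
      show "chart (Var 1 ^ (n + e - m) * a j) = chart (cross g x j)"
        unfolding cross_hom[OF chart.comm_ring_hom_axioms] x(2) X by (simp add: chart.hom_mult chart.hom_power)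
    qed
  qed
qed

section \<open>Passage to the algebraic closure\<close>

lemma comm_ring_hom_to_ac: "comm_ring_hom to_ac"
  by unfold_locales simp_all

lemma comm_ring_hom_cst: "comm_ring_hom (cst :: 'a::comm_ring_1 \<Rightarrow> 'a poly3)"
  by unfold_locales (simp_all add: single_add mult_single)

definition base_change :: "'a::field poly3 \<Rightarrow> 'a alg_closure poly3" where
  "base_change = eval_at (\<lambda>c. cst (to_ac c)) Var"

lemma comm_ring_hom_cst_to_ac: "comm_ring_hom (\<lambda>c. cst (to_ac c))"
  by (rule comm_ring_hom_comp[OF comm_ring_hom_cst comm_ring_hom_to_ac])

interpretation base_change: comm_ring_hom base_change
  unfolding base_change_def by (rule eval_at_hom[OF comm_ring_hom_cst_to_ac])

lemma base_change_gen: "base_change (cst c) = cst (to_ac c)" "base_change (Var j) = Var j"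
  by (simp_all add: base_change_def eval_at_cst[OF comm_ring_hom_cst_to_ac] eval_at_Var[OF comm_ring_hom_cst_to_ac])

lemma lookup_base_change: "lookup (base_change p) m = to_ac (lookup p m)"
proof (induction p rule: poly3_induct)
  case (single m' c)
  have "base_change (single m' c) = single m' (to_ac c)"
  proof (rule mon_exhaust[of m'])
    fix x y z assume m': "m' = mon x y z"
    show ?thesis
      unfolding m' single_mon base_change.hom_mult base_change.hom_power base_change_gen ..
  qed
  then show ?case by (simp add: lookup_single when_def)
qed (simp_all add: base_change.hom_add lookup_add)

lemma eval_base_change: "eval_at id a (base_change p) = eval_at to_ac a p"
proof (rule hom_poly3_eqI)
  show "comm_ring_hom (\<lambda>p. eval_at id a (base_change p))"
    by (rule comm_ring_hom_comp[OF eval_at_hom[OF comm_ring_hom_id] base_change.comm_ring_hom_axioms])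
qed (simp_all add: eval_id_gen eval_at_hom[OF comm_ring_hom_id] eval_at_hom[OF comm_ring_hom_to_ac] eval_at_cst[OF comm_ring_hom_to_ac] eval_at_Var[OF comm_ring_hom_to_ac]
    base_change_gen del: id_apply)

text \<open>Smoothness speaks only of points on the curve, but Euler's formula puts every common
  zero of the partial derivatives on it; over the closure they are thus free of base points.\<close>

lemma smooth_curve_no_low_syzygy:
  fixes f :: "'a::field_char_0 poly3"
  assumes "smooth_curve f" "f \<in> forms d" "\<And>j. b j \<in> forms m" "m < d - 1"
    and "(\<Sum>j\<in>UNIV. b j * partial_deriv j f) = 0"
  shows "b j = 0"
proof -
  have forms: "base_change p \<in> forms k" if "p \<in> forms k" for p :: "'a poly3" and k
    using that by (auto simp: forms_def in_keys_iff lookup_base_change)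
  have "base_change (b j) = 0"
  proof (rule no_low_syzygy_if_base_point_free[where g = "\<lambda>j. base_change (partial_deriv j f)" and e = "d - 1"])
    show "base_change (partial_deriv j f) \<in> forms (d - 1)" for j
      by (intro forms partial_deriv_forms assms)
    show "base_change (b j) \<in> forms m" for j by (intro forms assms)
    show "(\<Sum>j\<in>UNIV. base_change (b j) * base_change (partial_deriv j f)) = 0"
      using assms(5) by (simp flip: base_change.hom_mult base_change.hom_sum)
    fix p :: "3 \<Rightarrow> 'a alg_closure" assume p: "\<exists>j. p j \<noteq> 0"
    show "\<exists>j. eval_at id p (base_change (partial_deriv j f)) \<noteq> 0"
    proof (rule ccontr)
      assume "\<not> ?thesis"
      then have zero: "eval_at to_ac p (partial_deriv j f) = 0" for j by (simp add: eval_base_change)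
      interpret ev: comm_ring_hom "eval_at to_ac p" by (rule eval_at_hom[OF comm_ring_hom_to_ac])
      have "eval_at to_ac p (cst (of_nat d) * f) = eval_at to_ac p (\<Sum>j\<in>UNIV. Var j * partial_deriv j f)"
        by (simp only: euler_formula[OF assms(2)])
      then have "of_nat d * eval_at to_ac p f = 0"
        unfolding ev.hom_mult ev.hom_sum eval_at_cst[OF comm_ring_hom_to_ac] by (simp add: zero)
      moreover have "d \<noteq> 0" using assms(4) by auto
      ultimately have "eval_at to_ac p f = 0" by simp
      with p zero assms(1) show False unfolding smooth_curve_def by blast
    qed
  qed fact
  then have "to_ac (lookup (b j) m) = 0" for m by (metis lookup_base_change lookup_zero)
  then show ?thesis by (intro poly_mapping_eqI) simp
qed

section \<open>Linear systems\<close>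

text \<open>Vectors over a domain either satisfy a linear relation or possess a dual family up to
  a nonzero scalar; the second alternative survives every specialization of that scalar to a
  nonzero value.\<close>

lemma dependent_or_dual_family:
  fixes m :: "'i \<Rightarrow> 'k \<Rightarrow> 'r::idom"
  assumes "finite I" "finite T"
  shows "(\<exists>x. (\<exists>i\<in>I. x i \<noteq> 0) \<and> (\<forall>t\<in>T. (\<Sum>i\<in>I. x i * m i t) = 0)) \<or>
    (\<exists>N \<delta>. \<delta> \<noteq> 0 \<and> (\<forall>i\<in>I. \<forall>j\<in>I. (\<Sum>t\<in>T. N i t * m j t) = (if i = j then \<delta> else 0)))"
  using assms(1)
proof (induction I)
  case empty
  show ?case by (intro disjI2 exI[of _ "\<lambda>_ _. 0"] exI[of _ 1]) simp
next
  case (insert q I)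
  show ?case
  proof (cases "\<exists>x. (\<exists>i\<in>I. x i \<noteq> 0) \<and> (\<forall>t\<in>T. (\<Sum>i\<in>I. x i * m i t) = 0)")
    case True
    then obtain x where x: "\<exists>i\<in>I. x i \<noteq> 0" "\<And>t. t \<in> T \<Longrightarrow> (\<Sum>i\<in>I. x i * m i t) = 0" by blast
    have "(\<Sum>i\<in>insert q I. (x(q := 0)) i * m i t) = 0" if "t \<in> T" for t
    proof -
      have "(\<Sum>i\<in>I. (x(q := 0)) i * m i t) = (\<Sum>i\<in>I. x i * m i t)"
        using insert.hyps by (intro sum.cong) auto
      then show ?thesis using insert.hyps x(2)[OF that] by simp
    qed
    moreover have "\<exists>i\<in>insert q I. (x(q := 0)) i \<noteq> 0" using x(1) insert.hyps by auto
    ultimately show ?thesis by blast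
  next
    case False
    with insert.IH obtain N \<delta> where \<delta>: "\<delta> \<noteq> 0"
      and N: "\<And>i j. i \<in> I \<Longrightarrow> j \<in> I \<Longrightarrow> (\<Sum>t\<in>T. N i t * m j t) = (if i = j then \<delta> else 0)" by blast
    \<comment> \<open>Gram-Schmidt without division: \<open>r\<close> is \<open>\<delta>\<close>
      times the part of the new vector that all old functionals kill.\<close>
    define a where "a i = (\<Sum>t\<in>T. N i t * m q t)" for i
    define r where "r t = \<delta> * m q t - (\<Sum>i\<in>I. a i * m i t)" for t
    show ?thesis
    proof (cases "\<forall>t\<in>T. r t = 0")
      case True
      define x where "x i = (if i = q then \<delta> else - a i)" for i
      have "(\<Sum>i\<in>insert q I. x i * m i t) = r t" for t
      proof -
        have "(\<Sum>i\<in>I. x i * m i t) = (\<Sum>i\<in>I. - (a i * m i t))"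
          using insert.hyps by (intro sum.cong) (auto simp: x_def)
        then show ?thesis using insert.hyps by (simp add: x_def r_def sum_negf)
      qed
      with True \<delta> show ?thesis by (intro disjI1 exI[of _ x]) (auto simp: x_def)
    next
      case False
      then obtain t0 where t0: "t0 \<in> T" "r t0 \<noteq> 0" by blast
      \<comment> \<open>The coordinate functional at \<open>t0\<close>, corrected so that it kills
        the old vectors; on the new vector it takes the value \<open>r t0\<close>.\<close>
      define \<psi> where "\<psi> t = (if t = t0 then \<delta> else 0) - (\<Sum>i\<in>I. N i t * m i t0)" for t
      have \<psi>: "(\<Sum>t\<in>T. \<psi> t * m j t) = \<delta> * m j t0 - (\<Sum>i\<in>I. (\<Sum>t\<in>T. N i t * m j t) * m i t0)" for j
      proof -
        have "(\<Sum>t\<in>T. \<psi> t * m j t) = (\<Sum>t\<in>T. (if t = t0 then \<delta> * m j t else 0)) - (\<Sum>t\<in>T. \<Sum>i\<in>I. N i t * m j t * m i t0)"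
          unfolding \<psi>_def left_diff_distrib sum_subtractf
          by (intro arg_cong2[where f = minus] sum.cong) (auto simp: sum_distrib_left sum_distrib_right mult_ac)
        also have "(\<Sum>t\<in>T. \<Sum>i\<in>I. N i t * m j t * m i t0) = (\<Sum>i\<in>I. (\<Sum>t\<in>T. N i t * m j t) * m i t0)"
          unfolding sum_distrib_right by (rule sum.swap)
        finally show ?thesis using assms(2) t0(1) by simp
      qed
      have \<psi>_I: "(\<Sum>t\<in>T. \<psi> t * m j t) = 0" if "j \<in> I" for j
      proof -
        have "(\<Sum>i\<in>I. (\<Sum>t\<in>T. N i t * m j t) * m i t0) = (\<Sum>i\<in>I. if i = j then \<delta> * m j t0 else 0)"
          using N that by (intro sum.cong) auto
        then show ?thesis unfolding \<psi> using insert.hyps(1) that by simp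
      qed
      have \<psi>_q: "(\<Sum>t\<in>T. \<psi> t * m q t) = r t0" unfolding \<psi> by (simp add: r_def a_def)
      define N' where "N' i t = (if i = q then \<delta> * \<psi> t else r t0 * N i t - a i * \<psi> t)" for i t
      have "(\<Sum>t\<in>T. N' i t * m j t) = (if i = j then \<delta> * r t0 else 0)" if "i \<in> insert q I" "j \<in> insert q I" for i j
      proof (cases "i = q")
        case True
        have "(\<Sum>t\<in>T. N' i t * m j t) = \<delta> * (\<Sum>t\<in>T. \<psi> t * m j t)"
          by (simp add: N'_def True sum_distrib_left mult.assoc)
        with that True insert.hyps show ?thesis by (cases "j = q") (auto simp: \<psi>_I \<psi>_q)
      next
        case False
        then have i: "i \<in> I" using that by simp
        have "(\<Sum>t\<in>T. N' i t * m j t) = r t0 * (\<Sum>t\<in>T. N i t * m j t) - a i * (\<Sum>t\<in>T. \<psi> t * m j t)"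
          using False by (simp add: N'_def sum_distrib_left left_diff_distrib sum_subtractf mult.assoc)
        with that False insert.hyps i show ?thesis
          by (cases "j = q") (auto simp: \<psi>_I \<psi>_q N a_def[symmetric])
      qed
      then show ?thesis using \<delta> t0(2) by (intro disjI2 exI[of _ N'] exI[of _ "\<delta> * r t0"]) simp
    qed
  qed
qed

text \<open>Gaussian elimination without division: the entries \<open>m'\<close> are minors formed
  with the pivot \<open>m p t\<close>, so one stays inside the domain.\<close>

lemma underdetermined_system:
  fixes m :: "'i \<Rightarrow> 'k \<Rightarrow> 'r::idom"
  assumes "finite T" "finite I" "card T < card I"
  shows "\<exists>x. (\<exists>i\<in>I. x i \<noteq> 0) \<and> (\<forall>t\<in>T. (\<Sum>i\<in>I. x i * m i t) = 0)"
  using assms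
proof (induction T arbitrary: I m)
  case empty
  then have "I \<noteq> {}" by auto
  then show ?case by (intro exI[of _ "\<lambda>_. 1"]) auto
next
  case (insert t T)
  show ?case
  proof (cases "\<forall>i\<in>I. m i t = 0")
    case True
    have "card T < card I" using insert by simp
    from insert.IH[OF insert.prems(1) this, of m] obtain x
      where x: "\<exists>i\<in>I. x i \<noteq> 0" "\<And>t. t \<in> T \<Longrightarrow> (\<Sum>i\<in>I. x i * m i t) = 0" by blast
    moreover have "(\<Sum>i\<in>I. x i * m i t) = 0" using True by simp
    ultimately show ?thesis by blast
  next
    case False
    then obtain p where p: "p \<in> I" "m p t \<noteq> 0" by blast
    define m' where "m' i t' = m p t * m i t' - m i t * m p t'" for i t'
    have "card T < card (I - {p})" using insert p by simp
    then obtain x where x: "\<exists>i\<in>I - {p}. x i \<noteq> 0" "\<And>t. t \<in> T \<Longrightarrow> (\<Sum>i\<in>I - {p}. x i * m' i t) = 0"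
      using insert.IH[of "I - {p}" m'] insert.prems(1) by blast
    define y where "y i = (if i = p then - (\<Sum>i\<in>I - {p}. x i * m i t) else m p t * x i)" for i
    have y: "(\<Sum>i\<in>I. y i * m i t') = (\<Sum>i\<in>I - {p}. x i * m' i t')" for t'
    proof -
      have "(\<Sum>i\<in>I. y i * m i t') = y p * m p t' + (\<Sum>i\<in>I - {p}. y i * m i t')"
        using insert.prems(1) p(1) by (rule sum.remove)
      also have "(\<Sum>i\<in>I - {p}. y i * m i t') = (\<Sum>i\<in>I - {p}. m p t * x i * m i t')"
        by (intro sum.cong) (auto simp: y_def)
      also have "y p * m p t' = - (\<Sum>i\<in>I - {p}. x i * m i t * m p t')"
        by (simp add: y_def sum_distrib_right)
      finally show ?thesis
        by (simp add: m'_def right_diff_distrib sum_subtractf mult_ac)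
    qed
    have "(\<Sum>i\<in>I - {p}. x i * m' i t) = 0" by (simp add: m'_def mult.commute)
    with x(2) have "\<forall>t'\<in>insert t T. (\<Sum>i\<in>I. y i * m i t') = 0" by (auto simp: y)
    moreover have "\<exists>i\<in>I. y i \<noteq> 0" using x(1) p by (auto simp: y_def)
    ultimately show ?thesis by blast
  qed
qed

text \<open>With the right-hand side adjoined as the vector \<open>None\<close> there is one vector
  too many. The resulting relation involves it, by independence of the others, and can be solved for
  it.\<close>

lemma independent_imp_spanning:
  fixes m :: "'i \<Rightarrow> 'k \<Rightarrow> 'r::field"
  assumes "finite T" "finite I" "card I = card T"
    and indep: "\<And>x. (\<And>t. t \<in> T \<Longrightarrow> (\<Sum>i\<in>I. x i * m i t) = 0) \<Longrightarrow> \<forall>i\<in>I. x i = 0"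
  obtains x where "\<And>t. t \<in> T \<Longrightarrow> (\<Sum>i\<in>I. x i * m i t) = c t"
proof -
  define m' where "m' i t = (case i of None \<Rightarrow> c t | Some i \<Rightarrow> m i t)" for i t
  let ?I = "insert None (Some ` I)"
  have "card ?I = Suc (card I)" using assms(2) by (simp add: card_image)
  with underdetermined_system[of T ?I m'] assms(1-3) obtain x where
    x: "\<exists>i\<in>?I. x i \<noteq> 0" "\<And>t. t \<in> T \<Longrightarrow> (\<Sum>i\<in>?I. x i * m' i t) = 0" by auto
  have s: "(\<Sum>i\<in>?I. x i * m' i t) = x None * c t + (\<Sum>i\<in>I. x (Some i) * m i t)" for t
    using assms(2) by (simp add: m'_def sum.reindex)
  have "x None \<noteq> 0"
  proof
    assume 0: "x None = 0"
    then have "\<forall>i\<in>I. x (Some i) = 0" using x(2) by (intro indep) (simp add: s)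
    with 0 x(1) show False by auto
  qed
  then have "(\<Sum>i\<in>I. (- x (Some i) / x None) * m i t) = c t" if "t \<in> T" for t
  proof -
    have "(\<Sum>i\<in>I. x (Some i) * m i t) = - (x None * c t)" using x(2)[OF that] by (simp add: s add_eq_0_iff)
    then have "(\<Sum>i\<in>I. (- x (Some i) / x None) * m i t) = - (- (x None * c t)) / x None"
      by (simp add: sum_negf flip: sum_divide_distrib)
    then show ?thesis using \<open>x None \<noteq> 0\<close> by simp
  qed
  then show thesis by (rule that)
qed

text \<open>\<open>B j\<close> is the number of admissible coefficients of the \<open>j\<close>-th
  entry, so that \<open>B j = 0\<close> can demand a zero entry and the total over \<open>j\<close>
  is the number of unknowns.\<close>

definition supported :: "(3 \<Rightarrow> nat) \<Rightarrow> (3 \<Rightarrow> 'a::zero poly) \<Rightarrow> bool" where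
  "supported B C \<longleftrightarrow> (\<forall>j i. B j \<le> i \<longrightarrow> coeff (C j) i = 0)"

abbreviation slots :: "(3 \<Rightarrow> nat) \<Rightarrow> (3 \<times> nat) set" where
  "slots B \<equiv> SIGMA j:UNIV. {..<B j}"

lemma card_slots: "card (slots B) = B 0 + B 1 + B 2"
  by (simp add: sum_three)

lemma coeff_supported_combination:
  fixes C h :: "3 \<Rightarrow> 'a::comm_ring_1 poly"
  assumes "supported B C"
  shows "coeff (\<Sum>j\<in>UNIV. C j * h j) t
    = (\<Sum>(j, i)\<in>slots B. coeff (C j) i * coeff (monom 1 i * h j) t)"
proof -
  have C: "C j = (\<Sum>i<B j. monom (coeff (C j) i) i)" for j
    using assms unfolding supported_def by (intro poly_eqI) (auto simp: coeff_sum sum.delta not_less)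
  have "C j * h j = (\<Sum>i<B j. Polynomial.smult (coeff (C j) i) (monom 1 i * h j))" for j
    by (subst C[of j]) (simp add: sum_distrib_right smult_monom flip: mult_smult_left)
  then show ?thesis by (simp add: coeff_sum sum.Sigma case_prod_unfold)
qed

lemma supported_family:
  fixes x :: "3 \<times> nat \<Rightarrow> 'a::comm_ring_1" and B :: "3 \<Rightarrow> nat"
  defines "C \<equiv> \<lambda>j. \<Sum>i<B j. monom (x (j, i)) i"
  shows "supported B C" "(j, i) \<in> slots B \<Longrightarrow> coeff (C j) i = x (j, i)"
  by (auto simp: C_def supported_def coeff_sum sum.delta)

section \<open>Restriction to a line\<close>

definition at_line :: "'a::comm_ring_1 \<Rightarrow> 'a \<Rightarrow> 'a poly poly \<Rightarrow> 'a" where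
  "at_line u v c = poly (poly c [:v:]) u"

lemma comm_ring_hom_at_line: "comm_ring_hom (at_line u v)"
  unfolding at_line_def by (rule comm_ring_hom_comp[OF comm_ring_hom_poly comm_ring_hom_poly])

interpretation at_line: comm_ring_hom "at_line u v"
  by (rule comm_ring_hom_at_line)

definition restr :: "'a::comm_ring_1 \<Rightarrow> 'a \<Rightarrow> 'a poly3 \<Rightarrow> 'a poly" where
  "restr u v p = map_poly (at_line u v) (on_lines p)"

interpretation restr: comm_ring_hom "restr u v"
  unfolding restr_def
  by (rule comm_ring_hom_comp[OF comm_ring_hom_map_poly[OF comm_ring_hom_at_line] on_lines.comm_ring_hom_axioms])

lemma restr_gen [simp]:
  "restr u v (cst c) = [:c:]" "restr u v (Var 0) = pCons 0 1" "restr u v (Var 1) = 1" "restr u v (Var 2) = [:v, u:]"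
  by (simp_all add: restr_def at_line.map_poly_pCons_hom at_line_def map_poly_1')

lemma coeff_restr: "coeff (restr u v p) t = at_line u v (coeff (on_lines p) t)"
  by (simp add: restr_def coeff_map_poly)

lemma degree_restr_forms: "p \<in> forms k \<Longrightarrow> deg (restr u v p) \<le> k"
  unfolding restr_def using on_lines_forms(1) degree_map_poly_le le_trans by blast

lemma coeff_restr_forms: "p \<in> forms k \<Longrightarrow> coeff (restr u v p) k = poly (at_inf p) u"
  by (simp add: coeff_restr on_lines_forms(2) at_line_def)

lemma restr_single: "restr u v (single (mon a b 0) x) = monom x a"
  unfolding single_mon restr.hom_mult restr.hom_power restr_gen pCons_0_1_power by (simp add: smult_monom)

lemma restr_forms_ex:
  assumes "deg c \<le> k" obtains p where "p \<in> forms k" "restr u v p = c"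
proof
  let ?p = "\<Sum>i\<le>k. single (mon i (k - i) 0) (coeff c i)"
  show "?p \<in> forms k" by (rule forms_sum) (auto intro!: forms_single)
  show "restr u v ?p = c"
    unfolding restr.hom_sum restr_single using assms by (simp add: poly_as_sum_of_monoms')
qed

definition line_form :: "'a::comm_ring_1 \<Rightarrow> 'a \<Rightarrow> 'a poly3" where
  "line_form u v = Var 2 - cst u * Var 0 - cst v * Var 1"

lemma line_form_forms: "line_form u v \<in> forms (Suc 0)"
  unfolding line_form_def by (intro forms_diff forms_cst_mult forms_Var)

lemma restr_line_form [simp]: "restr u v (line_form u v) = 0"
  unfolding line_form_def by (simp add: restr.hom_minus restr.hom_mult)

text \<open>Division by \<open>line_form u v\<close>, which is monic in \<open>x2\<close>. The
  clause for \<open>k = 0\<close> makes up for the truncated \<open>k - 1\<close>.\<close>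

lemma eliminate_last_variable:
  assumes "p \<in> forms k"
  obtains q r where "p = q + line_form u v * r" "q \<in> forms k" "\<forall>m. lookup m 2 \<noteq> 0 \<longrightarrow> lookup q m = 0"
    "r \<in> forms (k - 1)" "k = 0 \<longrightarrow> r = 0"
proof -
  define good where "good k p \<longleftrightarrow> (\<exists>q r. p = q + line_form u v * r \<and> q \<in> forms k \<and>
    (\<forall>m. lookup m 2 \<noteq> 0 \<longrightarrow> lookup q m = 0) \<and> r \<in> forms (k - 1) \<and> (k = 0 \<longrightarrow> r = 0))" for k p
  have add: "good k (p + p')" if "good k p" "good k p'" for k p p'
  proof -
    from that obtain q r q' r' where "p = q + line_form u v * r" "p' = q' + line_form u v * r'"
      "q \<in> forms k" "q' \<in> forms k" "\<forall>m. lookup m 2 \<noteq> 0 \<longrightarrow> lookup q m = 0" "\<forall>m. lookup m 2 \<noteq> 0 \<longrightarrow> lookup q' m = 0"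
      "r \<in> forms (k - 1)" "r' \<in> forms (k - 1)" "k = 0 \<longrightarrow> r = 0" "k = 0 \<longrightarrow> r' = 0"
      unfolding good_def by blast
    then show ?thesis unfolding good_def
      by (intro exI[of _ "q + q'"] exI[of _ "r + r'"]) (auto simp: lookup_add forms_add algebra_simps)
  qed
  have zero: "good k 0" for k
    unfolding good_def by (intro exI[of _ 0]) simp
  have single: "good (a + b + c) (single (mon a b c) x)" for a b c x
  proof (induction c arbitrary: a b x)
    case 0
    have "lookup (single (mon a b 0) x) m = 0" if "lookup m 2 \<noteq> 0" for m
      using that by (auto simp: lookup_single when_def)
    then show ?case unfolding good_def
      by (intro exI[of _ "single (mon a b 0) x"] exI[of _ 0]) (auto intro: forms_single)
  next
    case (Suc c)
    let ?s = "single (mon a b c) x"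
    have V: "Var 2 = line_form u v + cst u * Var 0 + cst v * Var 1" by (simp add: line_form_def)
    have "single (mon a b (Suc c)) x = Var 2 * ?s" by (simp add: single_mon mult_ac)
    also have "\<dots> = line_form u v * ?s + cst u * (Var 0 * ?s) + cst v * (Var 1 * ?s)"
      unfolding V by (simp add: algebra_simps)
    also have "cst u * (Var 0 * ?s) = single (mon (Suc a) b c) (u * x)"
      by (simp add: single_mon mult_ac flip: mult_single[of 0 u 0 x, simplified])
    also have "cst v * (Var 1 * ?s) = single (mon a (Suc b) c) (v * x)"
      by (simp add: single_mon mult_ac flip: mult_single[of 0 v 0 x, simplified])
    finally have eq: "single (mon a b (Suc c)) x = line_form u v * ?s
      + single (mon (Suc a) b c) (u * x) + single (mon a (Suc b) c) (v * x)" .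
    have "good (a + b + Suc c) (line_form u v * ?s)"
      unfolding good_def by (intro exI[of _ 0] exI[of _ ?s]) (auto intro: forms_single)
    moreover have "good (a + b + Suc c) (single (mon (Suc a) b c) (u * x))"
      "good (a + b + Suc c) (single (mon a (Suc b) c) (v * x))"
      using Suc.IH[of "Suc a" b "u * x"] Suc.IH[of a "Suc b" "v * x"] by simp_all
    ultimately show ?case unfolding eq by (intro add)
  qed
  have "good k p"
    using assms by (induction rule: forms_induct) (use zero single add in blast)+
  then show thesis unfolding good_def using that by blast
qed

text \<open>The remainder involves \<open>x0\<close> and \<open>x1\<close> only, and such a form is
  determined by its restriction to the line.\<close>

lemma restr_zero_dvd:
  assumes "p \<in> forms k" "restr u v p = 0"
  obtains r where "p = line_form u v * r" "r \<in> forms (k - 1)" "k = 0 \<longrightarrow> r = 0"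
proof -
  obtain q r where qr: "p = q + line_form u v * r" "q \<in> forms k" "\<forall>m. lookup m 2 \<noteq> 0 \<longrightarrow> lookup q m = 0"
    "r \<in> forms (k - 1)" "k = 0 \<longrightarrow> r = 0"
    by (rule eliminate_last_variable[OF assms(1), where u = u and v = v])
  have q0: "restr u v q = 0" using assms(2) unfolding qr(1) by (simp add: restr.hom_add restr.hom_mult)
  have "q = 0"
  proof (rule poly_mapping_eqI)
    fix m
    show "lookup q m = lookup 0 m"
    proof (rule mon_exhaust[of m])
      fix a b c assume m: "m = mon a b c"
      show ?thesis
      proof (cases "c = 0 \<and> a + b = k")
        case True
        have "coeff (restr u v (single m' (lookup q m'))) a = (if m' = m then lookup q m' else 0)"
          if "m' \<in> keys q" for m'
        proof (rule mon_exhaust[of m'])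
          fix a' b' c' assume m': "m' = mon a' b' c'"
          have "c' = 0" using that qr(3)[rule_format, of m'] by (auto simp: m' in_keys_iff)
          moreover have "a' + b' + c' = k" using that qr(2) by (auto simp: forms_def m')
          ultimately show ?thesis using True unfolding m' m by (auto simp: restr_single)
        qed
        then have "coeff (restr u v q) a = (\<Sum>m'\<in>keys q. if m' = m then lookup q m' else 0)"
          by (subst (1) poly3_expand[of q]) (simp add: restr.hom_sum coeff_sum)
        with q0 show ?thesis by (simp add: in_keys_iff split: if_splits)
      next
        case False
        then show ?thesis
          using qr(3)[rule_format, of m] lookup_forms[OF qr(2), of m] by (cases "c = 0") (simp_all add: m)
      qed
    qed
  qed
  with qr show thesis by (intro that) auto
qed

section \<open>Syzygies on the general line\<close>

context net
begin

definition restr_syzygy :: "'a \<Rightarrow> 'a \<Rightarrow> (3 \<Rightarrow> 'a poly) \<Rightarrow> bool" where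
  "restr_syzygy u v C \<longleftrightarrow> (\<Sum>j\<in>UNIV. C j * restr u v (g j)) = 0"

lemma restr_syzygy_of_syzygy: "syzygy k b \<Longrightarrow> restr_syzygy u v (\<lambda>j. restr u v (b j))"
  unfolding syzygy_def restr_syzygy_def by (metis (no_types, lifting) restr.hom_mult restr.hom_sum restr.hom_zero sum.cong)

text \<open>The assumption is linear independence of the products
  \<open>monom 1 i * on_lines (g j)\<close> over \<open>K[u, v]\<close>. It is certified by a dual
  family with scalar \<open>\<delta>\<close>, and the certificate specializes to every line with
  nonzero \<open>\<delta>\<close>.\<close>

lemma generic_supported_syzygies:
  assumes "\<And>A j. line_syzygy A \<Longrightarrow> supported B A \<Longrightarrow> A j = 0"
  obtains \<delta> where "\<delta> \<noteq> 0"
    "\<And>u v C j. at_line u v \<delta> \<noteq> 0 \<Longrightarrow> restr_syzygy u v C \<Longrightarrow> supported B C \<Longrightarrow> C j = 0"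
proof -
  define m where "m = (\<lambda>(j, i) t. coeff (monom 1 i * on_lines (g j)) t)"
  \<comment> \<open>Large enough to contain the exponents of all products, so that no coefficient is
    lost.\<close>
  define T where "T = {..e + B 0 + B 1 + B 2}"
  have m_high: "m (j, i) t = 0" if "(j, i) \<in> slots B" "t \<notin> T" for j i t
  proof -
    have "deg (monom 1 i * on_lines (g j)) \<le> i + e"
      using degree_mult_le[of "monom 1 i" "on_lines (g j)"] degree_monom_le[of "1 :: 'a poly poly" i]
        on_lines_forms(1)[OF g_forms[of j]] by linarith
    moreover have "i \<le> B 0 + B 1 + B 2"
    proof -
      have "\<forall>j. B j \<le> B 0 + B 1 + B 2" unfolding all_three by simp
      then have "B j \<le> B 0 + B 1 + B 2" by blast
      with that(1) show ?thesis by simp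
    qed
    ultimately show ?thesis using that(2) unfolding m_def T_def by (auto intro!: coeff_eq_0)
  qed
  have fin: "finite (slots B)" "finite T" by (auto simp: T_def)
  have indep: "\<not> (\<exists>x. (\<exists>s\<in>slots B. x s \<noteq> 0) \<and> (\<forall>t\<in>T. (\<Sum>s\<in>slots B. x s * m s t) = 0))"
  proof
    assume "\<exists>x. (\<exists>s\<in>slots B. x s \<noteq> 0) \<and> (\<forall>t\<in>T. (\<Sum>s\<in>slots B. x s * m s t) = 0)"
    then obtain x j i where x: "(j, i) \<in> slots B" "x (j, i) \<noteq> 0" "\<And>t. t \<in> T \<Longrightarrow> (\<Sum>s\<in>slots B. x s * m s t) = 0"
      by fastforce
    define A where "A = (\<lambda>j. \<Sum>i<B j. monom (x (j, i)) i)"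
    have A: "supported B A" "\<And>j i. (j, i) \<in> slots B \<Longrightarrow> coeff (A j) i = x (j, i)"
      unfolding A_def by (rule supported_family, rule supported_family)
    have "(\<Sum>j\<in>UNIV. A j * on_lines (g j)) = 0"
    proof (rule poly_eqI)
      fix t
      have "coeff (\<Sum>j\<in>UNIV. A j * on_lines (g j)) t = (\<Sum>s\<in>slots B. x s * m s t)"
        unfolding coeff_supported_combination[OF A(1)] by (rule sum.cong) (auto simp: A(2) m_def)
      also have "\<dots> = 0"
      proof (cases "t \<in> T")
        case False
        then show ?thesis using m_high by (intro sum.neutral) auto
      qed (rule x(3))
      finally show "coeff (\<Sum>j\<in>UNIV. A j * on_lines (g j)) t = coeff 0 t" by simp
    qed
    then have "A j = 0" using A(1) by (intro assms) (simp_all add: line_syzygy_def)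
    with A(2)[OF x(1)] x(2) show False by simp
  qed
  have dual: "\<exists>N \<delta>. \<delta> \<noteq> 0 \<and> (\<forall>s\<in>slots B. \<forall>s'\<in>slots B. (\<Sum>t\<in>T. N s t * m s' t) = (if s = s' then \<delta> else 0))"
    by (rule disjE[OF dependent_or_dual_family[OF fin, of m]]) (erule notE[OF indep], assumption)
  then obtain N where "\<exists>\<delta>. \<delta> \<noteq> 0 \<and> (\<forall>s\<in>slots B. \<forall>s'\<in>slots B. (\<Sum>t\<in>T. N s t * m s' t) = (if s = s' then \<delta> else 0))"
    by (rule exE)
  then obtain \<delta> where N\<delta>: "\<delta> \<noteq> 0 \<and> (\<forall>s\<in>slots B. \<forall>s'\<in>slots B. (\<Sum>t\<in>T. N s t * m s' t) = (if s = s' then \<delta> else 0))"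
    by (rule exE)
  have \<delta>: "\<delta> \<noteq> 0" using N\<delta> by (rule conjunct1)
  have N: "(\<Sum>t\<in>T. N s t * m s' t) = (if s = s' then \<delta> else 0)" if "s \<in> slots B" "s' \<in> slots B" for s s'
    using bspec[OF bspec[OF conjunct2[OF N\<delta>] that(1)] that(2)] .
  show thesis
  proof (rule that[OF \<delta>])
    fix u v C j assume nz: "at_line u v \<delta> \<noteq> 0" and C: "restr_syzygy u v C" "supported B C"
    have rel: "(\<Sum>(j, i)\<in>slots B. coeff (C j) i * at_line u v (m (j, i) t)) = 0" for t
    proof -
      have "at_line u v (m (j, i) t) = coeff (monom 1 i * restr u v (g j)) t" for j i
        by (simp add: m_def coeff_monom_mult coeff_restr)
      then have "(\<Sum>(j, i)\<in>slots B. coeff (C j) i * at_line u v (m (j, i) t))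
          = coeff (\<Sum>j\<in>UNIV. C j * restr u v (g j)) t"
        by (simp only: coeff_supported_combination[OF C(2)])
      with C(1) show ?thesis by (simp add: restr_syzygy_def)
    qed
    have "coeff (C j) i = 0" if "(j, i) \<in> slots B" for i
    proof -
      have "0 = (\<Sum>t\<in>T. at_line u v (N (j, i) t) * (\<Sum>(j', i')\<in>slots B. coeff (C j') i' * at_line u v (m (j', i') t)))"
        by (simp only: rel mult_zero_right sum.neutral_const)
      also have "\<dots> = (\<Sum>t\<in>T. \<Sum>s\<in>slots B. coeff (C (fst s)) (snd s) * at_line u v (N (j, i) t * m s t))"
        by (simp add: sum_distrib_left case_prod_unfold at_line.hom_mult mult_ac)
      also have "\<dots> = (\<Sum>s\<in>slots B. coeff (C (fst s)) (snd s) * at_line u v (\<Sum>t\<in>T. N (j, i) t * m s t))"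
        by (subst sum.swap) (simp add: at_line.hom_sum sum_distrib_left)
      also have "\<dots> = (\<Sum>s\<in>slots B. if s = (j, i) then coeff (C j) i * at_line u v \<delta> else 0)"
        using N[OF that] by (intro sum.cong) auto
      also have "\<dots> = coeff (C j) i * at_line u v \<delta>" using that fin(1) by (simp add: sum.delta)
      finally show ?thesis using nz by simp
    qed
    then show "C j = 0"
      using C(2) unfolding supported_def by (intro poly_eqI) (metis SigmaI UNIV_I coeff_0 lessThan_iff not_le)
  qed
qed

text \<open>The condition linking the two sides of the equivalence: it does not mention any line,
  and for partial derivatives it is the condition on the coincidence threshold.\<close>

definition stable :: bool where
  "stable \<longleftrightarrow> (\<forall>k b j. 2 * k + 2 \<le> e \<longrightarrow> syzygy k b \<longrightarrow> b j = 0)"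

text \<open>What injectivity of multiplication by \<open>line_form u v\<close> requires of the
  line.\<close>

definition lines_lift :: "'a \<Rightarrow> 'a \<Rightarrow> bool" where
  "lines_lift u v \<longleftrightarrow> (\<forall>k C. 2 * k + 2 \<le> e \<longrightarrow> (\<forall>j. deg (C j) \<le> k) \<longrightarrow> restr_syzygy u v C \<longrightarrow>
    (\<exists>b. syzygy k b \<and> (\<forall>j. restr u v (b j) = C j)))"

text \<open>Surjectivity in the critical degree, read on the line. For \<open>e \<ge> 1\<close>,
  \<open>n = (e - 1) div 2\<close> is the least multiplier degree for which the
  \<open>3 * (n + 1)\<close> unknowns reach the \<open>n + e + 1\<close> equations.\<close>

definition lines_span :: "'a \<Rightarrow> 'a \<Rightarrow> bool" where
  "lines_span u v \<longleftrightarrow> (\<forall>c. deg c \<le> (e - 1) div 2 + e \<longrightarrow>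
    (\<exists>C. (\<forall>j. deg (C j) \<le> (e - 1) div 2) \<and> c = (\<Sum>j\<in>UNIV. C j * restr u v (g j))))"

lemma no_line_syzygy_if_stable:
  assumes "stable" "line_syzygy A" "\<And>j. deg (A j) \<le> k" "2 * k + 2 \<le> e"
  shows "A j = 0"
proof (rule ccontr)
  assume "A j \<noteq> 0"
  with assms obtain b i where "syzygy k b" "b i \<noteq> 0"
    by (auto elim!: descent[of A j k])
  with assms(1,4) show False unfolding stable_def by blast
qed

text \<open>The pattern makes the system square. For even \<open>e\<close> full entries of degree
  \<open>n\<close> do. For odd \<open>e = 2 * n + 1\<close> there is one unknown too many and a
  syzygy of degree \<open>n\<close> may exist; all such syzygies are proportional, so giving up one
  well-chosen leading coefficient excludes them.\<close>

lemma stable_slots: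
  assumes "stable" "e \<ge> 1"
  obtains B where "B 0 + B 1 + B 2 = (e - 1) div 2 + e + 1" "\<And>j. B j \<le> (e - 1) div 2 + 1"
    "\<And>j. e \<le> 2 * B j + 1"
    "\<And>A j. line_syzygy A \<Longrightarrow> supported B A \<Longrightarrow> A j = 0"
proof (cases "even e")
  case True
  then obtain n' where "e = 2 * n'" by (rule evenE)
  with assms(2) have "e = 2 * (n' - 1) + 2" by simp
  then obtain n where n: "e = 2 * n + 2" by blast
  show thesis
  proof (rule that[of "\<lambda>_. Suc n"])
    fix A j assume A: "line_syzygy A" "supported (\<lambda>_. Suc n) A"
    have "deg (A j) \<le> n" for j
      using A(2) unfolding supported_def by (intro degree_le) (auto simp: Suc_le_eq)
    with assms(1) A(1) show "A j = 0" by (rule no_line_syzygy_if_stable) (simp add: n)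
  qed (simp_all add: n)
next
  case False
  then obtain n where n: "e = 2 * n + 1" by (rule oddE)
  define B where "B i = (\<lambda>j :: 3. if j = i then n else Suc n)" for i
  have "\<exists>i. \<forall>A. line_syzygy A \<longrightarrow> supported (B i) A \<longrightarrow> (\<forall>j. A j = 0)"
  proof (rule ccontr)
    assume "\<not> ?thesis"
    then have "\<forall>i. \<exists>A. line_syzygy A \<and> supported (B i) A \<and> (\<exists>j. A j \<noteq> 0)" by blast
    then obtain A where A: "\<And>i. line_syzygy (A i)" "\<And>i. supported (B i) (A i)" "\<And>i. \<exists>j. A i j \<noteq> 0" by metis
    have deg: "deg (A i j) \<le> n" for i j
      using A(2)[of i] unfolding supported_def B_def by (intro degree_le) (auto simp: Suc_le_eq)
    have top: "\<exists>j. coeff (A i j) n \<noteq> 0" for i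
    proof (rule ccontr)
      assume no: "\<not> ?thesis"
      obtain j where j: "A i j \<noteq> 0" using A(3) by blast
      then have "n \<noteq> 0" using no deg[of i j] by (metis le_zero_eq leading_coeff_0_iff)
      then obtain n' where n': "n = Suc n'" by (cases n) auto
      have "deg (A i j) \<le> n'" for j
      proof (intro degree_le allI impI)
        fix t assume "t > n'"
        then have "t = n \<or> deg (A i j) < t" using deg[of i j] n' by linarith
        then show "coeff (A i j) t = 0" using no by (auto simp: coeff_eq_0)
      qed
      from no_line_syzygy_if_stable[OF assms(1) A(1) this, of j] j show False by (simp add: n n')
    qed
    have cross_top: "coeff (A i j) n * coeff (A i' j') n = coeff (A i j') n * coeff (A i' j) n" for i i' j j'
    proof -
      have "proportional (A i) (A i')"
        using A(1) A(1) deg deg by (rule line_syzygies_proportional) (simp add: n)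
      then have "coeff (A i j * A i' j') (n + n) = coeff (A i j' * A i' j) (n + n)"
        unfolding proportional_def by simp
      then show ?thesis unfolding coeff_mult_le[OF deg deg] .
    qed
    \<comment> \<open>\<open>A 0\<close> has a leading coefficient at the place \<open>i\<close>
      where the pattern of \<open>A i\<close> forbids one, so proportionality kills all leading
      coefficients of \<open>A i\<close>.\<close>
    obtain i where i: "coeff (A 0 i) n \<noteq> 0" using top by blast
    have "coeff (A i i) n = 0" using A(2)[of i] unfolding supported_def B_def by simp
    then have "coeff (A i j) n = 0" for j using cross_top[of 0 i i j] i by simp
    with top[of i] show False by blast
  qed
  then obtain i where i: "\<And>A j. line_syzygy A \<Longrightarrow> supported (B i) A \<Longrightarrow> A j = 0" by blast
  have "(\<Sum>j\<in>UNIV. B i j) = (\<Sum>j\<in>UNIV - {i}. Suc n) + n"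
    by (simp add: B_def sum.If_cases Collect_neg_eq Compl_eq_Diff_UNIV sum.remove[of UNIV i])
  also have "\<dots> = 3 * n + 2" by (simp add: card_Diff_singleton)
  finally have "B i 0 + B i 1 + B i 2 = 3 * n + 2" by (simp only: sum_three)
  then show thesis
  proof (intro that[of "B i"])
    show "B i j \<le> (e - 1) div 2 + 1" "e \<le> 2 * B i j + 1" for j by (simp_all add: n B_def)
    show "A j = 0" if "line_syzygy A" "supported (B i) A" for A j using that by (rule i)
  qed (simp add: n)
qed

lemma degree_restr_combination:
  assumes "\<And>j. deg (C j) \<le> n"
  shows "deg (\<Sum>j\<in>UNIV. C j * restr u v (g j)) \<le> n + e"
proof (rule degree_sum_le)
  fix j :: 3
  show "deg (C j * restr u v (g j)) \<le> n + e"
    using degree_mult_le[of "C j" "restr u v (g j)"] assms[of j] degree_restr_forms[OF g_forms[of j], of u v]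
    by linarith
qed simp

lemma degree_of_supported:
  assumes "supported B C" "B j \<le> Suc n" shows "deg (C j) \<le> n"
  using assms unfolding supported_def by (intro degree_le) auto

text \<open>In a square system injectivity gives spanning. Lifting is immediate, since a syzygy in
  the low range fits the pattern and hence is zero.\<close>

lemma stable_lines:
  assumes "stable" "e \<ge> 1"
  obtains \<delta> where "\<delta> \<noteq> 0" "\<And>u v. at_line u v \<delta> \<noteq> 0 \<Longrightarrow> lines_lift u v \<and> lines_span u v"
proof -
  define n where "n = (e - 1) div 2"
  obtain B where B: "B 0 + B 1 + B 2 = n + e + 1" "\<And>j. B j \<le> n + 1" "\<And>j. e \<le> 2 * B j + 1"
    and no: "\<And>A j. line_syzygy A \<Longrightarrow> supported B A \<Longrightarrow> A j = 0"
    unfolding n_def by (rule stable_slots[OF assms]) blast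
  from no obtain \<delta> where \<delta>: "\<delta> \<noteq> 0"
    and inj: "\<And>u v C j. at_line u v \<delta> \<noteq> 0 \<Longrightarrow> restr_syzygy u v C \<Longrightarrow> supported B C \<Longrightarrow> C j = 0"
    by (rule generic_supported_syzygies[where B = B]) blast+
  show thesis
  proof (rule that[OF \<delta>], rule conjI)
    fix u v assume uv: "at_line u v \<delta> \<noteq> 0"
    show "lines_lift u v"
      unfolding lines_lift_def
    proof (intro allI impI)
      fix k C assume k: "2 * k + 2 \<le> e" and C: "\<forall>j. deg (C j) \<le> k" "restr_syzygy u v C"
      have "supported B C"
        unfolding supported_def
      proof (intro allI impI)
        fix j i assume "B j \<le> i"
        then have "k < i" using B(3)[of j] k by linarith
        then show "coeff (C j) i = 0" using C(1) by (intro coeff_eq_0) (metis le_less_trans)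
      qed
      with uv C(2) have "C j = 0" for j by (rule inj)
      then show "\<exists>b. syzygy k b \<and> (\<forall>j. restr u v (b j) = C j)"
        by (intro exI[of _ "\<lambda>_. 0"]) (simp add: syzygy_def)
    qed
    show "lines_span u v"
      unfolding lines_span_def n_def[symmetric]
    proof (intro allI impI)
      fix c :: "'a poly" assume c: "deg c \<le> n + e"
      define m where "m = (\<lambda>s t. coeff (monom 1 (snd s) * restr u v (g (fst s))) t)"
      define fam where "fam x j = (\<Sum>i<B j. monom (x (j, i)) i)" for x :: "3 \<times> nat \<Rightarrow> 'a" and j
      have fam: "supported B (fam x)" for x
        unfolding fam_def by (rule supported_family)
      have fam2: "coeff (fam x j) i = x (j, i)" if "(j, i) \<in> slots B" for j i x
        unfolding fam_def using that by (rule supported_family)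
      have deg: "deg (fam x j) \<le> n" for x j
        using B(2)[of j] by (intro degree_of_supported[OF fam]) simp
      have coeff: "coeff (\<Sum>j\<in>UNIV. fam x j * restr u v (g j)) t = (\<Sum>s\<in>slots B. x s * m s t)" for x t
        unfolding coeff_supported_combination[OF fam] by (rule sum.cong) (auto simp: fam2 m_def)
      have "card (slots B) = card {..n + e}" unfolding card_slots B(1) by simp
      moreover have "\<forall>s\<in>slots B. x s = 0" if x: "\<And>t. t \<in> {..n + e} \<Longrightarrow> (\<Sum>s\<in>slots B. x s * m s t) = 0" for x
      proof
        have "(\<Sum>j\<in>UNIV. fam x j * restr u v (g j)) = 0"
        proof (rule poly_eqI)
          fix t
          show "coeff (\<Sum>j\<in>UNIV. fam x j * restr u v (g j)) t = coeff 0 t"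
          proof (cases "t \<le> n + e")
            case True
            then show ?thesis using x[of t] by (simp only: coeff coeff_0) simp
          next
            case False
            then show ?thesis
              using degree_restr_combination[where C = "fam x" and u = u and v = v, OF deg] by (simp add: coeff_eq_0)
          qed
        qed
        then have "fam x j = 0" for j using uv fam by (intro inj) (simp_all add: restr_syzygy_def)
        then show "x s = 0" if "s \<in> slots B" for s using fam2[of "fst s" "snd s" x] that by simp
      qed
      ultimately obtain x where x: "\<And>t. t \<in> {..n + e} \<Longrightarrow> (\<Sum>s\<in>slots B. x s * m s t) = coeff c t"
        by (rule independent_imp_spanning[of "{..n + e}" "slots B" m "coeff c", rotated 2]) auto
      have "c = (\<Sum>j\<in>UNIV. fam x j * restr u v (g j))"
      proof (rule poly_eqI)
        fix t
        show "coeff c t = coeff (\<Sum>j\<in>UNIV. fam x j * restr u v (g j)) t"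
        proof (cases "t \<le> n + e")
          case True
          then show ?thesis using x[of t] by (simp only: coeff) simp
        next
          case False
          then show ?thesis
            using degree_restr_combination[where C = "fam x" and u = u and v = v, OF deg] c by (simp add: coeff_eq_0)
        qed
      qed
      with deg show "\<exists>C. (\<forall>j. deg (C j) \<le> n) \<and> c = (\<Sum>j\<in>UNIV. C j * restr u v (g j))"
        by blast
    qed
  qed
qed

text \<open>Minimality also provides a component that survives at infinity: otherwise
  \<open>Var 1\<close> could be cancelled from all of them.\<close>

lemma unstable_minimal_syzygy:
  assumes "\<not> stable"
  obtains r b i where "2 * r + 2 \<le> e" "syzygy r b" "at_inf (b i) \<noteq> 0" "b i \<noteq> 0"
    "\<And>k b' j. k < r \<Longrightarrow> syzygy k b' \<Longrightarrow> b' j = 0"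
proof -
  define P where "P k \<longleftrightarrow> (\<exists>b j. syzygy k b \<and> b j \<noteq> 0)" for k
  define r where "r = (LEAST k. P k)"
  from assms obtain k where k: "2 * k + 2 \<le> e" "P k" unfolding stable_def P_def by blast
  then have r: "P r" "r \<le> k" unfolding r_def by (auto intro: LeastI Least_le)
  have min: "b' j = 0" if "k < r" "syzygy k b'" for k b' j
    using that not_less_Least[of k P] unfolding r_def P_def by blast
  from r(1) obtain b j where b: "syzygy r b" "b j \<noteq> 0" unfolding P_def by blast
  have bf: "b i \<in> forms r" for i using b(1) by (simp add: syzygy_def)
  have "\<exists>i. at_inf (b i) \<noteq> 0"
  proof (rule ccontr)
    assume "\<not> ?thesis"
    then have inf: "at_inf (b i) = 0" for i by blast
    show False
    proof (cases r)
      case 0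
      with forms_0_at_inf[of "b j"] bf[of j] inf[of j] b(2) show False by simp
    next
      case (Suc r')
      have "\<exists>q. q \<in> forms r' \<and> b i = Var 1 * q" for i
        using at_inf_zero_dvd[of "b i" r'] bf[of i] inf[of i] unfolding Suc by metis
      then obtain q where q: "\<And>i. q i \<in> forms r'" "\<And>i. b i = Var 1 * q i" by metis
      have "Var 1 * (\<Sum>i\<in>UNIV. q i * g i) = 0"
        using b(1) by (simp add: syzygy_def q sum_distrib_left mult.assoc)
      then have "syzygy r' q" using q(1) Var_neq_0[of 1] by (auto simp: syzygy_def)
      from min[OF _ this, of j] Suc q(2)[of j] b(2) show False by simp
    qed
  qed
  then obtain i where i: "at_inf (b i) \<noteq> 0" by blast
  then have "b i \<noteq> 0" by auto
  have "2 * r + 2 \<le> e" using k(1) r(2) by linarith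
  from this b(1) i \<open>b i \<noteq> 0\<close> min show thesis by (rule that)
qed

lemma restr_syzygy_reduce:
  assumes "restr_syzygy u v C" "restr_syzygy u v D"
  shows "restr_syzygy u v (\<lambda>j. C j - q * D j)"
proof -
  have "(\<Sum>j\<in>UNIV. (C j - q * D j) * restr u v (g j))
      = (\<Sum>j\<in>UNIV. C j * restr u v (g j)) - q * (\<Sum>j\<in>UNIV. D j * restr u v (g j))"
    by (simp add: left_diff_distrib sum_subtractf sum_distrib_left mult.assoc)
  with assms show ?thesis by (simp add: restr_syzygy_def)
qed

text \<open>Modulo the minimal syzygy \<open>b\<close> every triple on the line reduces to one whose
  \<open>i\<close>-th entry has degree below \<open>r\<close>. In low degree no reduced triple is a
  nonzero syzygy, which gives lifting, and the reduced triples are too few to span.\<close>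

lemma unstable_lines:
  assumes "\<not> stable"
  obtains \<delta> where "\<delta> \<noteq> 0" "\<And>u v. at_line u v \<delta> \<noteq> 0 \<Longrightarrow> lines_lift u v \<and> \<not> lines_span u v"
proof -
  obtain r b i where r: "2 * r + 2 \<le> e" and b: "syzygy r b" and i: "at_inf (b i) \<noteq> 0" "b i \<noteq> 0"
    and min: "\<And>k b' j. k < r \<Longrightarrow> syzygy k b' \<Longrightarrow> b' j = 0"
    by (rule unstable_minimal_syzygy[OF assms]) blast
  have bf: "b j \<in> forms r" for j using b by (simp add: syzygy_def)
  \<comment> \<open>The largest degree with \<open>2 * K + 2 \<le> e\<close>.\<close>
  define K where "K = e div 2 - 1"
  have K: "2 * K + 2 \<le> e" "r \<le> K" using r by (auto simp: K_def)
  define B where "B j = (if j = i then r else Suc K)" for j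
  have no: "A j = 0" if A: "line_syzygy A" "supported B A" for A j
  proof -
    have dA: "deg (A j) \<le> K" for j
      using K(2) by (intro degree_of_supported[OF A(2)]) (simp add: B_def)
    have rK: "r + K < e" using K by linarith
    obtain c where c: "\<And>j. A j = c * on_lines (b j)"
    proof (rule line_syzygy_multiple[where r = r and b = b and i = i and A = A and k = K])
      show "syzygy r b" "b i \<noteq> 0" "line_syzygy A" "r + K < e" by fact+
      show "deg (A j) \<le> K" for j by (rule dA)
      show "b' j = 0" if "k < r" "syzygy k b'" for k b' j using that by (rule min)
    qed (rule that)
    have "coeff (on_lines (b i)) r \<noteq> 0" using i(1) by (simp add: on_lines_forms(2)[OF bf])
    then have nz: "on_lines (b i) \<noteq> 0" and "r \<le> deg (on_lines (b i))" by (auto intro: le_degree)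
    have "c = 0"
    proof (rule ccontr)
      assume "c \<noteq> 0"
      with nz have Ai: "A i \<noteq> 0" by (simp add: c)
      have "r \<le> deg (A i)"
        using degree_mult_ge[OF \<open>c \<noteq> 0\<close>, of "on_lines (b i)"] \<open>r \<le> deg (on_lines (b i))\<close> by (simp add: c)
      then have "coeff (A i) (deg (A i)) = 0"
        using A(2) unfolding supported_def by (simp add: B_def)
      with Ai show False by simp
    qed
    then show ?thesis by (simp add: c)
  qed
  from no obtain \<delta> where \<delta>: "\<delta> \<noteq> 0"
    and inj: "\<And>u v C j. at_line u v \<delta> \<noteq> 0 \<Longrightarrow> restr_syzygy u v C \<Longrightarrow> supported B C \<Longrightarrow> C j = 0"
    by (rule generic_supported_syzygies[where B = B]) blast+
  show thesis
  \<comment> \<open>The second factor keeps the degree of \<open>b i\<close> equal to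
    \<open>r\<close> on the line, so it can serve as divisor.\<close>
  proof (rule that[of "\<delta> * [:at_inf (b i):]"])
    show "\<delta> * [:at_inf (b i):] \<noteq> 0" using \<delta> i by simp
    fix u v assume "at_line u v (\<delta> * [:at_inf (b i):]) \<noteq> 0"
    then have uv: "at_line u v \<delta> \<noteq> 0" and iu: "poly (at_inf (b i)) u \<noteq> 0"
      by (auto simp: at_line_def)
    let ?b = "\<lambda>j. restr u v (b j)"
    have bi: "?b i \<noteq> 0" "deg (?b i) = r"
      using iu coeff_restr_forms[OF bf, of u v i] degree_restr_forms[OF bf, of u v i]
      by (auto intro!: antisym le_degree)
    have bdeg: "deg (?b j) \<le> r" for j by (rule degree_restr_forms[OF bf])
    have bs: "restr_syzygy u v ?b" by (rule restr_syzygy_of_syzygy[OF b])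
    \<comment> \<open>Reduction does not raise the degree, as no component of \<open>b\<close>
      exceeds the degree \<open>r\<close> of the divisor.\<close>
    have qdeg: "deg (C i div ?b i * ?b j) \<le> k" if "deg (C i) \<le> k" for C k j
    proof (cases "C i div ?b i = 0")
      case False
      have "deg (C i div ?b i) + r \<le> k"
      proof -
        have "r \<le> deg (C i)" using False bi(2) div_poly_less[of "C i" "?b i"] by force
        moreover have "C i mod ?b i = 0 \<or> deg (C i mod ?b i) < r"
          using degree_mod_less[OF bi(1), of "C i"] bi(2) by simp
        ultimately have "deg (C i mod ?b i) \<le> k" using that by auto
        then have "deg (C i - C i mod ?b i) \<le> k" using that by (intro degree_diff_le)
        moreover have "C i - C i mod ?b i = C i div ?b i * ?b i" by (rule minus_mod_eq_div_mult)
        moreover have "deg (C i div ?b i * ?b i) = deg (C i div ?b i) + r"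
          using False bi by (simp add: degree_mult_eq)
        ultimately show ?thesis by simp
      qed
      then show ?thesis using degree_mult_le[of "C i div ?b i" "?b j"] bdeg[of j] by linarith
    qed simp
    have red: "coeff (C i - C i div ?b i * ?b i) t = 0" if "r \<le> t" for C :: "3 \<Rightarrow> 'a poly" and t
    proof -
      have "C i - C i div ?b i * ?b i = C i mod ?b i" by (rule minus_div_mult_eq_mod)
      moreover have "C i mod ?b i = 0 \<or> deg (C i mod ?b i) < r"
        using degree_mod_less[OF bi(1), of "C i"] bi(2) by simp
      ultimately show ?thesis using that by (auto intro: coeff_eq_0)
    qed
    have lift: "lines_lift u v"
      unfolding lines_lift_def
    proof (intro allI impI)
      fix k C assume k: "2 * k + 2 \<le> e" and C: "\<forall>j. deg (C j) \<le> k" "restr_syzygy u v C"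
      define q where "q = C i div ?b i"
      have "supported B (\<lambda>j. C j - q * ?b j)"
        unfolding supported_def
      proof (intro allI impI)
        fix j t assume t: "B j \<le> t"
        show "coeff (C j - q * ?b j) t = 0"
        proof (cases "j = i")
          case True
          then show ?thesis using red[of t C] t by (simp add: q_def B_def)
        next
          case False
          have "deg (C j - q * ?b j) \<le> k"
            using C(1) qdeg[of C k j] unfolding q_def by (intro degree_diff_le) auto
          moreover have "k < t" using t False k by (simp add: B_def K_def)
          ultimately show ?thesis by (intro coeff_eq_0) simp
        qed
      qed
      with uv restr_syzygy_reduce[OF C(2) bs] have "C j - q * ?b j = 0" for j by (rule inj)
      then have Cq: "C j = q * ?b j" for j by simp
      show "\<exists>b. syzygy k b \<and> (\<forall>j. restr u v (b j) = C j)"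
      proof (cases "q = 0")
        case True
        then show ?thesis by (intro exI[of _ "\<lambda>_. 0"]) (simp add: syzygy_def Cq)
      next
        case False
        have "deg (q * ?b i) = deg q + r"
          using False bi by (simp add: degree_mult_eq)
        then have le: "deg q + r \<le> k" using C(1) Cq[of i] by metis
        then have "deg q \<le> k - r" by simp
        then obtain Q where Q: "Q \<in> forms (k - r)" "restr u v Q = q" by (rule restr_forms_ex)
        have "Q * b j \<in> forms k" for j using forms_mult[OF Q(1) bf[of j]] le by simp
        moreover have "(\<Sum>j\<in>UNIV. Q * b j * g j) = Q * (\<Sum>j\<in>UNIV. b j * g j)"
          by (simp add: sum_distrib_left mult.assoc)
        ultimately have "syzygy k (\<lambda>j. Q * b j)" using b by (simp add: syzygy_def)
        then show ?thesis by (intro exI[of _ "\<lambda>j. Q * b j"]) (simp add: restr.hom_mult Q Cq)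
      qed
    qed
    define n where "n = (e - 1) div 2"
    have n: "2 * n + 2 + r < n + e + 1" "r \<le> n" using r unfolding n_def by linarith+
    define B' where "B' j = (if j = i then r else Suc n)" for j
    define m where "m = (\<lambda>s t. coeff (monom 1 (snd s) * restr u v (g (fst s))) t)"
    have "(\<Sum>j\<in>UNIV. B' j) = r + (\<Sum>j\<in>UNIV - {i}. Suc n)"
      by (simp add: B'_def sum.remove[of UNIV i])
    also have "\<dots> = 2 * n + 2 + r" by (simp add: card_Diff_singleton)
    finally have "card (slots B') < card {..n + e}" using n unfolding card_slots sum_three by simp
    \<comment> \<open>The transposed system: \<open>y\<close> is a functional on polynomials of
      degree at most \<open>n + e\<close> that kills all reduced combinations but not the monomial
      of exponent \<open>t0\<close>.\<close>
    with underdetermined_system[of "slots B'" "{..n + e}" "\<lambda>t s. m s t"] obtain y t0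
      where y: "t0 \<le> n + e" "y t0 \<noteq> 0" "\<And>s. s \<in> slots B' \<Longrightarrow> (\<Sum>t\<le>n + e. y t * m s t) = 0" by auto
    have "\<not> lines_span u v"
    proof
      assume "lines_span u v"
      moreover have "deg (monom 1 t0 :: 'a poly) \<le> n + e"
        using y(1) by (intro order_trans[OF degree_monom_le])
      ultimately obtain C where C: "\<And>j. deg (C j) \<le> n" "monom 1 t0 = (\<Sum>j\<in>UNIV. C j * restr u v (g j))"
        unfolding lines_span_def n_def by blast
      define q where "q = C i div ?b i"
      define D where "D = (\<lambda>j. C j - q * ?b j)"
      have "(\<Sum>j\<in>UNIV. D j * restr u v (g j))
          = (\<Sum>j\<in>UNIV. C j * restr u v (g j)) - q * (\<Sum>j\<in>UNIV. ?b j * restr u v (g j))"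
        by (simp add: D_def left_diff_distrib sum_subtractf sum_distrib_left mult.assoc)
      with bs C(2) have D: "monom 1 t0 = (\<Sum>j\<in>UNIV. D j * restr u v (g j))" by (simp add: restr_syzygy_def)
      have sup: "supported B' D"
        unfolding supported_def
      proof (intro allI impI)
        fix j t assume t: "B' j \<le> t"
        show "coeff (D j) t = 0"
        proof (cases "j = i")
          case True
          then show ?thesis using red[of t C] t by (simp add: D_def q_def B'_def)
        next
          case False
          have "deg (D j) \<le> n"
            using C(1) qdeg[of C n j] unfolding D_def q_def by (intro degree_diff_le) auto
          with t False show ?thesis by (intro coeff_eq_0) (simp add: B'_def)
        qed
      qed
      have co: "coeff (monom 1 t0) t = (\<Sum>s\<in>slots B'. coeff (D (fst s)) (snd s) * m s t)" for t
        unfolding D coeff_supported_combination[OF sup] by (simp add: m_def case_prod_unfold)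
      have "y t0 = (\<Sum>t\<le>n + e. y t * coeff (monom 1 t0) t)"
        using y(1) by (simp add: if_distrib[of "\<lambda>c. _ * c"] cong: if_cong)
      also have "\<dots> = (\<Sum>t\<le>n + e. \<Sum>s\<in>slots B'. coeff (D (fst s)) (snd s) * (y t * m s t))"
        unfolding co by (simp add: sum_distrib_left mult_ac)
      also have "\<dots> = (\<Sum>s\<in>slots B'. coeff (D (fst s)) (snd s) * (\<Sum>t\<le>n + e. y t * m s t))"
        by (subst sum.swap) (simp add: sum_distrib_left)
      also have "\<dots> = 0" using y(3) by (intro sum.neutral) auto
      finally show False using y(2) by simp
    qed
    with lift show "lines_lift u v \<and> \<not> lines_span u v" ..
  qed
qed

end

section \<open>Multiplication by a linear form modulo the net\<close>

definition part :: "nat \<Rightarrow> 'a::comm_monoid_add poly3 \<Rightarrow> 'a poly3" where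
  "part k p = (\<Sum>m\<in>{m \<in> keys p. monom_degree m = k}. single m (lookup p m))"

lemma lookup_part: "lookup (part k p) m = (if monom_degree m = k then lookup p m else 0)"
proof -
  have "lookup (part k p) m = (\<Sum>m'\<in>{m' \<in> keys p. monom_degree m' = k}. if m' = m then lookup p m' else 0)"
    unfolding part_def lookup_sum by (rule sum.cong) (auto simp: lookup_single when_def)
  then show ?thesis by (auto simp: in_keys_iff)
qed

lemma part_forms: "part k p \<in> forms k"
  unfolding forms_def by (auto simp: in_keys_iff lookup_part split: if_splits)

lemma part_of_form: "p \<in> forms n \<Longrightarrow> part k p = (if k = n then p else 0)"
  by (rule poly_mapping_eqI) (auto simp: lookup_part lookup_forms)

lemma part_add: "part k (p + q) = part k p + part k q"
  by (rule poly_mapping_eqI) (simp add: lookup_part lookup_add)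

lemma part_zero [simp]: "part k 0 = 0"
  by (rule poly_mapping_eqI) (simp add: lookup_part)

lemma part_sum: "part k (\<Sum>i\<in>I. h i) = (\<Sum>i\<in>I. part k (h i))"
  by (induction I rule: infinite_finite_induct) (simp_all add: part_add)

lemma part_mult:
  assumes "g \<in> forms e"
  shows "part n (c * g) = (if e \<le> n then part (n - e) c * g else (0 :: 'a::comm_ring_1 poly3))"
proof (induction c rule: poly3_induct)
  case (single m x)
  have s: "single m x \<in> forms (monom_degree m)" by (rule forms_single) simp
  have "single m x * g \<in> forms (monom_degree m + e)" by (rule forms_mult[OF s assms])
  from part_of_form[OF this, of n] part_of_form[OF s, of "n - e"] show ?case by auto
qed (auto simp: distrib_right part_add)

text \<open>As the generators are forms of one degree, the coefficients of a homogeneous member can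
  be replaced by their components of the right degree.\<close>

lemma combos_forms:
  fixes g :: "3 \<Rightarrow> 'a::comm_ring_1 poly3"
  assumes "p \<in> combos g" "p \<in> forms n" "\<And>j. g j \<in> forms e"
  shows "n < e \<Longrightarrow> p = 0"
    and "e \<le> n \<Longrightarrow> \<exists>C. (\<forall>j. C j \<in> forms (n - e)) \<and> p = (\<Sum>j\<in>UNIV. C j * g j)"
proof -
  from assms(1) obtain C where C: "p = (\<Sum>j\<in>UNIV. C j * g j)" unfolding combos_def by blast
  have p: "p = (\<Sum>j\<in>UNIV. part n (C j * g j))" using part_of_form[OF assms(2), of n] unfolding C part_sum by simp
  show "p = 0" if "n < e" using p that by (simp add: part_mult[OF assms(3)])
  show "\<exists>C. (\<forall>j. C j \<in> forms (n - e)) \<and> p = (\<Sum>j\<in>UNIV. C j * g j)" if "e \<le> n"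
    using p that by (intro exI[of _ "\<lambda>j. part (n - e) (C j)"]) (simp add: part_mult[OF assms(3)] part_forms)
qed

lemma linear_coeffs_line_form: "linear_coeffs (line_form u v) 0 = - u" "linear_coeffs (line_form u v) 1 = - v"
  "linear_coeffs (line_form u v) 2 = (1 :: 'a::comm_ring_1)"
proof -
  have "single i (1::nat) \<noteq> single j 1" if "i \<noteq> j" for i j :: 3
    using that by (metis lookup_single_eq lookup_single_not_eq zero_neq_one)
  then show "linear_coeffs (line_form u v) 0 = - u" "linear_coeffs (line_form u v) 1 = - v"
    "linear_coeffs (line_form u v) 2 = (1 :: 'a)"
    unfolding linear_coeffs_def line_form_def lookup_minus lookup_cst_mult
    by (simp_all add: Var_def lookup_single when_def)
qed

lemma line_form_neq_0: "line_form u v \<noteq> (0 :: 'a::comm_ring_1 poly3)"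
proof
  assume "line_form u v = (0 :: 'a poly3)"
  then have "linear_coeffs (line_form u v) 2 = (0 :: 'a)" by (simp add: linear_coeffs_def)
  then show False by (simp add: linear_coeffs_line_form)
qed

context net
begin

text \<open>If the product with the line form is a combination of \<open>g\<close>, its coefficients
  restrict to a syzygy on the line. Subtracting a lift of it to the plane makes them divisible by
  the line form, which is then cancelled.\<close>

lemma line_form_mult_injective:
  assumes "lines_lift u v" "x \<in> forms i" "2 * i + 4 \<le> 3 * e" "line_form u v * x \<in> combos g"
  shows "x \<in> combos g"
proof -
  have f: "line_form u v * x \<in> forms (Suc i)" using forms_mult[OF line_form_forms assms(2)] by simp
  note cf = combos_forms[OF assms(4) f g_forms]
  show ?thesis
  proof (cases "Suc i < e")
    case True
    from cf(1)[OF this] line_form_neq_0[of u v] have "x = 0" by simp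
    then show ?thesis using combos_mult[OF combos_generator, of 0 g] by simp
  next
    case False
    define k where "k = Suc i - e"
    from cf(2) False obtain A where A: "\<And>j. A j \<in> forms k" "line_form u v * x = (\<Sum>j\<in>UNIV. A j * g j)"
      unfolding k_def by auto
    \<comment> \<open>With \<open>k = i + 1 - e\<close> this is the bound
      \<open>2 * i + 4 \<le> 3 * e\<close>.\<close>
    have k: "2 * k + 2 \<le> e" using assms(3) False by (simp add: k_def)
    have "restr u v (\<Sum>j\<in>UNIV. A j * g j) = 0" unfolding A(2)[symmetric] restr.hom_mult by simp
    then have "restr_syzygy u v (\<lambda>j. restr u v (A j))"
      unfolding restr_syzygy_def restr.hom_sum restr.hom_mult .
    moreover have "\<forall>j. deg (restr u v (A j)) \<le> k" using degree_restr_forms[OF A(1)] by blast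
    ultimately have "\<exists>b. syzygy k b \<and> (\<forall>j. restr u v (b j) = restr u v (A j))"
      using assms(1)[unfolded lines_lift_def, rule_format, OF k, of "\<lambda>j. restr u v (A j)"] by simp
    then obtain b where b: "syzygy k b" "\<And>j. restr u v (b j) = restr u v (A j)" by blast
    have "\<exists>r. A j - b j = line_form u v * r" for j
    proof -
      have "A j - b j \<in> forms k" using A(1) b(1) by (intro forms_diff) (auto simp: syzygy_def)
      moreover have "restr u v (A j - b j) = 0" by (simp add: restr.hom_minus b(2))
      ultimately show ?thesis by (metis restr_zero_dvd)
    qed
    then obtain r where r: "\<And>j. A j - b j = line_form u v * r j" by metis
    have "line_form u v * x = (\<Sum>j\<in>UNIV. (A j - b j) * g j)"
      using A(2) b(1) by (simp add: left_diff_distrib sum_subtractf syzygy_def)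
    also have "\<dots> = line_form u v * (\<Sum>j\<in>UNIV. r j * g j)"
      by (simp add: r sum_distrib_left mult.assoc)
    finally have "x = (\<Sum>j\<in>UNIV. r j * g j)" using line_form_neq_0[of u v] by simp
    then show ?thesis by (rule combosI)
  qed
qed

text \<open>Only the lowest degree looks at the line. Above it, Euler's formula writes
  \<open>y\<close> as a combination of the variables with its partial derivatives as coefficients,
  to which the previous degree applies.\<close>

lemma line_form_mult_surjective:
  assumes "lines_span u v" "e \<ge> 1" "i \<ge> (e - 1) div 2 + e - 1" "y \<in> forms (Suc i)"
  shows "\<exists>x\<in>forms i. y - line_form u v * x \<in> combos g"
  using assms(3,4)
proof (induction i arbitrary: y rule: dec_induct)
  case base
  define n where "n = (e - 1) div 2"
  have Suc: "Suc (n + e - 1) = n + e" using assms(2) by simp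
  have y: "y \<in> forms (n + e)" using base unfolding n_def[symmetric] Suc .
  have "deg (restr u v y) \<le> n + e" by (rule degree_restr_forms[OF y])
  with assms(1) obtain C where C: "\<And>j. deg (C j) \<le> n" "restr u v y = (\<Sum>j\<in>UNIV. C j * restr u v (g j))"
    unfolding lines_span_def n_def by blast
  have "\<exists>A. A \<in> forms n \<and> restr u v A = C j" for j using restr_forms_ex[OF C(1)] by metis
  then obtain A where A: "\<And>j. A j \<in> forms n" "\<And>j. restr u v (A j) = C j" by metis
  let ?z = "y - (\<Sum>j\<in>UNIV. A j * g j)"
  have "?z \<in> forms (n + e)" by (intro forms_diff forms_sum forms_mult y A g_forms)
  moreover have "restr u v ?z = 0" unfolding restr.hom_minus restr.hom_sum restr.hom_mult A(2) C(2) by simp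
  ultimately obtain x where x: "?z = line_form u v * x" "x \<in> forms (n + e - 1)" by (rule restr_zero_dvd)
  have "y - line_form u v * x = (\<Sum>j\<in>UNIV. A j * g j)" by (simp flip: x(1))
  then have "y - line_form u v * x \<in> combos g" by (rule combosI)
  with x(2) show ?case unfolding n_def by blast
next
  case (step i)
  let ?c = "cst (inverse (of_nat (Suc (Suc i)))) :: 'a poly3"
  have "\<exists>x. x \<in> forms i \<and> partial_deriv j y - line_form u v * x \<in> combos g" for j
    using step.IH[of "partial_deriv j y"] partial_deriv_forms[OF step.prems, of j] by auto
  then obtain x where x: "\<And>j. x j \<in> forms i" "\<And>j. partial_deriv j y - line_form u v * x j \<in> combos g" by metis
  have "?c * cst (of_nat (Suc (Suc i))) = 1"
    unfolding mult_single by (simp del: of_nat_Suc)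
  then have "y = ?c * cst (of_nat (Suc (Suc i))) * y" by (simp only: mult_1_left)
  also have "\<dots> = ?c * (cst (of_nat (Suc (Suc i))) * y)" by (rule mult.assoc)
  also have "\<dots> = ?c * (\<Sum>j\<in>UNIV. Var j * partial_deriv j y)" unfolding euler_formula[OF step.prems] ..
  finally have y: "y = ?c * (\<Sum>j\<in>UNIV. Var j * partial_deriv j y)" .
  let ?x = "?c * (\<Sum>j\<in>UNIV. Var j * x j)"
  have "(\<Sum>j\<in>UNIV. Var j * x j) \<in> forms (Suc 0 + i)" by (intro forms_sum forms_mult forms_Var x)
  then have xf: "?x \<in> forms (Suc i)" using forms_cst_mult by simp
  have eq: "y - line_form u v * ?x = ?c * (\<Sum>j\<in>UNIV. Var j * (partial_deriv j y - line_form u v * x j))"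
  proof -
    have "?c * (\<Sum>j\<in>UNIV. Var j * (partial_deriv j y - line_form u v * x j))
        = ?c * (\<Sum>j\<in>UNIV. Var j * partial_deriv j y) - line_form u v * ?x"
      by (simp only: sum_distrib_left right_diff_distrib sum_subtractf mult_ac)
    then show ?thesis unfolding y[symmetric] ..
  qed
  have "?c * (\<Sum>j\<in>UNIV. Var j * (partial_deriv j y - line_form u v * x j)) \<in> combos g"
    unfolding sum_three by (intro combos_add combos_mult x)
  then have "y - line_form u v * ?x \<in> combos g" by (simp only: eq)
  with xf show ?case by (rule bexI[rotated])
qed

lemma lines_span_of_surjective:
  assumes "e \<ge> 1" "\<And>y. y \<in> forms ((e - 1) div 2 + e) \<Longrightarrow> \<exists>x. y - line_form u v * x \<in> combos g \<and> x \<in> forms ((e - 1) div 2 + e - 1)"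
  shows "lines_span u v"
  unfolding lines_span_def
proof (intro allI impI)
  define n where "n = (e - 1) div 2"
  fix c :: "'a poly" assume "deg c \<le> (e - 1) div 2 + e"
  then obtain y where y: "y \<in> forms (n + e)" "restr u v y = c" unfolding n_def by (rule restr_forms_ex)
  with assms(2) obtain x where x: "y - line_form u v * x \<in> combos g" "x \<in> forms (n + e - 1)"
    unfolding n_def by blast
  have "line_form u v * x \<in> forms (Suc 0 + (n + e - 1))" by (rule forms_mult[OF line_form_forms x(2)])
  then have "line_form u v * x \<in> forms (n + e)" using assms(1) by simp
  with y(1) have "y - line_form u v * x \<in> forms (n + e)" by (rule forms_diff)
  from combos_forms(2)[OF x(1) this g_forms] obtain A
    where A: "\<And>j. A j \<in> forms n" "y - line_form u v * x = (\<Sum>j\<in>UNIV. A j * g j)" by auto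
  have "c = restr u v (y - line_form u v * x)" by (simp add: restr.hom_minus restr.hom_mult y(2))
  also have "\<dots> = (\<Sum>j\<in>UNIV. restr u v (A j) * restr u v (g j))"
    unfolding A(2) restr.hom_sum restr.hom_mult ..
  finally show "\<exists>C. (\<forall>j. deg (C j) \<le> (e - 1) div 2) \<and> c = (\<Sum>j\<in>UNIV. C j * restr u v (g j))"
    using degree_restr_forms[OF A(1)] unfolding n_def by (intro exI[of _ "\<lambda>j. restr u v (A j)"]) simp
qed

end

text \<open>A linear form \<open>l\<close> with \<open>l 2 \<noteq> 0\<close> cuts out the line of
  slope \<open>- l 0 / l 2\<close> and intercept \<open>- l 1 / l 2\<close>. A power of
  \<open>l 2\<close> clears the denominators in the value of \<open>\<delta>\<close>.\<close>

lemma homogenize_at_line: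
  obtains p N where "\<And>l. l 2 \<noteq> 0 \<Longrightarrow> eval_at id l p = l 2 ^ N * at_line (- l 0 / l 2) (- l 1 / l 2) (\<delta> :: 'a::field poly poly)"
proof -
  interpret ev: comm_ring_hom "eval_at id l :: 'a poly3 \<Rightarrow> 'a" for l
    by (rule eval_at_hom[OF comm_ring_hom_id])
  define good where "good \<delta> \<longleftrightarrow> (\<exists>p N. \<forall>l. l 2 \<noteq> 0 \<longrightarrow>
    eval_at id l p = l 2 ^ N * at_line (- l 0 / l 2) (- l 1 / l 2) \<delta>)" for \<delta> :: "'a poly poly"
  have add: "good (a + b)" if "good a" "good b" for a b
  proof -
    from that obtain p N q M where
      "\<forall>l. l 2 \<noteq> 0 \<longrightarrow> eval_at id l p = l 2 ^ N * at_line (- l 0 / l 2) (- l 1 / l 2) a"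
      "\<forall>l. l 2 \<noteq> 0 \<longrightarrow> eval_at id l q = l 2 ^ M * at_line (- l 0 / l 2) (- l 1 / l 2) b"
      unfolding good_def by blast
    then show ?thesis unfolding good_def
      by (intro exI[of _ "p * Var 2 ^ M + q * Var 2 ^ N"] exI[of _ "N + M"])
        (simp add: ev.hom_add ev.hom_mult ev.hom_power eval_id_gen at_line.hom_add power_add algebra_simps)
  qed
  have mult: "good (a * b)" if "good a" "good b" for a b
  proof -
    from that obtain p N q M where
      "\<forall>l. l 2 \<noteq> 0 \<longrightarrow> eval_at id l p = l 2 ^ N * at_line (- l 0 / l 2) (- l 1 / l 2) a"
      "\<forall>l. l 2 \<noteq> 0 \<longrightarrow> eval_at id l q = l 2 ^ M * at_line (- l 0 / l 2) (- l 1 / l 2) b"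
      unfolding good_def by blast
    then show ?thesis unfolding good_def
      by (intro exI[of _ "p * q"] exI[of _ "N + M"])
        (simp add: ev.hom_mult at_line.hom_mult power_add algebra_simps)
  qed
  have 1: "good [:[:c:]:]" for c
    unfolding good_def by (intro exI[of _ "cst c"] exI[of _ 0]) (simp add: eval_id_gen at_line_def)
  have 2: "good [:pCons 0 1:]"
    unfolding good_def by (intro exI[of _ "- Var 0"] exI[of _ 1]) (simp add: ev.hom_uminus eval_id_gen at_line_def)
  have 3: "good (pCons 0 1)"
    unfolding good_def by (intro exI[of _ "- Var 1"] exI[of _ 1]) (simp add: ev.hom_uminus eval_id_gen at_line_def)
  have "good \<delta>" by (induction \<delta> rule: poly_poly_induct) (rule 1 2 3 add mult; assumption)+
  then show thesis unfolding good_def using that by blast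
qed

lemma linear_form_expand:
  fixes l :: "'a::comm_ring_1 poly3"
  assumes "l \<in> forms 1"
  shows "l = (\<Sum>j\<in>UNIV. cst (linear_coeffs l j) * Var j)"
proof -
  have c: "linear_coeffs l j = lookup (partial_deriv j l) 0" for j
    by (simp add: linear_coeffs_def lookup_partial_deriv)
  have "partial_deriv j l \<in> forms 0" for j using partial_deriv_forms[OF assms, of j] by simp
  then have p: "cst (linear_coeffs l j) = partial_deriv j l" for j unfolding c by (metis forms_0_eq_cst)
  have "(\<Sum>j\<in>UNIV. cst (linear_coeffs l j) * Var j) = cst (of_nat 1) * l"
    unfolding p euler_formula[OF assms, symmetric] by (simp only: mult.commute)
  then show ?thesis by simp
qed

lemma generic_linear_forms:
  assumes "(\<delta> :: 'a::field_char_0 poly poly) \<noteq> 0"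
  obtains U where "zariski_open_forms1 U" "U \<noteq> {}"
    "\<And>l. l \<in> U \<Longrightarrow> \<exists>c u v. c \<noteq> 0 \<and> l = cst c * line_form u v \<and> at_line u v \<delta> \<noteq> 0"
proof -
  interpret ev: comm_ring_hom "eval_at id l :: 'a poly3 \<Rightarrow> 'a" for l
    by (rule eval_at_hom[OF comm_ring_hom_id])
  obtain p N where p: "\<And>l. l 2 \<noteq> 0 \<Longrightarrow> eval_at id l p = l 2 ^ N * at_line (- l 0 / l 2) (- l 1 / l 2) \<delta>"
    by (rule homogenize_at_line) blast
  \<comment> \<open>The factor \<open>Var 2\<close> excludes the lines that are not of the shape
    \<open>w = u * s + v\<close>.\<close>
  define U where "U = {l \<in> forms 1. \<exists>q\<in>{Var 2 * p}. eval_at id (linear_coeffs l) q \<noteq> 0}"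
  have "zariski_open_forms1 U" unfolding zariski_open_forms1_def U_def by blast
  moreover have "U \<noteq> {}"
  proof -
    \<comment> \<open>The field is infinite, so first \<open>v\<close> and then \<open>u\<close> can
      be chosen off the zeros of \<open>\<delta>\<close>.\<close>
    have "\<exists>v. poly \<delta> [:v:] \<noteq> 0"
    proof (rule ccontr)
      assume "\<not> ?thesis"
      then have "range (\<lambda>v :: 'a. [:v:]) \<subseteq> {x. poly \<delta> x = 0}" by auto
      then have "finite (range (\<lambda>v :: 'a. [:v:]))" using poly_roots_finite[OF assms] by (rule finite_subset)
      moreover have "inj (\<lambda>v :: 'a. [:v:])" by (rule injI) simp
      ultimately have "finite (UNIV :: 'a set)" by (rule finite_imageD)
      then show False using infinite_UNIV_char_0 by blast
    qed
    then obtain v where "poly \<delta> [:v:] \<noteq> 0" by blast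
    then obtain u where u: "at_line u v \<delta> \<noteq> 0" unfolding at_line_def using poly_all_0_iff_0 by blast
    have "line_form u v \<in> U"
      using u p[of "linear_coeffs (line_form u v)"] line_form_forms[of u v]
      by (simp add: U_def ev.hom_mult eval_id_gen linear_coeffs_line_form)
    then show ?thesis by blast
  qed
  moreover have "\<exists>c u v. c \<noteq> 0 \<and> l = cst c * line_form u v \<and> at_line u v \<delta> \<noteq> 0" if "l \<in> U" for l
  proof -
    let ?a = "linear_coeffs l"
    have l: "l \<in> forms 1" "?a 2 \<noteq> 0" "eval_at id ?a p \<noteq> 0"
      using that unfolding U_def by (auto simp: ev.hom_mult eval_id_gen)
    have "l = cst (?a 2) * line_form (- ?a 0 / ?a 2) (- ?a 1 / ?a 2)"
    proof -
      have "cst (?a 2) * (cst (- ?a j / ?a 2) * Var j) = - (cst (?a j) * Var j)" for j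
        using l(2) by (simp add: mult_single single_uminus flip: mult.assoc)
      then show ?thesis
        by (subst linear_form_expand[OF l(1)]) (simp add: line_form_def sum_three right_diff_distrib)
    qed
    moreover have "at_line (- ?a 0 / ?a 2) (- ?a 1 / ?a 2) \<delta> \<noteq> 0"
      using l(2,3) p[of ?a] by auto
    ultimately show ?thesis using l(2) by blast
  qed
  ultimately show thesis by (rule that)
qed

section \<open>The Milnor algebra\<close>

lemma poly3_ring_simps [simp]:
  "carrier poly3_ring = UNIV" "x \<otimes>\<^bsub>poly3_ring\<^esub> y = x * y" "x \<oplus>\<^bsub>poly3_ring\<^esub> y = x + y"
  "\<one>\<^bsub>poly3_ring\<^esub> = 1" "\<zero>\<^bsub>poly3_ring\<^esub> = 0"
  by (simp_all add: ring_of_type_algebra_def)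

lemma cring_poly3_ring: "cring (poly3_ring :: 'a::comm_ring_1 poly3 ring)"
  by (rule cring_from_type_algebra)

lemma ideal_combos: "ideal (combos g) (poly3_ring :: 'a::comm_ring_1 poly3 ring)"
proof -
  interpret R: cring "poly3_ring :: 'a poly3 ring" by (rule cring_poly3_ring)
  have inv: "\<ominus>\<^bsub>poly3_ring\<^esub> x = - x" for x :: "'a poly3"
    by (rule R.minus_equality) simp_all
  show ?thesis
  proof (rule idealI)
    show "subgroup (combos g) (add_monoid poly3_ring)"
    proof (rule R.add.subgroupI)
      show "combos g \<noteq> {}" using combos_generator by blast
      show "\<ominus>\<^bsub>poly3_ring\<^esub> x \<in> combos g" if "x \<in> combos g" for x
        using combos_mult[OF that, of "- 1"] by (simp add: inv)
    qed (simp_all add: combos_add)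
    show "x \<otimes>\<^bsub>poly3_ring\<^esub> a \<in> combos g" "a \<otimes>\<^bsub>poly3_ring\<^esub> x \<in> combos g" if "a \<in> combos g" for a x
      using combos_mult[OF that, of x] by (simp_all add: mult.commute)
  qed (rule R.ring_axioms)
qed

lemma jacobian_ideal_eq_combos: "jacobian_ideal f = combos (partials f)"
proof
  have "range (partials f) \<subseteq> combos (partials f)"
    using combos_generator[of "partials f"] by blast
  then show "jacobian_ideal f \<subseteq> combos (partials f)"
    unfolding jacobian_ideal_def genideal_def using ideal_combos by blast
  show "combos (partials f) \<subseteq> jacobian_ideal f"
    unfolding jacobian_ideal_def genideal_def
  proof (rule subsetI, rule InterI, elim CollectE conjE)
    fix p I assume p: "p \<in> combos (partials f)" and I: "ideal I poly3_ring" "range (partials f) \<subseteq> I"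
    interpret ideal I poly3_ring by (rule I(1))
    obtain C where C: "p = (\<Sum>j\<in>UNIV. C j * partial_deriv j f)" using p unfolding combos_def by blast
    have "C j * partial_deriv j f \<in> I" for j using I_l_closed[of "partial_deriv j f" "C j"] I(2) by auto
    moreover have "x + y \<in> I" if "x \<in> I" "y \<in> I" for x y using additive_subgroup.a_closed[OF ideal.axioms(1)[OF I(1)] that] by simp
    ultimately show "p \<in> I" unfolding C sum_three by blast
  qed
qed

lemma milnor_class_eq_image: "milnor_class f a = (\<lambda>h. h + a) ` combos (partials f)"
  unfolding milnor_class_def jacobian_ideal_eq_combos a_r_coset_def' by auto

lemma milnor_class_eq_iff: "milnor_class f a = milnor_class f b \<longleftrightarrow> a - b \<in> combos (partials f)"
proof
  have "0 \<in> combos (partials f)" using combos_mult[OF combos_generator, of 0] by simp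
  then have "a \<in> milnor_class f a" unfolding milnor_class_eq_image by (intro image_eqI[of _ _ 0]) simp_all
  moreover assume "milnor_class f a = milnor_class f b"
  ultimately obtain h where "h \<in> combos (partials f)" "a = h + b"
    unfolding milnor_class_eq_image by blast
  then show "a - b \<in> combos (partials f)" by simp
next
  have sub: "milnor_class f a \<subseteq> milnor_class f b" if "a - b \<in> combos (partials f)" for a b
    unfolding milnor_class_eq_image
  proof
    fix x assume "x \<in> (\<lambda>h. h + a) ` combos (partials f)"
    then obtain h where h: "h \<in> combos (partials f)" "x = h + a" by blast
    then have "x = (h + (a - b)) + b" by simp
    moreover have "h + (a - b) \<in> combos (partials f)" by (intro combos_add h that)
    ultimately show "x \<in> (\<lambda>h. h + b) ` combos (partials f)" by blast
  qed
  assume ab: "a - b \<in> combos (partials f)"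
  from combos_mult[OF this, of "- 1"] have "b - a \<in> combos (partials f)" by simp
  with ab sub show "milnor_class f a = milnor_class f b" by blast
qed

lemma milnor_algebra_mult: "milnor_class f a \<otimes>\<^bsub>milnor_algebra f\<^esub> milnor_class f b = milnor_class f (a * b)"
  using ideal.rcoset_mult_add[OF ideal_combos, of a b "partials f"]
  by (simp add: milnor_algebra_def milnor_class_def FactRing_def jacobian_ideal_eq_combos)

lemma milnor_algebra_add: "milnor_class f a \<oplus>\<^bsub>milnor_algebra f\<^esub> milnor_class f b = milnor_class f (a + b)"
proof -
  interpret I: ideal "combos (partials f)" poly3_ring by (rule ideal_combos)
  show ?thesis
    using I.a_rcos_sum[of a b]
    by (simp add: milnor_algebra_def milnor_class_def FactRing_def jacobian_ideal_eq_combos)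
qed

lemma milnor_mult_class: "milnor_mult f l (milnor_class f x) = milnor_class f (l * x)"
  by (simp add: milnor_mult_def milnor_algebra_mult)

lemma milnor_mult_part_subset:
  assumes "l \<in> forms (Suc 0)"
  shows "milnor_mult f l ` milnor_part f i \<subseteq> milnor_part f (i + 1)"
  using forms_mult[OF assms] by (auto simp: milnor_part_def milnor_mult_class)

lemma inj_on_milnor_mult:
  assumes "\<And>x. x \<in> forms i \<Longrightarrow> l * x \<in> combos (partials f) \<Longrightarrow> x \<in> combos (partials f)"
  shows "inj_on (milnor_mult f l) (milnor_part f i)"
proof (rule inj_onI)
  fix a b assume "a \<in> milnor_part f i" "b \<in> milnor_part f i" and eq: "milnor_mult f l a = milnor_mult f l b"
  then obtain x y where xy: "x \<in> forms i" "y \<in> forms i" "a = milnor_class f x" "b = milnor_class f y"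
    unfolding milnor_part_def by blast
  from eq have "l * (x - y) \<in> combos (partials f)"
    by (simp add: xy milnor_mult_class milnor_class_eq_iff right_diff_distrib)
  with assms xy show "a = b" by (simp add: milnor_class_eq_iff forms_diff)
qed

lemma milnor_mult_surjective_iff:
  assumes "l \<in> forms (Suc 0)"
  shows "milnor_mult f l ` milnor_part f i = milnor_part f (i + 1) \<longleftrightarrow>
    (\<forall>y\<in>forms (Suc i). \<exists>x\<in>forms i. y - l * x \<in> combos (partials f))"
proof -
  have "milnor_mult f l ` milnor_part f i = milnor_part f (i + 1) \<longleftrightarrow> milnor_part f (i + 1) \<subseteq> milnor_mult f l ` milnor_part f i"
    using milnor_mult_part_subset[OF assms, of f i] by blast
  also have "\<dots> \<longleftrightarrow> (\<forall>y\<in>forms (Suc i). \<exists>x\<in>forms i. milnor_class f y = milnor_class f (l * x))"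
    by (auto simp: milnor_part_def milnor_mult_class image_image)
  finally show ?thesis by (simp add: milnor_class_eq_iff)
qed

section \<open>Dimensions of the graded pieces\<close>

interpretation poly3: vector_space "\<lambda>(c :: 'a::field) (p :: 'a poly3). cst c * p"
  by unfold_locales (simp_all add: distrib_left distrib_right single_add mult_single flip: mult.assoc)

lemma finite_monomials: "finite {m. monom_degree m = k}"
proof (rule finite_subset)
  show "{m. monom_degree m = k} \<subseteq> (\<lambda>(a, b, c). mon a b c) ` ({..k} \<times> {..k} \<times> {..k})"
  proof
    fix m assume "m \<in> {m. monom_degree m = k}"
    then show "m \<in> (\<lambda>(a, b, c). mon a b c) ` ({..k} \<times> {..k} \<times> {..k})"
    proof (cases m rule: mon_exhaust)
      case (1 a b c)
      with \<open>m \<in> {m. monom_degree m = k}\<close> show ?thesis by (intro image_eqI[of _ _ "(a, b, c)"]) auto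
    qed
  qed
qed simp

lemma subspace_forms: "poly3.subspace (forms k)"
  by (rule poly3.subspaceI) (auto intro: forms_add forms_cst_mult)

lemma subspace_combos: "poly3.subspace (combos g)"
proof (rule poly3.subspaceI)
  show "0 \<in> combos g" using combos_mult[OF combos_generator, of 0] by simp
qed (auto intro: combos_add combos_mult)

lemma forms_expand:
  fixes p :: "'a::comm_ring_1 poly3"
  assumes "p \<in> forms k"
  shows "p = (\<Sum>m | monom_degree m = k. cst (lookup p m) * single m 1)"
proof -
  have "p = (\<Sum>m\<in>keys p. single m (lookup p m))" by (rule poly3_expand)
  also have "\<dots> = (\<Sum>m | monom_degree m = k. single m (lookup p m))"
    using assms finite_monomials by (intro sum.mono_neutral_left) (auto simp: forms_def in_keys_iff)
  finally show ?thesis by (simp add: mult_single)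
qed

lemma forms_subset_span: "forms k \<subseteq> poly3.span ((\<lambda>m. single m 1) ` {m. monom_degree m = k})"
proof
  fix p :: "'a poly3" assume "p \<in> forms k"
  then show "p \<in> poly3.span ((\<lambda>m. single m 1) ` {m. monom_degree m = k})"
    by (subst forms_expand) (assumption, rule poly3.span_sum, rule poly3.span_scale, rule poly3.span_base, rule imageI)
qed

text \<open>Rank-nullity for the map from forms to classes. Dimension in the quotient ring is built
  by line extensions, so a basis of the kernel is extended to \<open>forms k\<close> and the
  complement is adjoined vector by vector. The assumption makes the scalars a field.\<close>

lemma milnor_dim_add:
  fixes f :: "'a::field poly3"
  assumes "1 \<notin> combos (partials f)"
  shows "milnor_dim f k + poly3.dim (combos (partials f) \<inter> forms k) = poly3.dim (forms k :: 'a poly3 set)"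
proof -
  define J where "J = combos (partials f)"
  let ?cls = "milnor_class f"
  interpret ideal J poly3_ring unfolding J_def by (rule ideal_combos)
  interpret R: ring "milnor_algebra f"
    unfolding milnor_algebra_def jacobian_ideal_eq_combos by (rule quotient_is_ring[unfolded J_def])
  have zero: "\<zero>\<^bsub>milnor_algebra f\<^esub> = ?cls 0"
    by (simp add: milnor_algebra_def FactRing_def milnor_class_eq_image jacobian_ideal_eq_combos)
  have one: "\<one>\<^bsub>milnor_algebra f\<^esub> = ?cls 1"
    by (simp add: milnor_algebra_def FactRing_def milnor_class_def)
  have carrier: "?cls a \<in> carrier (milnor_algebra f)" for a
    by (auto simp: milnor_algebra_def FactRing_def milnor_class_def A_RCOSETS_def')
  interpret K: Ring.field "ring_of_type_algebra :: 'a ring" by (rule field_from_type_algebra)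
  interpret H: ring_hom_ring "ring_of_type_algebra :: 'a ring" "milnor_algebra f" "\<lambda>c. ?cls (cst c)"
  proof (rule ring_hom_ringI2[OF K.ring_axioms R.ring_axioms], rule ring_hom_memI)
    show "?cls (cst (x \<otimes>\<^bsub>ring_of_type_algebra\<^esub> y)) = ?cls (cst x) \<otimes>\<^bsub>milnor_algebra f\<^esub> ?cls (cst y)" for x y :: 'a
      by (simp add: milnor_algebra_mult mult_single) (simp add: ring_of_type_algebra_def)
    show "?cls (cst (x \<oplus>\<^bsub>ring_of_type_algebra\<^esub> y)) = ?cls (cst x) \<oplus>\<^bsub>milnor_algebra f\<^esub> ?cls (cst y)" for x y :: 'a
      by (simp add: milnor_algebra_add flip: single_add) (simp add: ring_of_type_algebra_def)
    show "?cls (cst \<one>\<^bsub>ring_of_type_algebra :: 'a ring\<^esub>) = \<one>\<^bsub>milnor_algebra f\<^esub>"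
      unfolding one by (simp add: ring_of_type_algebra_def)
  qed (rule carrier)
  have sub: "subfield (milnor_scalars f) (milnor_algebra f)"
  proof -
    have "\<one>\<^bsub>milnor_algebra f\<^esub> \<noteq> \<zero>\<^bsub>milnor_algebra f\<^esub>"
      unfolding one zero milnor_class_eq_iff using assms by simp
    from H.img_is_subfield(2)[OF K.carrier_is_subfield this]
    show ?thesis by (simp add: milnor_scalars_def ring_of_type_algebra_def)
  qed
  define W where "W = J \<inter> forms k"
  have W: "poly3.subspace W" unfolding W_def J_def by (intro poly3.subspace_inter subspace_combos subspace_forms)
  obtain A where A: "A \<subseteq> W" "poly3.independent A" "W \<subseteq> poly3.span A"
    by (rule poly3.maximal_independent_subset[of W])
  then have sA: "poly3.span A = W" using poly3.span_minimal[OF A(1) W] by blast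
  have "A \<subseteq> forms k" using A(1) by (auto simp: W_def)
  then obtain C where C: "A \<subseteq> C" "C \<subseteq> forms k" "poly3.independent C" "forms k \<subseteq> poly3.span C"
    using A(2) by (rule poly3.maximal_independent_subset_extend)
  have sC: "poly3.span C = forms k" using C(4) poly3.span_minimal[OF C(2) subspace_forms] by blast
  have "finite ((\<lambda>m. single m (1 :: 'a)) ` {m. monom_degree m = k})" using finite_monomials by simp
  from poly3.independent_span_bound[OF this C(3)] have fC: "finite C"
    using C(2) forms_subset_span by blast
  \<comment> \<open>\<open>A\<close> already spans the kernel in this degree, so a further
    independent form has a class outside the image built so far.\<close>
  have dims: "R.dimension (card B) (milnor_scalars f) (?cls ` poly3.span (A \<union> B))"
    if "finite B" "A \<inter> B = {}" "poly3.independent (A \<union> B)" "A \<union> B \<subseteq> forms k" for B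
    using that
  proof (induction B)
    case empty
    have "?cls ` W = {?cls 0}"
    proof -
      have "?cls w = ?cls 0" if "w \<in> W" for w using that unfolding milnor_class_eq_iff W_def J_def by simp
      moreover have "0 \<in> W" using W by (rule poly3.subspace_0)
      ultimately show ?thesis by blast
    qed
    then show ?case using R.zero_dim[of "milnor_scalars f"] by (simp add: sA zero)
  next
    case (insert b B)
    let ?S = "poly3.span (A \<union> B)"
    have bA: "b \<notin> A \<union> B" using insert by auto
    have indep: "poly3.independent (insert b (A \<union> B))" using insert.prems by simp
    then have b: "b \<notin> ?S" and iAB: "poly3.independent (A \<union> B)"
      using bA by (auto simp: poly3.independent_insert)
    have SF: "?S \<subseteq> forms k" using insert.prems(3) by (intro poly3.span_minimal subspace_forms) auto
    have bF: "b \<in> forms k" using insert.prems(3) by simp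
    have "?cls b \<notin> ?cls ` ?S"
    proof
      assume "?cls b \<in> ?cls ` ?S"
      then obtain w where w: "w \<in> ?S" "b - w \<in> J" unfolding J_def using milnor_class_eq_iff by blast
      have "b - w \<in> W" unfolding W_def using w SF bF by (auto intro: forms_diff)
      then have "b - w \<in> ?S" using sA poly3.span_mono[of A "A \<union> B"] by blast
      from poly3.span_add[OF this w(1)] b show False by simp
    qed
    moreover have "R.dimension (card B) (milnor_scalars f) (?cls ` ?S)"
      using insert iAB by auto
    ultimately have "R.dimension (Suc (card B)) (milnor_scalars f) (R.line_extension (milnor_scalars f) (?cls b) (?cls ` ?S))"
      by (intro R.Suc_dim carrier)
    moreover have "R.line_extension (milnor_scalars f) (?cls b) (?cls ` ?S) = ?cls ` poly3.span (A \<union> insert b B)"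
    proof -
      have ext: "u \<in> R.line_extension (milnor_scalars f) (?cls b) (?cls ` ?S) \<longleftrightarrow>
          (\<exists>c. \<exists>w\<in>?S. u = ?cls (cst c * b + w))" for u
        unfolding R.line_extension_mem_iff milnor_scalars_def
        by (auto simp: milnor_algebra_mult milnor_algebra_add)
      have span: "x \<in> poly3.span (A \<union> insert b B) \<longleftrightarrow> (\<exists>c. \<exists>w\<in>?S. x = cst c * b + w)" for x
      proof -
        have "x \<in> poly3.span (insert b (A \<union> B)) \<longleftrightarrow> (\<exists>c. x - cst c * b \<in> ?S)"
          unfolding poly3.span_insert by simp
        also have "\<dots> \<longleftrightarrow> (\<exists>c. \<exists>w\<in>?S. x = cst c * b + w)"
          by (intro iff_exI) (metis add_diff_cancel_left' add.commute diff_add_cancel)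
        finally show ?thesis by simp
      qed
      show ?thesis
      proof (rule Set.set_eqI)
        fix u
        have "u \<in> ?cls ` poly3.span (A \<union> insert b B) \<longleftrightarrow> (\<exists>x. x \<in> poly3.span (A \<union> insert b B) \<and> u = ?cls x)"
          by (auto simp: image_iff)
        also have "\<dots> \<longleftrightarrow> (\<exists>c. \<exists>w\<in>?S. u = ?cls (cst c * b + w))" unfolding span by blast
        finally show "u \<in> R.line_extension (milnor_scalars f) (?cls b) (?cls ` ?S) \<longleftrightarrow> u \<in> ?cls ` poly3.span (A \<union> insert b B)"
          unfolding ext by blast
      qed
    qed
    ultimately show ?case using insert.hyps by simp
  qed
  have "A \<union> (C - A) = C" using C(1) by blast
  with dims[of "C - A"] fC C have "R.dimension (card (C - A)) (milnor_scalars f) (milnor_part f k)"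
    by (simp add: sC milnor_part_def)
  from R.dimI[OF sub this] have "milnor_dim f k = card (C - A)"
    by (simp add: milnor_dim_def over_def)
  moreover have "poly3.dim W = card A" using poly3.basis_card_eq_dim[OF A(1) A(3) A(2)] by simp
  moreover have "poly3.dim (forms k :: 'a poly3 set) = card C" using poly3.basis_card_eq_dim[OF C(2) C(4) C(3)] by simp
  moreover have "card (C - A) + card A = card C"
    using C(1) fC by (metis add.commute card_Diff_subset card_mono finite_subset le_add_diff_inverse)
  ultimately show ?thesis by (simp add: W_def J_def)
qed

definition no_syzygy :: "nat \<Rightarrow> (3 \<Rightarrow> 'a::comm_ring_1 poly3) \<Rightarrow> bool" where
  "no_syzygy k g \<longleftrightarrow> (\<forall>b j. (\<forall>j. b j \<in> forms k) \<longrightarrow> (\<Sum>j\<in>UNIV. b j * g j) = 0 \<longrightarrow> b j = 0)"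

text \<open>This graded piece of the ideal is the image of triples of forms of degree
  \<open>k\<close>, a space of dimension \<open>3 * card {m. monom_degree m = k}\<close>; the kernel
  consists of the syzygies.\<close>

lemma dim_combos_forms:
  fixes g :: "3 \<Rightarrow> 'a::field poly3"
  assumes "\<And>j. g j \<in> forms e"
  shows "poly3.dim (combos g \<inter> forms (k + e)) \<le> 3 * card {m. monom_degree m = k}" (is "?le")
    and "poly3.dim (combos g \<inter> forms (k + e)) = 3 * card {m. monom_degree m = k} \<longleftrightarrow> no_syzygy k g"
proof -
  let ?M = "{m. monom_degree m = k}"
  define I where "I = (UNIV :: 3 set) \<times> ?M"
  define \<phi> where "\<phi> = (\<lambda>(j, m). single m 1 * g j)"
  have fI: "finite I" "card I = 3 * card ?M" using finite_monomials by (simp_all add: I_def card_cartesian_product)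
  have expand: "(\<Sum>j\<in>UNIV. C j * g j) = (\<Sum>i\<in>I. cst (lookup (C (fst i)) (snd i)) * \<phi> i)"
    if "\<And>j. C j \<in> forms k" for C
  proof -
    have "C j * g j = (\<Sum>m\<in>?M. cst (lookup (C j) m) * (single m 1 * g j))" for j
      by (subst forms_expand[OF that[of j]]) (simp add: sum_distrib_right mult.assoc)
    then show ?thesis by (simp add: I_def \<phi>_def sum.cartesian_product case_prod_unfold)
  qed
  have \<phi>_mem: "\<phi> i \<in> combos g \<inter> forms (k + e)" if "i \<in> I" for i
    using that assms unfolding I_def \<phi>_def
    by (auto intro!: combos_mult combos_generator forms_mult forms_single)
  have span: "poly3.span (\<phi> ` I) = combos g \<inter> forms (k + e)"
  proof
    show "poly3.span (\<phi> ` I) \<subseteq> combos g \<inter> forms (k + e)"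
      using \<phi>_mem by (intro poly3.span_minimal poly3.subspace_inter subspace_combos subspace_forms) auto
    show "combos g \<inter> forms (k + e) \<subseteq> poly3.span (\<phi> ` I)"
    proof
      fix p assume p: "p \<in> combos g \<inter> forms (k + e)"
      then obtain C where C: "\<And>j. C j \<in> forms k" "p = (\<Sum>j\<in>UNIV. C j * g j)"
        using combos_forms(2)[of p g "k + e" e] assms by auto
      show "p \<in> poly3.span (\<phi> ` I)"
        unfolding C(2) expand[OF C(1)]
        by (rule poly3.span_sum, rule poly3.span_scale, rule poly3.span_base, rule imageI)
    qed
  qed
  have "poly3.dim (combos g \<inter> forms (k + e)) \<le> card (\<phi> ` I)"
    using fI(1) by (intro poly3.dim_le_card) (simp_all add: span)
  also have "\<dots> \<le> card I" by (rule card_image_le[OF fI(1)])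
  finally show ?le by (simp add: fI)
  show "poly3.dim (combos g \<inter> forms (k + e)) = 3 * card {m. monom_degree m = k} \<longleftrightarrow> no_syzygy k g"
  proof
    assume no: "no_syzygy k g"
    have indep: "u i = 0" if u: "(\<Sum>i\<in>I. cst (u i) * \<phi> i) = 0" and i: "i \<in> I" for u i
    proof -
      define C where "C j = (\<Sum>m\<in>?M. single m (u (j, m)))" for j
      have lC: "lookup (C j) m = u (j, m)" if "m \<in> ?M" for j m
        using that finite_monomials by (simp add: C_def lookup_sum lookup_single when_def)
      have C: "C j \<in> forms k" for j unfolding C_def by (auto intro!: forms_sum forms_single)
      have "(\<Sum>j\<in>UNIV. C j * g j) = (\<Sum>i\<in>I. cst (u i) * \<phi> i)"
        unfolding expand[OF C] by (rule sum.cong) (auto simp: I_def lC)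
      with u have "(\<Sum>j\<in>UNIV. C j * g j) = 0" by simp
      with no C have "C (fst i) = 0" unfolding no_syzygy_def by blast
      with lC[of "snd i" "fst i"] i show ?thesis by (auto simp: I_def)
    qed
    \<comment> \<open>Independence below concerns the set of products, so coincidences must be
      excluded: they are relations with coefficients \<open>1\<close> and
      \<open>- 1\<close>.\<close>
    have inj: "inj_on \<phi> I"
    proof (rule inj_onI, rule ccontr)
      fix i i' assume i: "i \<in> I" "i' \<in> I" "\<phi> i = \<phi> i'" "i \<noteq> i'"
      define u where "u = (\<lambda>x. if x = i then 1 else if x = i' then - 1 else 0 :: 'a)"
      have "(\<Sum>x\<in>I. cst (u x) * \<phi> x) = (\<Sum>x\<in>{i, i'}. cst (u x) * \<phi> x)"
        using fI(1) i by (intro sum.mono_neutral_right) (auto simp: u_def)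
      also have "\<dots> = 0" using i by (simp add: u_def single_uminus)
      finally have "u i = 0" using i(1) by (rule indep)
      then show False by (simp add: u_def)
    qed
    have "poly3.independent (\<phi> ` I)"
    proof (rule poly3.independent_if_scalars_zero)
      fix h x assume h: "(\<Sum>x\<in>\<phi> ` I. cst (h x) * x) = 0" and x: "x \<in> \<phi> ` I"
      then obtain i where i: "i \<in> I" "x = \<phi> i" by blast
      have "(\<Sum>i\<in>I. cst (h (\<phi> i)) * \<phi> i) = 0" using h by (simp add: sum.reindex[OF inj])
      from indep[OF this i(1)] show "h x = 0" by (simp add: i)
    qed (use fI in simp)
    from poly3.dim_span_eq_card_independent[OF this]
    show "poly3.dim (combos g \<inter> forms (k + e)) = 3 * card {m. monom_degree m = k}"
      by (simp add: span card_image[OF inj] fI)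
  next
    assume dim: "poly3.dim (combos g \<inter> forms (k + e)) = 3 * card {m. monom_degree m = k}"
    show "no_syzygy k g"
      unfolding no_syzygy_def
    proof (intro allI impI, rule ccontr)
      fix b j assume b: "\<forall>j. b j \<in> forms k" "(\<Sum>j\<in>UNIV. b j * g j) = 0" and "b j \<noteq> 0"
      then obtain m where m: "lookup (b j) m \<noteq> 0" by (metis lookup_zero poly_mapping_eqI)
      then have i: "(j, m) \<in> I" using lookup_forms[of "b j" k m] b(1) by (auto simp: I_def)
      let ?I = "I - {(j, m)}"
      let ?c = "lookup (b j) m"
      have "cst ?c * \<phi> (j, m) + (\<Sum>i\<in>?I. cst (lookup (b (fst i)) (snd i)) * \<phi> i) = 0"
      proof -
        have "(\<Sum>i\<in>I. cst (lookup (b (fst i)) (snd i)) * \<phi> i) = 0"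
          using b expand[of b] by simp
        then show ?thesis unfolding sum.remove[OF fI(1) i] by simp
      qed
      then have "cst ?c * \<phi> (j, m) = - (\<Sum>i\<in>?I. cst (lookup (b (fst i)) (snd i)) * \<phi> i)"
        by (simp add: eq_neg_iff_add_eq_0)
      then have "cst ?c * \<phi> (j, m) \<in> poly3.span (\<phi> ` ?I)"
        by (simp only:) (rule poly3.span_neg, rule poly3.span_sum, rule poly3.span_scale, rule poly3.span_base, rule imageI)
      from poly3.span_scale[OF this, of "inverse ?c"] m have "\<phi> (j, m) \<in> poly3.span (\<phi> ` ?I)"
        by (simp add: mult_single flip: mult.assoc)
      then have "\<phi> ` I \<subseteq> poly3.span (\<phi> ` ?I)" by (auto intro: poly3.span_base)
      then have "poly3.span (\<phi> ` I) \<subseteq> poly3.span (\<phi> ` ?I)"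
        by (intro poly3.span_minimal) simp_all
      then have "poly3.dim (combos g \<inter> forms (k + e)) \<le> card (\<phi> ` ?I)"
        unfolding span using fI(1) by (intro poly3.dim_le_card) simp_all
      also have "\<dots> \<le> card ?I" using fI(1) by (intro card_image_le) simp
      also have "\<dots> < card I" using fI(1) i by (rule card_Diff1_less)
      finally show False using dim fI by simp
    qed
  qed
qed

lemma one_not_in_jacobian_ideal:
  fixes f :: "'a::field poly3"
  assumes "d \<ge> 2" "f \<in> forms d"
  shows "1 \<notin> combos (partials f)"
proof
  assume one: "1 \<in> combos (partials f)"
  have "(1 :: 'a poly3) \<in> forms 0" by (simp flip: single_one)
  from combos_forms(1)[OF one this partial_deriv_forms[OF assms(2)]] assms(1) show False by simp
qed

lemma milnor_dim_eq_low:
  fixes f f' :: "'a::field poly3"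
  assumes "d \<ge> 2" "f \<in> forms d" "f' \<in> forms d" "k < d - 1"
  shows "milnor_dim f k = milnor_dim f' k"
proof -
  have "combos (partials p) \<inter> forms k = {0}" if "p \<in> forms d" for p :: "'a poly3"
    using combos_forms(1)[of _ "partials p" k "d - 1"] partial_deriv_forms[OF that] assms(4)
      combos_mult[OF combos_generator, of 0 "partials p"] by auto
  then show ?thesis
    using milnor_dim_add[OF one_not_in_jacobian_ideal[OF assms(1,2)], of k]
      milnor_dim_add[OF one_not_in_jacobian_ideal[OF assms(1,3)], of k] assms(2,3) by simp
qed

text \<open>The smooth form has no syzygy below the Koszul degree \<open>d - 1\<close>, so its
  Jacobian ideal has the maximal dimension; equality says that the ideal of \<open>f\<close> attains
  it as well.\<close>

lemma milnor_dim_eq_iff: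
  fixes f fs :: "'a::field_char_0 poly3"
  assumes "d \<ge> 2" "f \<in> forms d" "fs \<in> forms d" "smooth_curve fs" "k < d - 1"
  shows "milnor_dim f (k + (d - 1)) = milnor_dim fs (k + (d - 1)) \<longleftrightarrow> no_syzygy k (partials f)"
proof -
  have "no_syzygy k (partials fs)"
    unfolding no_syzygy_def using smooth_curve_no_low_syzygy[OF assms(4,3) _ assms(5)] by blast
  then show ?thesis
    using milnor_dim_add[OF one_not_in_jacobian_ideal[OF assms(1,2)], of "k + (d - 1)"]
      milnor_dim_add[OF one_not_in_jacobian_ideal[OF assms(1,3)], of "k + (d - 1)"]
      dim_combos_forms[of "partials f" "d - 1" k] dim_combos_forms[of "partials fs" "d - 1" k]
      partial_deriv_forms[OF assms(2)] partial_deriv_forms[OF assms(3)]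
    by auto
qed

lemma coincidence_threshold_ge_iff:
  fixes f fs :: "'a::field_char_0 poly3"
  assumes "\<not> smooth_curve f" "milnor_dim f 0 = milnor_dim fs 0"
  shows "coincidence_threshold f fs \<ge> enat q \<longleftrightarrow> (\<forall>k\<le>q. milnor_dim f k = milnor_dim fs k)"
proof -
  let ?S = "{enat q | q. \<forall>k\<le>q. milnor_dim f k = milnor_dim fs k}"
  have ct: "coincidence_threshold f fs = Sup ?S" using assms(1) by (simp add: coincidence_threshold_def)
  show ?thesis
  proof
    assume "\<forall>k\<le>q. milnor_dim f k = milnor_dim fs k"
    then show "coincidence_threshold f fs \<ge> enat q" unfolding ct by (intro Sup_upper) blast
  next
    assume ge: "coincidence_threshold f fs \<ge> enat q"
    show "\<forall>k\<le>q. milnor_dim f k = milnor_dim fs k"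
    proof (cases q)
      \<comment> \<open>Here the inequality carries no information, since the supremum of the empty
        set is \<open>0\<close> in \<open>enat\<close>; the assumption in degree zero steps
        in.\<close>
      case 0
      with assms(2) show ?thesis by simp
    next
      case (Suc q')
      have "\<exists>x\<in>?S. enat q' < x"
      proof (rule ccontr)
        assume "\<not> ?thesis"
        then have "Sup ?S \<le> enat q'" by (intro Sup_least) (auto simp: not_less)
        with ge show False unfolding ct Suc by (meson enat_ord_simps(1) not_less_eq_eq order.refl order.trans)
      qed
      then show ?thesis unfolding Suc by auto
    qed
  qed
qed

text \<open>The open set is chosen after deciding whether \<open>stable\<close> holds. Surjectivity
  in the one case and its failure in the other then hold for every form of the set, so each of them
  satisfies the equivalence.\<close>

theorem corollary4p4:
  fixes f :: "'a::field_char_0 poly3" and d i0 :: nat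
  assumes "d \<ge> 2" and "f \<in> forms d" and "squarefree f"
    and "i0 = nat \<lfloor>(3 * real d - 6) / 2\<rfloor>"
  shows "\<exists>U. zariski_open_forms1 U \<and> U \<noteq> {} \<and>
    (\<forall>l\<in>U.
       (\<forall>i. real i < (3 * real d - 6) / 2 \<longrightarrow>
          milnor_mult f l ` milnor_part f i \<subseteq> milnor_part f (i + 1) \<and>
          inj_on (milnor_mult f l) (milnor_part f i)) \<and>
       (\<forall>fs\<in>forms d. smooth_curve fs \<longrightarrow>
          ((\<forall>i\<ge>i0. milnor_mult f l ` milnor_part f i = milnor_part f (i + 1)) \<longleftrightarrow>
           coincidence_threshold f fs \<ge> enat (3 * (d - 2) - i0))))"
proof -
  define e where "e = d - 1"
  define g where "g = (partials f)"
  have e: "e \<ge> 1" "d = Suc e" using assms(1) by (simp_all add: e_def)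
  interpret net g e
    unfolding g_def e_def by (rule net_partials) (use assms in auto)
  \<comment> \<open>Thus \<open>i0 + 1\<close> is the degree in which \<open>lines_span\<close> is
    stated.\<close>
  have i0: "i0 = (e - 1) div 2 + e - 1"
  proof -
    have "(3 * real d - 6) / 2 = real (3 * e - 3) / real 2" using e by (simp add: of_nat_diff)
    then have "i0 = (3 * e - 3) div 2" unfolding assms(4) by (simp only: floor_divide_of_nat_eq nat_int)
    also have "\<dots> = (e - 1) div 2 + e - 1" using e(1) by linarith
    finally show ?thesis .
  qed
  have stable_iff: "stable \<longleftrightarrow> (\<forall>k. 2 * k + 2 \<le> e \<longrightarrow> no_syzygy k g)"
    unfolding stable_def no_syzygy_def syzygy_def by blast
  obtain \<delta> where \<delta>: "\<delta> \<noteq> 0"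
    and lines: "\<And>u v. at_line u v \<delta> \<noteq> 0 \<Longrightarrow> lines_lift u v \<and> (lines_span u v \<longleftrightarrow> stable)"
  proof (cases stable)
    case True
    from True e(1) obtain \<delta> where "\<delta> \<noteq> 0" "\<And>u v. at_line u v \<delta> \<noteq> 0 \<Longrightarrow> lines_lift u v \<and> lines_span u v"
      by (rule stable_lines) blast
    with True show thesis by (intro that[of \<delta>]) auto
  next
    case False
    then obtain \<delta> where "\<delta> \<noteq> 0" "\<And>u v. at_line u v \<delta> \<noteq> 0 \<Longrightarrow> lines_lift u v \<and> \<not> lines_span u v"
      by (rule unstable_lines) blast
    with False show thesis by (intro that[of \<delta>]) auto
  qed
  obtain U where U: "zariski_open_forms1 U" "U \<noteq> {}"
    and generic: "\<And>l. l \<in> U \<Longrightarrow> \<exists>c u v. c \<noteq> 0 \<and> l = cst c * line_form u v \<and> at_line u v \<delta> \<noteq> 0"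
    by (rule generic_linear_forms[OF \<delta>]) blast
  show ?thesis
  proof (intro exI[of _ U] conjI U, rule ballI, rule conjI)
    fix l assume "l \<in> U"
    then obtain c u v where c: "c \<noteq> 0" and l: "l = cst c * line_form u v" and uv: "at_line u v \<delta> \<noteq> 0"
      using generic by blast
    have lf: "l \<in> forms (Suc 0)" unfolding l by (intro forms_cst_mult line_form_forms)
    have inv: "cst (inverse c) * (cst c * p) = p" for p :: "'a poly3"
      using c by (simp add: mult_single flip: mult.assoc)
    show "\<forall>i. real i < (3 * real d - 6) / 2 \<longrightarrow>
        milnor_mult f l ` milnor_part f i \<subseteq> milnor_part f (i + 1) \<and> inj_on (milnor_mult f l) (milnor_part f i)"
    proof (intro allI impI conjI milnor_mult_part_subset[OF lf] inj_on_milnor_mult)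
      fix i x assume i: "real i < (3 * real d - 6) / 2" and x: "x \<in> forms i"
        and lx: "l * x \<in> combos (partials f)"
      have "real (2 * i + 6) < real (3 * d)" using i by (simp add: field_simps)
      then have "2 * i + 6 < 3 * d" by (simp only: of_nat_less_iff)
      then have i': "2 * i + 4 \<le> 3 * e" using e(2) by linarith
      have "cst (inverse c) * (l * x) = line_form u v * x" unfolding l by (simp only: mult.assoc inv)
      with combos_mult[OF lx, of "cst (inverse c)"] have "line_form u v * x \<in> combos g" by (simp add: g_def)
      with lines[OF uv] x i' show "x \<in> combos (partials f)"
        using line_form_mult_injective[of u v x i] by (simp add: g_def)
    qed
    have surj_iff: "(\<forall>i\<ge>i0. milnor_mult f l ` milnor_part f i = milnor_part f (i + 1)) \<longleftrightarrow> stable"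
    proof -
      have eq: "milnor_mult f l ` milnor_part f i = milnor_part f (i + 1) \<longleftrightarrow>
          (\<forall>y\<in>forms (Suc i). \<exists>x\<in>forms i. y - line_form u v * x \<in> combos g)" for i
        unfolding milnor_mult_surjective_iff[OF lf] g_def[symmetric]
      proof (intro ball_cong refl iffI)
        fix y :: "'a poly3"
        assume "\<exists>x\<in>forms i. y - l * x \<in> combos g"
        then obtain x where "x \<in> forms i" "y - line_form u v * (cst c * x) \<in> combos g"
          unfolding l by (auto simp: mult_ac)
        then show "\<exists>x\<in>forms i. y - line_form u v * x \<in> combos g" using forms_cst_mult by blast
      next
        fix y :: "'a poly3"
        assume "\<exists>x\<in>forms i. y - line_form u v * x \<in> combos g"
        then obtain x where x: "x \<in> forms i" "y - line_form u v * x \<in> combos g" by blast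
        have "l * (cst (inverse c) * x) = line_form u v * x"
          unfolding l using inv[of "line_form u v * x"] by (simp only: mult_ac)
        with x show "\<exists>x\<in>forms i. y - l * x \<in> combos g" using forms_cst_mult[OF x(1)] by metis
      qed
      show ?thesis
      proof
        assume all: "\<forall>i\<ge>i0. milnor_mult f l ` milnor_part f i = milnor_part f (i + 1)"
        have Si0: "Suc i0 = (e - 1) div 2 + e" using e(1) by (simp add: i0)
        have "lines_span u v"
          using e(1)
        proof (rule lines_span_of_surjective)
          fix y :: "'a poly3" assume "y \<in> forms ((e - 1) div 2 + e)"
          with all eq[of i0] show "\<exists>x. y - line_form u v * x \<in> combos g \<and> x \<in> forms ((e - 1) div 2 + e - 1)"
            unfolding Si0 i0[symmetric] by blast
        qed
        with lines[OF uv] show stable by blast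
      next
        assume stable
        with lines[OF uv] have "lines_span u v" by blast
        from line_form_mult_surjective[OF this e(1)]
        show "\<forall>i\<ge>i0. milnor_mult f l ` milnor_part f i = milnor_part f (i + 1)"
          unfolding eq i0 by blast
      qed
    qed
    show "\<forall>fs\<in>forms d. smooth_curve fs \<longrightarrow>
        ((\<forall>i\<ge>i0. milnor_mult f l ` milnor_part f i = milnor_part f (i + 1)) \<longleftrightarrow>
         coincidence_threshold f fs \<ge> enat (3 * (d - 2) - i0))"
    proof (intro ballI impI)
      fix fs :: "'a poly3" assume fs: "fs \<in> forms d" "smooth_curve fs"
      define q where "q = 3 * (d - 2) - i0"
      \<comment> \<open>A syzygy of degree \<open>k\<close> shows in the dimension in degree
        \<open>k + e\<close>; the degrees up to \<open>q\<close> see exactly those that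
        \<open>stable\<close> forbids.\<close>
      have q: "k + e \<le> q \<longleftrightarrow> 2 * k + 2 \<le> e" for k using e unfolding q_def i0 by auto
      have "coincidence_threshold f fs \<ge> enat q \<longleftrightarrow> stable"
      proof (cases "smooth_curve f")
        case True
        have "no_syzygy k g" if "2 * k + 2 \<le> e" for k
        proof -
          have "k < d - 1" using that by (simp add: e_def)
          with smooth_curve_no_low_syzygy[OF True assms(2)] show ?thesis
            unfolding no_syzygy_def g_def by blast
        qed
        then have "stable" using stable_iff by blast
        with True show ?thesis by (simp add: coincidence_threshold_def)
      next
        case False
        have "milnor_dim f 0 = milnor_dim fs 0"
          using assms(1,2) fs(1) by (intro milnor_dim_eq_low[of d]) auto
        from coincidence_threshold_ge_iff[OF False this]
        have "coincidence_threshold f fs \<ge> enat q \<longleftrightarrow> (\<forall>k\<le>q. milnor_dim f k = milnor_dim fs k)" .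
        also have "\<dots> \<longleftrightarrow> (\<forall>k. k + e \<le> q \<longrightarrow> milnor_dim f (k + e) = milnor_dim fs (k + e))"
        proof (intro iffI allI impI)
          fix k assume *: "\<forall>k. k + e \<le> q \<longrightarrow> milnor_dim f (k + e) = milnor_dim fs (k + e)" "k \<le> q"
          show "milnor_dim f k = milnor_dim fs k"
          \<comment> \<open>Below degree \<open>e\<close> both Jacobian ideals are zero, so only the
            degrees \<open>k + e\<close> carry a condition.\<close>
          proof (cases "k < e")
            case True
            then show ?thesis using assms(1,2) fs(1) by (intro milnor_dim_eq_low[of d]) (auto simp: e_def)
          next
            case False
            with *(1)[rule_format, of "k - e"] *(2) show ?thesis by simp
          qed
        qed blast
        also have "\<dots> \<longleftrightarrow> stable"
        proof -
          have "milnor_dim f (k + e) = milnor_dim fs (k + e) \<longleftrightarrow> no_syzygy k g" if "2 * k + 2 \<le> e" for k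
            using milnor_dim_eq_iff[OF assms(1,2) fs, of k] that by (simp add: e_def g_def)
          then show ?thesis unfolding stable_iff q by blast
        qed
        finally show ?thesis .
      qed
      then show "(\<forall>i\<ge>i0. milnor_mult f l ` milnor_part f i = milnor_part f (i + 1)) \<longleftrightarrow>
          coincidence_threshold f fs \<ge> enat (3 * (d - 2) - i0)"
        unfolding surj_iff q_def ..
    qed
  qed
qed

end
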